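(* Let $R$ be a commutative ring with unit. For every oriented virtual link diagram $K$, the complex $[[K]]$ with coefficients in $R$ is well-defined; that is, $\partial\circ\partial=0$ for the differential $\partial$ described in the context.
   Context: Virtual diagrams. A virtual diagram is a four-valent graph immersed generically in the plane (possibly with closed components without vertices) in which each crossing is either classical (with over/under information) or virtual (no extra structure). State cube. Let $K$ be an oriented virtual diagram with $n$ classical crossings, enumerated arbitrarily. Each classical crossing can be smoothed in two ways: the $A$-smoothing joins the two regions (locally at the crossing) swept out by rotating the overcrossing strand counterclockwise to the undercrossing strand, and the $B$-smoothing joins the other two. (Thus at a positive crossing the $A$-smoothing is the one respecting the orientation, and at a negative crossing the $B$-smoothing is.) A state is a vertex $s\in\{0,1\}^n$, with $0$ meaning $A$-smoothing and $1$ meaning $B$-smoothing. Its circles are the closed curves obtained after smoothing all classical crossings according to $s$, where virtual crossings are ignored (curves go straight through them). The height of $s$ is its number of $1$'s. Edges of the cube change one coordinate from $0$ to $1$. Along an edge the two arcs at the corresponding crossing are resmoothed, so either two circles merge into one ($2\to1$), or one circle splits into two ($1\to2$), or one circle is transformed into one circle ($1\to1$); all other circles are unchanged. Chain spaces. To each circle $C$ of a state associate the free rank-2 $R$-module $V_C$ with basis $1$ and $X_{C,o}$, where $o$ is an orientation of $C$, and $X_{C,-o}=-X_{C,o}$ for the opposite orientation $-o$. To a state $s$ with circles $C_1,\dots,C_k$ associate the ordered tensor product $C_s$ of $V_{C_1},\dots,V_{C_k}$. It is the module generated by the tensor products in all orders of the factors, modulo the identification that permuting the factors by $\sigma$ multiplies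 by $\mathrm{sign}(\sigma)$. Its elements are written $p^1_{C_{a_1}}\wedge\dots\wedge p^k_{C_{a_k}}$, with $p_{C_i}\wedge q_{C_j}=-q_{C_j}\wedge p_{C_i}$ for different circles. It is free of rank $2^k$; $X\wedge X$ with factors in two different spaces is nonzero. The chain space of $[[K]]$ in height $i$ is $\bigoplus_{s} C_s$ over the states $s$ of height $i$. Local conventions at a crossing. At each classical crossing $v$, rotate the picture so that both strands are oriented upwards; this gives upper-left, upper-right, lower-left and lower-right half-edges at $v$. Orient the upper-right and lower-left half-edges away from $v$, and the upper-left and lower-right half-edges towards $v$. For an edge of the cube at $v$ of type $2\to1$ or $1\to2$, these local directions are compatible and orient every circle incident to $v$ in both states of the edge. For such a circle, $X$ (in the formulas below) denotes the generator $X_{C,o}$ for this orientation $o$. When two different circles are incident to $v$ in one state, they are numbered locally as first and second: the upper one is first and the lower one second if the smoothing at $v$ consists of an upper and a lower arc; the left one is first and the right one second if the smoothing consists of a left and a right arc. Partial differentials. The partial differential along an edge of type $1\to1$ is zero. Along an edge of type $2\to1$, rewrite elements (with the appropriate permutation sign) so that the first and the second circle occupy the first and second position, and replace these two factors by their image, put in first position, under $$m(1_1\wedge1_2)=1,\quad m(X_1\wedge1_2)=m(1_1\wedge X_2)=X,\quad m(X_1\wedge X_2)=0.$$ Along an edge of type $1\to2$, rewrite elements so that the splitting circle occupies the first position, and replace this factor by its image, put in the first two positions, under $$\Delta(1)=1_1\wedge X_2+X_1\wedge1_2,\quad \Delta(X)=X_1\wedge X_2,$$ where the indices $1,2$ denote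 the locally first and second circle. All remaining factors are left unchanged and in the same order. The differential $\partial$ of $[[K]]$ is the sum of the partial differentials over all edges of the cube (no further signs are inserted). *)

theory Defs
  imports
    "HOL-Analysis.Analysis"
    "HOL-Library.Poly_Mapping"
    "HOL-Combinatorics.Permutations"
begin

section \<open>Virtual diagrams\<close>

text \<open>
  The plane is \<^typ>\<open>complex\<close>.  An oriented virtual diagram is a finite family of closed
  curves (indexed by \<open>i < num_comps K\<close>, each a 1-periodic function on the real line) that is
  generically immersed, together with an enumeration \<open>k < num_cross K\<close> of those double points that
  are classical; \<open>over K k\<close> and \<open>under K k\<close> are the two preimages of the \<open>k\<close>-th one.  All other
  double points are virtual crossings.  A preimage is a pair of a component and a
  parameter in \<open>[0,1)\<close>.
\<close>

type_synonym point = "nat \<times> real"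

record vdiagram =
  num_comps :: nat
  curve :: "nat \<Rightarrow> real \<Rightarrow> complex"
  num_cross :: nat
  over :: "nat \<Rightarrow> point"
  under :: "nat \<Rightarrow> point"

definition points :: "vdiagram \<Rightarrow> point set" where
  "points K = {..<num_comps K} \<times> {0..<1}"

definition pos :: "vdiagram \<Rightarrow> point \<Rightarrow> complex" where
  "pos K p = curve K (fst p) (snd p)"

definition tangent :: "vdiagram \<Rightarrow> point \<Rightarrow> complex" where
  "tangent K p = vector_derivative (curve K (fst p)) (at (snd p))"

text \<open>The determinant of the pair of plane vectors \<open>(u, v)\<close>: it is positive iff \<open>v\<close> points to
  the left of \<open>u\<close>.\<close>

definition det2 :: "complex \<Rightarrow> complex \<Rightarrow> real" where
  "det2 u v = Re u * Im v - Im u * Re v"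

definition generic_immersion :: "vdiagram \<Rightarrow> bool" where
  "generic_immersion K \<longleftrightarrow>
     (\<forall>i<num_comps K. curve K i C1_differentiable_on UNIV
        \<and> (\<forall>t. curve K i (t + 1) = curve K i t)
        \<and> (\<forall>t. vector_derivative (curve K i) (at t) \<noteq> 0))
   \<and> finite {p \<in> points K. \<exists>q\<in>points K. q \<noteq> p \<and> pos K q = pos K p}
   \<and> (\<forall>p\<in>points K. \<forall>q\<in>points K. p \<noteq> q \<and> pos K p = pos K q \<longrightarrow>
        det2 (tangent K p) (tangent K q) \<noteq> 0)
   \<and> (\<forall>p\<in>points K. \<forall>q\<in>points K. \<forall>r\<in>points K.
        pos K p = pos K q \<and> pos K q = pos K r \<longrightarrow> p = q \<or> q = r \<or> p = r)"

definition virtual_diagram :: "vdiagram \<Rightarrow> bool" where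
  "virtual_diagram K \<longleftrightarrow> generic_immersion K
   \<and> (\<forall>k<num_cross K. over K k \<in> points K \<and> under K k \<in> points K
        \<and> over K k \<noteq> under K k \<and> pos K (over K k) = pos K (under K k))
   \<and> inj_on (\<lambda>k. pos K (over K k)) {..<num_cross K}"

section \<open>Edges and half-edges\<close>

text \<open>
  Cutting the curves at the preimages of the classical crossings (the marks) decomposes them into
  arcs, named by the mark they start from, and into components without classical crossings.
  Virtual crossings do not cut.
\<close>

definition marks :: "vdiagram \<Rightarrow> point set" where
  "marks K = over K ` {..<num_cross K} \<union> under K ` {..<num_cross K}"

datatype edge = Arc point | Loop nat

definition edges :: "vdiagram \<Rightarrow> edge set" where
  "edges K = Arc ` marks K \<union> Loop ` {i. i < num_comps K \<and> (\<forall>t. (i, t) \<notin> marks K)}"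

definition prev_mark :: "vdiagram \<Rightarrow> point \<Rightarrow> point" where
  "prev_mark K p =
     (let T = {u. (fst p, u) \<in> marks K}
      in (fst p, if \<exists>u\<in>T. u < snd p then Max {u\<in>T. u < snd p} else Max T))"

text \<open>\<open>Into p\<close> and \<open>Outof p\<close> are the two half-edges at the mark \<open>p\<close> that the orientation of the
  diagram directs towards, respectively away from, the crossing.\<close>

datatype halfedge = Into point | Outof point

fun edge_at :: "vdiagram \<Rightarrow> halfedge \<Rightarrow> edge" where
  "edge_at K (Into p) = Arc (prev_mark K p)"
| "edge_at K (Outof p) = Arc p"

text \<open>
  After rotating a crossing so that both strands run upwards, one strand runs from lower left to
  upper right and the other one from lower right to upper left; the latter is the one whose tangent
  lies to the left of the other tangent.  The crossing is positive iff the
  overcrossing strand runs from lower left to upper right.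
\<close>

definition positive :: "vdiagram \<Rightarrow> nat \<Rightarrow> bool" where
  "positive K k \<longleftrightarrow> det2 (tangent K (over K k)) (tangent K (under K k)) > 0"

definition to_right :: "vdiagram \<Rightarrow> nat \<Rightarrow> point" where
  "to_right K k = (if positive K k then over K k else under K k)"

definition to_left :: "vdiagram \<Rightarrow> nat \<Rightarrow> point" where
  "to_left K k = (if positive K k then under K k else over K k)"

definition upper_right :: "vdiagram \<Rightarrow> nat \<Rightarrow> halfedge" where
  "upper_right K k = Outof (to_right K k)"

definition upper_left :: "vdiagram \<Rightarrow> nat \<Rightarrow> halfedge" where
  "upper_left K k = Outof (to_left K k)"

definition lower_right :: "vdiagram \<Rightarrow> nat \<Rightarrow> halfedge" where
  "lower_right K k = Into (to_left K k)"

definition lower_left :: "vdiagram \<Rightarrow> nat \<Rightarrow> halfedge" where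
  "lower_left K k = Into (to_right K k)"

section \<open>States and their circles\<close>

text \<open>
  A vertex of the cube is given by the set of its coordinates equal to 1, i.e. of the
  \<open>B\<close>-smoothed crossings.  Rotating the overcrossing strand counterclockwise to the undercrossing
  one sweeps out the upper and lower regions at a positive crossing and the left and right
  regions at a negative one; joining the upper and lower regions leaves a left and a right arc.
\<close>

type_synonym state = "nat set"

definition states :: "vdiagram \<Rightarrow> nat \<Rightarrow> state set" where
  "states K i = {s. s \<subseteq> {..<num_cross K} \<and> card s = i}"

definition left_right :: "vdiagram \<Rightarrow> state \<Rightarrow> nat \<Rightarrow> bool" where
  "left_right K s k \<longleftrightarrow> (if k \<in> s then \<not> positive K k else positive K k)"

definition first_arc :: "vdiagram \<Rightarrow> state \<Rightarrow> nat \<Rightarrow> halfedge \<times> halfedge" where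
  "first_arc K s k =
     (if left_right K s k then (lower_left K k, upper_left K k)
      else (upper_left K k, upper_right K k))"

definition second_arc :: "vdiagram \<Rightarrow> state \<Rightarrow> nat \<Rightarrow> halfedge \<times> halfedge" where
  "second_arc K s k =
     (if left_right K s k then (lower_right K k, upper_right K k)
      else (lower_left K k, lower_right K k))"

definition smoothing_arcs :: "vdiagram \<Rightarrow> state \<Rightarrow> (halfedge \<times> halfedge) set" where
  "smoothing_arcs K s = first_arc K s ` {..<num_cross K} \<union> second_arc K s ` {..<num_cross K}"

text \<open>A circle is represented by the set of edges it runs through.\<close>

type_synonym circle = "edge set"

definition joined :: "vdiagram \<Rightarrow> state \<Rightarrow> (edge \<times> edge) set" where
  "joined K s = (let r = {(edge_at K h, edge_at K h') | h h'. (h, h') \<in> smoothing_arcs K s}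
                 in (r \<union> r\<inverse>)\<^sup>*)"

definition circles :: "vdiagram \<Rightarrow> state \<Rightarrow> circle set" where
  "circles K s = edges K // joined K s"

definition first_circle :: "vdiagram \<Rightarrow> state \<Rightarrow> nat \<Rightarrow> circle" where
  "first_circle K s k = joined K s `` {edge_at K (fst (first_arc K s k))}"

definition second_circle :: "vdiagram \<Rightarrow> state \<Rightarrow> nat \<Rightarrow> circle" where
  "second_circle K s k = joined K s `` {edge_at K (fst (second_arc K s k))}"

section \<open>Orientations of circles\<close>

text \<open>
  An orientation of a circle \<open>C\<close> directs each of its edges so that, at every smoothing arc on
  \<open>C\<close>, one end is directed towards the crossing and the other one away from it.  It is
  represented by the set of those edges of \<open>C\<close> that it directs as the diagram does; the
  opposite orientation of \<open>p\<close> is then \<open>C - p\<close>.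
\<close>

type_synonym orient = "edge set"

fun away :: "vdiagram \<Rightarrow> orient \<Rightarrow> halfedge \<Rightarrow> bool" where
  "away K p (Outof x) \<longleftrightarrow> edge_at K (Outof x) \<in> p"
| "away K p (Into x) \<longleftrightarrow> edge_at K (Into x) \<notin> p"

definition orientation :: "vdiagram \<Rightarrow> state \<Rightarrow> circle \<Rightarrow> orient \<Rightarrow> bool" where
  "orientation K s C p \<longleftrightarrow> p \<subseteq> C \<and>
     (\<forall>(h, h')\<in>smoothing_arcs K s. edge_at K h \<in> C \<longrightarrow> away K p h \<noteq> away K p h')"

text \<open>The orientation of a circle \<open>C\<close> incident to the crossing \<open>k\<close> given by the local directions
  there.  It is used only for edges of the cube of type \<open>2 \<rightarrow> 1\<close> and \<open>1 \<rightarrow> 2\<close>, for which it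
  exists; it is unique because \<open>C\<close> is connected.\<close>

definition local_orient :: "vdiagram \<Rightarrow> state \<Rightarrow> nat \<Rightarrow> circle \<Rightarrow> orient" where
  "local_orient K s k C = (THE p. orientation K s C p
     \<and> (\<forall>h\<in>{upper_right K k, lower_left K k}. edge_at K h \<in> C \<longrightarrow> away K p h)
     \<and> (\<forall>h\<in>{upper_left K k, lower_right K k}. edge_at K h \<in> C \<longrightarrow> \<not> away K p h))"

section \<open>Chain spaces\<close>

text \<open>A word \<open>[p\<^sub>1, \<dots>, p\<^sub>k]\<close> stands for \<open>p\<^sub>1 \<and> \<dots> \<and> p\<^sub>k\<close>, where each factor is the
  generator \<open>1\<close> or \<open>X\<^sub>C\<^sub>,\<^sub>o\<close> of the module of its circle.\<close>

datatype factor = One_at (circ: circle) | X_at (circ: circle) orient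

type_synonym word = "factor list"

definition words :: "vdiagram \<Rightarrow> state \<Rightarrow> word set" where
  "words K s = {w. distinct (map circ w) \<and> circ ` set w = circles K s
     \<and> (\<forall>C p. X_at C p \<in> set w \<longrightarrow> orientation K s C p)}"

definition generators :: "vdiagram \<Rightarrow> nat \<Rightarrow> (state \<times> word) set" where
  "generators K i = (SIGMA s:states K i. words K s)"

text \<open>Formal linear combinations of generators, and the submodule of relations: permuting
  factors multiplies by the sign, and \<open>X\<close> for the opposite orientation is \<open>- X\<close>.\<close>

type_synonym 'r free_chain = "(state \<times> word) \<Rightarrow>\<^sub>0 'r"

definition fscale :: "'r::comm_ring_1 \<Rightarrow> 'r free_chain \<Rightarrow> 'r free_chain" where
  "fscale r x = Poly_Mapping.map ((*) r) x"

lemma lookup_fscale [simp]: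
  "Poly_Mapping.lookup (fscale r x) g = r * Poly_Mapping.lookup x g"
  by (simp add: fscale_def Poly_Mapping.map.rep_eq when_def)

interpretation free_chain: module fscale
proof
qed (auto intro!: poly_mapping_eqI simp: lookup_add algebra_simps)

definition free_chains :: "vdiagram \<Rightarrow> nat \<Rightarrow> 'r::comm_ring_1 free_chain set" where
  "free_chains K i = {x. Poly_Mapping.keys x \<subseteq> generators K i}"

definition relators :: "vdiagram \<Rightarrow> nat \<Rightarrow> 'r::comm_ring_1 free_chain set" where
  "relators K i =
     {Poly_Mapping.single (s, permute_list \<sigma> w) 1 - Poly_Mapping.single (s, w) (of_int (sign \<sigma>))
        | s w \<sigma>. (s, w) \<in> generators K i \<and> \<sigma> permutes {..<length w}}
   \<union> {Poly_Mapping.single (s, u @ X_at C (C - p) # v) 1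
        + Poly_Mapping.single (s, u @ X_at C p # v) 1
        | s u C p v. (s, u @ X_at C p # v) \<in> generators K i}"

text \<open>Elements of the chain space are the cosets of the span of the relators.\<close>

type_synonym 'r chain = "'r free_chain set"

definition coset :: "vdiagram \<Rightarrow> nat \<Rightarrow> 'r::comm_ring_1 free_chain \<Rightarrow> 'r chain" where
  "coset K i x = {y. y - x \<in> free_chain.span (relators K i)}"

definition chain_space :: "vdiagram \<Rightarrow> nat \<Rightarrow> 'r::comm_ring_1 chain set" where
  "chain_space K i = coset K i ` free_chains K i"

definition zero_chain :: "vdiagram \<Rightarrow> nat \<Rightarrow> 'r::comm_ring_1 chain" where
  "zero_chain K i = coset K i 0"

section \<open>The differential\<close>

text \<open>The maps \<open>m\<close> and \<open>\<Delta>\<close>, each returning the list of the summands of its value.  The arguments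
  \<open>C, p\<close> are the resulting circles with their local orientations; the orientation of
  the argument factors is accounted for separately by \<open>orient_sign\<close>.\<close>

fun merge_map :: "circle \<Rightarrow> orient \<Rightarrow> factor \<Rightarrow> factor \<Rightarrow> word list" where
  "merge_map C p (One_at _) (One_at _) = [[One_at C]]"
| "merge_map C p (X_at _ _) (One_at _) = [[X_at C p]]"
| "merge_map C p (One_at _) (X_at _ _) = [[X_at C p]]"
| "merge_map C p (X_at _ _) (X_at _ _) = []"

fun split_map :: "circle \<Rightarrow> orient \<Rightarrow> circle \<Rightarrow> orient \<Rightarrow> factor \<Rightarrow> word list" where
  "split_map C1 p1 C2 p2 (One_at _) = [[One_at C1, X_at C2 p2], [X_at C1 p1, One_at C2]]"
| "split_map C1 p1 C2 p2 (X_at _ _) = [[X_at C1 p1, X_at C2 p2]]"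

fun orient_sign :: "orient \<Rightarrow> factor \<Rightarrow> int" where
  "orient_sign p (One_at _) = 1"
| "orient_sign p (X_at _ q) = (if q = p then 1 else - 1)"

text \<open>Moving the factor at \<open>C\<close> to the front is a cycle, of sign \<open>(-1)\<^bsup>j\<^esup>\<close> if it stood behind
  \<open>j\<close> other factors.\<close>

definition index_of :: "circle \<Rightarrow> word \<Rightarrow> nat" where
  "index_of C w = length (takeWhile (\<lambda>f. circ f \<noteq> C) w)"

definition front_sign :: "circle \<Rightarrow> word \<Rightarrow> int" where
  "front_sign C w = (- 1) ^ index_of C w"

definition factor_at :: "circle \<Rightarrow> word \<Rightarrow> factor" where
  "factor_at C w = w ! index_of C w"

definition without :: "circle \<Rightarrow> word \<Rightarrow> word" where
  "without C w = filter (\<lambda>f. circ f \<noteq> C) w"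

definition partial_differential ::
  "vdiagram \<Rightarrow> state \<Rightarrow> nat \<Rightarrow> word \<Rightarrow> 'r::comm_ring_1 free_chain" where
  "partial_differential K s k w =
    (let t = insert k s;
         A = first_circle K s k; B = second_circle K s k;
         A' = first_circle K t k; B' = second_circle K t k;
         combine = (\<lambda>(\<epsilon>::int) us rest.
           \<Sum>u\<leftarrow>us. Poly_Mapping.single (t, u @ rest) (of_int \<epsilon> :: 'r))
     in if A \<noteq> B \<and> A' = B' then
          combine
            (front_sign A w * front_sign B (without A w)
              * orient_sign (local_orient K s k A) (factor_at A w)
              * orient_sign (local_orient K s k B) (factor_at B w))
            (merge_map A' (local_orient K t k A') (factor_at A w) (factor_at B w))
            (without B (without A w))
        else if A = B \<and> A' \<noteq> B' then
          combine
            (front_sign A w * orient_sign (local_orient K s k A) (factor_at A w))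
            (split_map A' (local_orient K t k A') B' (local_orient K t k B') (factor_at A w))
            (without A w)
        else 0)"

text \<open>The linear map on representatives, and the induced map on cosets.  The union in the
  latter is again a coset iff the map on representatives respects the relations.\<close>

definition free_differential ::
  "vdiagram \<Rightarrow> 'r::comm_ring_1 free_chain \<Rightarrow> 'r free_chain" where
  "free_differential K x =
     (\<Sum>(s, w)\<in>Poly_Mapping.keys x. \<Sum>k\<in>{..<num_cross K} - s.
        fscale (Poly_Mapping.lookup x (s, w)) (partial_differential K s k w))"

definition differential :: "vdiagram \<Rightarrow> nat \<Rightarrow> 'r::comm_ring_1 chain \<Rightarrow> 'r chain" where
  "differential K i c = (\<Union>x\<in>c. coset K (Suc i) (free_differential K x))"

end

theory Submission
  imports Defs "HOL-Combinatorics.Cycles"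
begin

text \<open>
  Call an edge together with a direction an oriented edge; these are the half-edges, plus two for
  every component without crossings.  Composing the involution that reverses an edge with the
  involution given by the smoothing arcs yields a permutation whose orbits are the oriented circles
  of the state.  Resmoothing one crossing multiplies this permutation by the two transpositions that
  exchange opposite corners, so merges, splits and single-cycle smoothings, with all local
  orientations, are read off from first return maps on the corners.

  The sign of an ordering of the circles is an alternating function \<open>D s\<close> of lists of edges.  If
  \<open>UL\<close> and \<open>LR\<close> are the left upper and right lower edge at a crossing, then contraction with
  \<open>UL - LR\<close> turns the sign function of the state with two circles into that of the state with one
  circle, up to a constant sign; here \<open>UL\<close> lies on the first and \<open>LR\<close> on the second circle for
  either smoothing.  Likewise, on products of generators \<open>X\<close> a merge is the identity
  and a split is multiplication by \<open>UR + LL\<close>, for both smoothings.  The contractions at two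
  crossings anticommute and the multiplications commute, which settles all faces of the cube except those on
  which both crossings join the same two circles, or one path consists of two single-cycle
  smoothings.  For these one compares the numberings and local orientations of the circles at the two crossings.
\<close>

text \<open>The argument separates signs from products. Apart from the order of the factors, a chain
  space is the commutative algebra generated by the \<open>X\<close> of the circles, with all
  squares zero; the order contributes a factor of rank one, the top exterior power of the set of
  circles, and only there does the wedge anticommute. In the algebra, \<open>m\<close> identifies
  the two generators \<open>X\<close>, and \<open>\<Delta>\<close> multiplies any lift by
  \<open>X_1 + X_2\<close>; the choice of lift does not matter since
  \<open>(X_1 - X_2)(X_1 + X_2) = 0\<close>. Such maps commute, so the anticommutativity of a face
  must come from the factors of rank one. A merge has to forget which of its two circles is which;
  this forces the antisymmetric contraction with \<open>UL - LR\<close>. All sign functions take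
  lists of edges, which are the same for every state, so the signs around a face can be compared by
  evaluation at a single list. They are integers of square 1, and the ring \<open>R\<close> enters
  only afterwards. This picture breaks down when two crossings number or orient the same circles
  differently, hence the separate study of these faces.\<close>

abbreviation single :: "'a \<Rightarrow> 'b::zero \<Rightarrow> 'a \<Rightarrow>\<^sub>0 'b" where
  "single \<equiv> Poly_Mapping.single"

section \<open>Orbits of permutations\<close>

definition orb :: "('a \<Rightarrow> 'a) \<Rightarrow> 'a \<Rightarrow> 'a set" where
  "orb g x = range (\<lambda>n. (g ^^ n) x)"

lemma orb_self: "x \<in> orb g x"
  unfolding orb_def by (metis funpow_0 rangeI)

lemma orb_step: "y \<in> orb g x \<Longrightarrow> g y \<in> orb g x"
  unfolding orb_def by (auto intro: range_eqI[where x = "Suc _"])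

lemma orb_closed: "x \<in> S \<Longrightarrow> (\<And>y. y \<in> S \<Longrightarrow> g y \<in> S) \<Longrightarrow> orb g x \<subseteq> S"
proof
  fix y assume S: "x \<in> S" "\<And>y. y \<in> S \<Longrightarrow> g y \<in> S" "y \<in> orb g x"
  then obtain n where n: "y = (g ^^ n) x" by (auto simp: orb_def)
  have "(g ^^ n) x \<in> S" by (induction n) (use S in auto)
  with n show "y \<in> S" by simp
qed

lemma orb_trans: "y \<in> orb g x \<Longrightarrow> z \<in> orb g y \<Longrightarrow> z \<in> orb g x"
  by (rule subsetD[OF orb_closed[of y "orb g x" g]]) (auto intro: orb_step)

lemma funpow_period:
  assumes "permutation g" obtains N where "N > 0" "g ^^ N = id"
  using permutation_is_nilpotent[OF assms] by blast

text \<open>Orbits are defined by forward iteration only; since a permutation has finite order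
  \<open>N\<close>, a step is undone by \<open>N - 1\<close> further ones.\<close>

lemma orb_sym:
  assumes g: "permutation g" and y: "y \<in> orb g x" shows "x \<in> orb g y"
proof -
  obtain N where N: "N > 0" "g ^^ N = id" using funpow_period[OF g] .
  have "x \<in> orb g (g z)" if xz: "x \<in> orb g z" for z
  proof -
    obtain k where k: "x = (g ^^ k) z" using xz by (auto simp: orb_def)
    have "\<exists>j. x = (g ^^ Suc j) z"
    proof (cases k)
      case 0
      moreover have "(g ^^ Suc (N - 1)) z = z" unfolding Suc_diff_1[OF N(1)] N(2) by (rule id_apply)
      ultimately show ?thesis using k by (metis funpow_0)
    next
      case (Suc j)
      then show ?thesis using k by blast
    qed
    then obtain j where "x = (g ^^ Suc j) z" ..
    then have "x = (g ^^ j) (g z)" by (simp add: funpow_swap1)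
    then show ?thesis unfolding orb_def by blast
  qed
  then have "orb g x \<subseteq> {z. x \<in> orb g z}" by (intro orb_closed) (auto simp: orb_self)
  then show ?thesis using y by blast
qed

lemma orb_eqI: "permutation g \<Longrightarrow> y \<in> orb g x \<Longrightarrow> orb g y = orb g x"
  using orb_trans[of y g x] orb_trans[of x g y] orb_sym[of g y x] by blast

lemma orb_eq_iff: "permutation g \<Longrightarrow> orb g y = orb g x \<longleftrightarrow> y \<in> orb g x"
  using orb_eqI[of g y x] orb_self[of y g] by auto

text \<open>The first return map to \<open>E\<close>, written as a relation.\<close>

definition ret :: "('a \<Rightarrow> 'a) \<Rightarrow> 'a set \<Rightarrow> 'a \<Rightarrow> 'a \<Rightarrow> bool" where
  "ret g E a e \<longleftrightarrow> e \<in> E \<and> (\<exists>n>0. (g ^^ n) a = e \<and> (\<forall>k. 0 < k \<and> k < n \<longrightarrow> (g ^^ k) a \<notin> E))"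

lemma ret_exists:
  assumes g: "permutation g" and a: "a \<in> E" obtains e where "ret g E a e"
proof -
  obtain N where N: "N > 0" "g ^^ N = id" using funpow_period[OF g] .
  let ?P = "\<lambda>n. n > 0 \<and> (g ^^ n) a \<in> E"
  have "?P N" using N a by simp
  then obtain n where n: "?P n" "\<forall>k<n. \<not> ?P k"
    using exists_least_iff[of ?P] by blast
  then have "ret g E a ((g ^^ n) a)" unfolding ret_def by blast
  then show ?thesis by (rule that)
qed

lemma ret_orb: "ret g E a e \<Longrightarrow> e \<in> orb g a \<and> e \<in> E"
  by (auto simp: ret_def orb_def)

text \<open>If \<open>a\<close> first returns to itself after \<open>n\<close> steps, its orbit has
  period \<open>n\<close> and the points in between avoid \<open>E\<close>.\<close>

lemma ret_self:
  assumes "ret g E a a" shows "orb g a \<inter> E = {a}"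
proof -
  obtain n where n: "n > 0" "(g ^^ n) a = a" "\<forall>k. 0 < k \<and> k < n \<longrightarrow> (g ^^ k) a \<notin> E" "a \<in> E"
    using assms by (auto simp: ret_def)
  have "x = a" if x: "x \<in> orb g a" "x \<in> E" for x
  proof -
    obtain k where k: "x = (g ^^ k) a" using x by (auto simp: orb_def)
    have "x = (g ^^ (k mod n)) a" using k n(1,2) by (simp add: funpow_mod_eq)
    with n x show ?thesis
      by (metis funpow_0 mod_less_divisor neq0_conv)
  qed
  then show ?thesis using n orb_self by fastforce
qed

text \<open>The first return map determines how the orbits of \<open>g\<close> change when \<open>g\<close> is
  composed with a map that moves points of \<open>E\<close> only.\<close>

lemma ret_comp:
  assumes r: "ret g E a e" and off: "\<And>x. x \<notin> E \<Longrightarrow> \<tau> x = x" and E: "\<And>x. x \<in> E \<Longrightarrow> \<tau> x \<in> E"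
  shows "ret (\<lambda>x. \<tau> (g x)) E a (\<tau> e)"
proof -
  let ?h = "\<lambda>x. \<tau> (g x)"
  obtain n where n: "n > 0" "(g ^^ n) a = e" "\<forall>k. 0 < k \<and> k < n \<longrightarrow> (g ^^ k) a \<notin> E" "e \<in> E"
    using r by (auto simp: ret_def)
  have *: "(?h ^^ k) a = (g ^^ k) a" if "k < n" for k
    using that
  proof (induction k)
    case (Suc k)
    then have "(?h ^^ Suc k) a = \<tau> ((g ^^ Suc k) a)" by simp
    also have "\<dots> = (g ^^ Suc k) a" using Suc.prems n(3) off by blast
    finally show ?case .
  qed simp
  have "(?h ^^ n) a = \<tau> e"
    using n *[of "n - 1"] by (cases n) auto
  then show ?thesis
    unfolding ret_def using n E * by (intro conjI exI[of _ n]) auto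
qed

section \<open>Oriented circles as orbits\<close>

locale involutions =
  fixes al be :: "'a \<Rightarrow> 'a"
  assumes al_al [simp]: "al (al x) = x" and al_neq: "al x \<noteq> x"
    and be_be [simp]: "be (be x) = x" and be_neq: "be x \<noteq> x"
    and perm: "permutation (\<lambda>x. be (al x))"
begin

text \<open>If \<open>al\<close> reverses oriented edges and \<open>be\<close> is given by the smoothing arcs, then \<open>ob x\<close> is
  the oriented circle through \<open>x\<close>, and \<open>sc x y\<close> below says that \<open>x\<close> and \<open>y\<close> lie on the same
  unoriented circle.\<close>

definition ob :: "'a \<Rightarrow> 'a set" where "ob = orb (\<lambda>x. be (al x))"

lemma ob_self [simp]: "x \<in> ob x" by (simp add: ob_def orb_self)

lemma ob_eq_iff: "ob y = ob x \<longleftrightarrow> y \<in> ob x"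
  unfolding ob_def by (rule orb_eq_iff[OF perm])

lemma ob_step: "ob (be (al x)) = ob x"
  unfolding ob_eq_iff unfolding ob_def by (rule orb_step) (rule orb_self)

lemma ob_be: "ob (be x) = ob (al x)"
  using ob_step[of "al x"] by simp

text \<open>Reversal carries oriented circles to oriented circles because \<open>al\<close>
  conjugates \<open>be \<circ> al\<close> to its inverse.\<close>

lemma ob_al: "ob y = ob x \<Longrightarrow> ob (al y) = ob (al x)"
proof -
  assume "ob y = ob x"
  then have "y \<in> ob x" by (simp add: ob_eq_iff)
  moreover have "ob x \<subseteq> {y. ob (al y) = ob (al x)}"
    unfolding ob_def
  proof (rule orb_closed)
    show "be (al y) \<in> {y. orb (\<lambda>x. be (al x)) (al y) = orb (\<lambda>x. be (al x)) (al x)}"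
      if "y \<in> {y. orb (\<lambda>x. be (al x)) (al y) = orb (\<lambda>x. be (al x)) (al x)}" for y
      using that ob_step[of "al (be (al y))"] by (simp add: ob_def)
  qed simp
  ultimately show ?thesis by blast
qed

lemma ob_al_iff: "ob (al y) = ob (al x) \<longleftrightarrow> ob y = ob x"
  using ob_al[of y x] ob_al[of "al y" "al x"] by auto

text \<open>A circle never runs through an edge in both directions: otherwise the middle of such a
  run would be a fixed point of one of the involutions.\<close>

lemma ob_al_neq: "ob (al x) \<noteq> ob x"
proof -
  define g where "g x = be (al x)" for x
  have g_inj: "g x = g y \<Longrightarrow> x = y" for x y
    unfolding g_def by (metis al_al be_be)
  \<comment> \<open>This removes one step at each end of a run from \<open>x\<close> to
    \<open>al x\<close>, so the induction descends by two.\<close>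
  have al: "al x = g (al (g x))" for x by (simp add: g_def)
  have "(g ^^ n) x \<noteq> al x" for n x
  proof (induction n arbitrary: x rule: less_induct)
    case (less n)
    consider "n = 0" | "n = 1" | k where "n = Suc (Suc k)"
      by (metis One_nat_def not0_implies_Suc)
    then show ?case
    proof cases
      case 1
      then show ?thesis using al_neq[of x] by simp
    next
      case 2
      then show ?thesis using be_neq[of "al x"] by (simp add: g_def)
    next
      case 3
      have "(g ^^ k) (g x) \<noteq> al (g x)" using less 3 by simp
      moreover have "(g ^^ n) x = g ((g ^^ k) (g x))"
        unfolding 3 by (simp add: funpow_swap1)
      ultimately show ?thesis using al[of x] g_inj by metis
    qed
  qed
  moreover have "ob = orb g" by (simp add: ob_def g_def[abs_def])
  ultimately have "al x \<notin> ob x" by (auto simp: orb_def dest: sym)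
  then show ?thesis by (simp add: ob_eq_iff)
qed

definition sc :: "'a \<Rightarrow> 'a \<Rightarrow> bool" where
  "sc x y \<longleftrightarrow> ob x = ob y \<or> ob x = ob (al y)"

lemma sc_refl [simp]: "sc x x" by (simp add: sc_def)

lemma sc_sym: "sc x y \<Longrightarrow> sc y x"
  using ob_al_iff[of x "al y"] by (auto simp: sc_def)

lemma sc_trans: "sc x y \<Longrightarrow> sc y z \<Longrightarrow> sc x z"
  using ob_al_iff[of y z] ob_al_iff[of y "al z"] by (auto simp: sc_def)

lemma sc_al [simp]: "sc (al x) y \<longleftrightarrow> sc x y" "sc x (al y) \<longleftrightarrow> sc x y"
  using ob_al_iff[of x y] ob_al_iff[of x "al y"] by (auto simp: sc_def)

lemma sc_be [simp]: "sc (be x) y \<longleftrightarrow> sc x y" "sc x (be y) \<longleftrightarrow> sc x y"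
  using sc_al ob_be ob_al_iff[of "be y" "al y"] by (simp_all add: sc_def)

lemma ob_imp_sc: "ob x = ob y \<Longrightarrow> sc x y" by (simp add: sc_def)

lemma al_eq_iff [simp]: "al x = al y \<longleftrightarrow> x = y" by (metis al_al)

lemma be_eq_iff [simp]: "be x = be y \<longleftrightarrow> x = y" by (metis be_be)

text \<open>Written as equality of values of a function, the equivalence \<open>sc\<close> is
  accessible to equational reasoning in the case distinctions about merged circles.\<close>

lemma sc_classes: "\<exists>f :: 'a \<Rightarrow> 'a set. \<forall>x y. sc x y \<longleftrightarrow> f x = f y"
proof (intro exI allI iffI)
  fix x y
  show "sc x y" if "{z. sc x z} = {z. sc y z}" using that sc_refl[of y] by blast
  show "{z. sc x z} = {z. sc y z}" if "sc x y"
    using sc_trans[OF that] sc_trans[OF sc_sym[OF that]] by blast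
qed

end

section \<open>Resmoothing one crossing: merges, splits and single-cycle smoothings\<close>

definition swap2 :: "'a \<Rightarrow> 'a \<Rightarrow> 'a \<Rightarrow> 'a \<Rightarrow> 'a \<Rightarrow> 'a" where
  "swap2 p q r s x = (if x = p then q else if x = q then p else if x = r then s
     else if x = s then r else x)"

text \<open>Resmoothing a crossing composes the smoothing involution with the rotation by 180
  degrees of the four corners \<open>a\<close>, \<open>c\<close>, \<open>be a\<close>, \<open>be c\<close> at it, where \<open>a\<close> and \<open>c\<close> are opposite.\<close>

locale resmoothing = S: involutions al be + T: involutions al be'
  for al be be' :: "'a \<Rightarrow> 'a" +
  fixes a c :: 'a
  assumes ac: "a \<noteq> c" "c \<noteq> be a"
    and be': "be' x = swap2 a c (be a) (be c) (be x)"
begin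

lemma distinct_corners: "a \<noteq> be a" "a \<noteq> be c" "c \<noteq> be c" "be a \<noteq> be c" "be a \<noteq> a" "be c \<noteq> a"
  "be c \<noteq> c" "be c \<noteq> be a" "be a \<noteq> c" "c \<noteq> a"
  using ac S.be_be S.be_neq by metis+

lemma be'_corners [simp]: "be' a = be c" "be' c = be a" "be' (be a) = c" "be' (be c) = a"
  using ac distinct_corners by (auto simp: be' swap2_def)

lemma be'_other: "x \<notin> {a, c, be a, be c} \<Longrightarrow> be' x = be x"
  using S.be_eq_iff[of x] S.be_be by (auto simp: be' swap2_def)

text \<open>The rotation is an involution of the same four corners. Hence \<open>S\<close> and
  \<open>T\<close> may be exchanged, and a split is a merge read backwards.\<close>

lemma inverse: "resmoothing al be' be a c"
proof unfold_locales
  show "c \<noteq> be' a" using distinct_corners by simp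
  show "be x = swap2 a c (be' a) (be' c) (be' x)" for x
  proof -
    consider "x = a" | "x = c" | "x = be a" | "x = be c" | "x \<notin> {a, c, be a, be c}" by blast
    then show ?thesis
    proof cases
      case 5
      then have "be x \<noteq> a" "be x \<noteq> c" "be x \<noteq> be a" "be x \<noteq> be c" using S.be_be[of x] by auto
      then show ?thesis using be'_other[OF 5] by (simp add: swap2_def)
    qed (simp_all add: swap2_def ac distinct_corners)
  qed
qed (use ac in auto)

text \<open>\<open>be\<close> and \<open>be'\<close> differ only at the four corners, and by
  assumption these all lie on one circle of \<open>T\<close>; so no step along a circle of
  \<open>S\<close> leaves a circle of \<open>T\<close>.\<close>

lemma mono:
  assumes "T.sc a c" "S.sc x y" shows "T.sc x y"
proof -
  have b: "T.sc (be h) h" for h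
  proof (cases "h \<in> {a, c, be a, be c}")
    case True
    have "T.sc c a" using assms(1) by (rule T.sc_sym)
    moreover have "T.sc (be a) x = T.sc c x" "T.sc (be c) x = T.sc a x"
        "T.sc x (be a) = T.sc x c" "T.sc x (be c) = T.sc x a" for x
      using T.sc_be(1)[of c x] T.sc_be(1)[of a x] T.sc_be(2)[of x c] T.sc_be(2)[of x a] by simp_all
    ultimately show ?thesis using True assms(1) by auto
  next
    case False then show ?thesis using T.sc_be[of h h] be'_other by auto
  qed
  have *: "S.ob z \<subseteq> {w. T.sc w z}" for z
    unfolding S.ob_def
    by (rule orb_closed) (auto intro: T.sc_trans[OF b])
  have "x \<in> S.ob y \<or> x \<in> S.ob (al y)" using assms(2) by (simp add: S.sc_def S.ob_eq_iff)
  then show ?thesis using *[of y] *[of "al y"] by auto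
qed

text \<open>A circle of \<open>S\<close> that misses the crossing never meets a point at which
  \<open>be\<close> and \<open>be'\<close> differ.\<close>

lemma unaffected:
  assumes "\<not> S.sc x a" "\<not> S.sc x c" shows "T.ob x = S.ob x"
proof -
  have "((\<lambda>x. be' (al x)) ^^ n) x = ((\<lambda>x. be (al x)) ^^ n) x" for n
  proof (induction n)
    case (Suc n)
    let ?y = "((\<lambda>x. be (al x)) ^^ n) x"
    have "?y \<in> S.ob x" by (auto simp: S.ob_def orb_def)
    then have "S.sc ?y x" by (simp add: S.sc_def S.ob_eq_iff)
    then have "\<not> S.sc (al ?y) a" "\<not> S.sc (al ?y) c"
      using assms S.sc_trans S.sc_sym S.sc_al by blast+
    then have "al ?y \<notin> {a, c, be a, be c}" by (auto simp del: S.sc_al)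
    then show ?case using Suc be'_other by simp
  qed simp
  then show ?thesis by (simp add: T.ob_def S.ob_def orb_def)
qed

text \<open>A single corner \<open>e\<close> describes both states: a step of \<open>T\<close> is a
  step of \<open>S\<close> followed by the rotation, so the return in \<open>T\<close> is the
  rotated \<open>e\<close>.\<close>

lemma first_return:
  assumes "x \<in> {a, c, be a, be c}"
  shows "\<exists>e\<in>{a, c, be a, be c}. S.ob e = S.ob x \<and> T.ob (swap2 a c (be a) (be c) e) = T.ob x
    \<and> (e = x \<longrightarrow> S.ob x \<inter> {a, c, be a, be c} = {x})
    \<and> (swap2 a c (be a) (be c) e = x \<longrightarrow> T.ob x \<inter> {a, c, be a, be c} = {x})"
proof -
  obtain e where e: "ret (\<lambda>x. be (al x)) {a, c, be a, be c} x e"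
    using ret_exists[OF S.perm assms] .
  have "ret (\<lambda>x. swap2 a c (be a) (be c) (be (al x))) {a, c, be a, be c} x (swap2 a c (be a) (be c) e)"
    by (rule ret_comp[OF e]) (auto simp: swap2_def)
  then have t: "ret (\<lambda>x. be' (al x)) {a, c, be a, be c} x (swap2 a c (be a) (be c) e)"
    by (simp add: be')
  show ?thesis
  proof (intro bexI[of _ e] conjI impI)
    show "e \<in> {a, c, be a, be c}" using ret_orb[OF e] by blast
    show "S.ob e = S.ob x" using ret_orb[OF e] unfolding S.ob_eq_iff by (simp add: S.ob_def)
    show "T.ob (swap2 a c (be a) (be c) e) = T.ob x"
      using ret_orb[OF t] unfolding T.ob_eq_iff by (simp add: T.ob_def)
    show "S.ob x \<inter> {a, c, be a, be c} = {x}" if "e = x"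
      using ret_self[OF e[unfolded that]] by (simp add: S.ob_def)
    show "T.ob x \<inter> {a, c, be a, be c} = {x}" if "swap2 a c (be a) (be c) e = x"
      using ret_self[OF t[unfolded that]] by (simp add: T.ob_def)
  qed
qed

lemma merge:
  assumes "\<not> S.sc a c" shows "T.ob a = T.ob c"
proof -
  obtain e where e: "e \<in> {a, c, be a, be c}" "S.ob e = S.ob a" "T.ob (swap2 a c (be a) (be c) e) = T.ob a"
    "e = a \<longrightarrow> S.ob a \<inter> {a, c, be a, be c} = {a}"
    "swap2 a c (be a) (be c) e = a \<longrightarrow> T.ob a \<inter> {a, c, be a, be c} = {a}"
    using first_return[OF insertI1] by blast
  have "S.ob c \<noteq> S.ob a" "S.ob (be a) \<noteq> S.ob a" "S.ob (be c) \<noteq> S.ob a"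
    using assms S.ob_al_neq by (auto simp: S.sc_def S.ob_be)
  \<comment> \<open>\<open>a\<close> is the only corner on its oriented circle in \<open>S\<close>,
    so it returns to itself, and in \<open>T\<close> to the rotated corner \<open>c\<close>.\<close>
  then have "e = a" using e(1,2) by blast
  then show ?thesis using e(3) by (simp add: swap2_def)
qed

lemma split:
  assumes "S.ob a = S.ob c" shows "\<not> T.sc a c"
proof -
  obtain e where e: "e \<in> {a, c, be a, be c}" "S.ob e = S.ob a" "T.ob (swap2 a c (be a) (be c) e) = T.ob a"
    "e = a \<longrightarrow> S.ob a \<inter> {a, c, be a, be c} = {a}"
    "swap2 a c (be a) (be c) e = a \<longrightarrow> T.ob a \<inter> {a, c, be a, be c} = {a}"
    using first_return[OF insertI1] by blast
  have "c \<in> S.ob a" using assms S.ob_eq_iff[of c a] by simp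
  then have "e \<noteq> a" using e(4) ac(1) by auto
  moreover have "S.ob (be a) \<noteq> S.ob a" "S.ob (be c) \<noteq> S.ob a"
    using assms S.ob_al_neq by (auto simp: S.ob_be)
  then have "e \<noteq> be a" "e \<noteq> be c" using e(2) by auto
  \<comment> \<open>In \<open>S\<close> the first return of \<open>a\<close> is \<open>c\<close>;
    after the rotation it is \<open>a\<close> itself, which is therefore alone on its oriented
    circle in \<open>T\<close>.\<close>
  ultimately have "e = c" using e(1) by blast
  then have T: "T.ob a \<inter> {a, c, be a, be c} = {a}" using e(5) ac by (simp add: swap2_def)
  then have "c \<notin> T.ob a" "be a \<notin> T.ob a" using ac distinct_corners by blast+
  moreover have "T.ob (be a) = T.ob (al c)" using T.ob_be[of c] by simp
  ultimately show ?thesis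
    using T.sc_sym[of a c] T.ob_eq_iff[of c a] T.ob_eq_iff[of "be a" a] by (auto simp: T.sc_def)
qed

text \<open>If \<open>T\<close> ran through \<open>a\<close> and \<open>c\<close> in the same sense,
  then going back to \<open>S\<close> would split their circle.\<close>

lemma single:
  assumes "S.sc a c" "T.sc a c" shows "T.ob a = T.ob (al c)"
proof (rule ccontr)
  assume "T.ob a \<noteq> T.ob (al c)"
  then have "T.ob a = T.ob c" using assms by (simp add: T.sc_def)
  then show False using resmoothing.split[OF inverse] assms by blast
qed

text \<open>The oriented refinement of \<open>mono\<close>: after a merge \<open>a\<close> and
  \<open>c\<close> are traversed in the same sense, so every step of \<open>S\<close> respects the
  orbits of \<open>T\<close>.\<close>

lemma ob_mono:
  assumes "\<not> S.sc a c" "S.ob x = S.ob y" shows "T.ob x = T.ob y"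
proof -
  have ac': "T.ob a = T.ob c" "T.ob (al a) = T.ob (al c)" using T.ob_al[OF merge[OF assms(1)]] merge[OF assms(1)] by simp_all
  have b: "T.ob (be h) = T.ob (al h)" for h
  proof (cases "h \<in> {a, c, be a, be c}")
    case True
    have "T.ob (be a) = T.ob (al c)" "T.ob (be c) = T.ob (al a)"
      using T.ob_be[of c] T.ob_be[of a] by simp_all
    moreover have "T.ob (al (be a)) = T.ob (be' (be a))" "T.ob (al (be c)) = T.ob (be' (be c))"
      by (simp_all only: T.ob_be)
    ultimately show ?thesis using True ac' by auto
  next
    case False then show ?thesis using T.ob_be[of h] be'_other[OF False] by simp
  qed
  have "S.ob y \<subseteq> {w. T.ob w = T.ob y}"
    unfolding S.ob_def by (rule orb_closed) (auto simp: b)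
  moreover have "x \<in> S.ob y" using assms(2) S.ob_eq_iff[of x y] by simp
  ultimately show ?thesis by blast
qed

lemma merge_sc:
  assumes "\<not> S.sc a c"
  shows "T.sc x y \<longleftrightarrow> S.sc x y \<or> S.sc x a \<and> S.sc y c \<or> S.sc x c \<and> S.sc y a"
proof
  \<comment> \<open>\<open>R\<close> glues the circles of \<open>a\<close> and \<open>c\<close>. A
    step of \<open>T\<close> preserves it, since at a corner it passes from one of these two circles
    to the other.\<close>
  define R where "R x y \<longleftrightarrow> S.sc x y \<or> S.sc x a \<and> S.sc y c \<or> S.sc x c \<and> S.sc y a" for x y
  assume "T.sc x y"
  have b: "S.sc (be' h) h \<or> S.sc (be' h) a \<and> S.sc h c \<or> S.sc (be' h) c \<and> S.sc h a" for h
  proof (cases "h \<in> {a, c, be a, be c}")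
    case False then show ?thesis using be'_other[OF False] by simp
  qed auto
  obtain f :: "'a \<Rightarrow> 'a set" where f': "\<forall>x y. S.sc x y \<longleftrightarrow> f x = f y" using S.sc_classes ..
  note f = f'[rule_format]
  have fal: "f (al z) = f z" for z using f[of "al z" z] by simp
  have "R (be' (al z)) w" if "R z w" for z w
    using that b[of "al z"] assms unfolding R_def f fal by (smt (verit))
  then have *: "T.ob w \<subseteq> {z. R z w}" for w
    unfolding T.ob_def by (intro orb_closed) (auto simp: R_def)
  have "x \<in> T.ob y \<or> x \<in> T.ob (al y)" using \<open>T.sc x y\<close> by (simp add: T.sc_def T.ob_eq_iff)
  then have "R x y" using *[of y] *[of "al y"] by (auto simp: R_def)
  then show "S.sc x y \<or> S.sc x a \<and> S.sc y c \<or> S.sc x c \<and> S.sc y a" by (simp add: R_def)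
next
  have ac': "T.sc a c" using merge[OF assms] by (rule T.ob_imp_sc)
  assume "S.sc x y \<or> S.sc x a \<and> S.sc y c \<or> S.sc x c \<and> S.sc y a"
  moreover obtain f :: "'a \<Rightarrow> 'a set" where f': "\<forall>x y. T.sc x y \<longleftrightarrow> f x = f y" using T.sc_classes ..
  note f = f'[rule_format]
  ultimately show "T.sc x y" using mono[OF ac'] ac' unfolding f by (smt (verit))
qed

lemma single_sc: "S.sc a c \<Longrightarrow> T.sc a c \<Longrightarrow> T.sc x y \<longleftrightarrow> S.sc x y"
  using mono resmoothing.mono[OF inverse] by blast

end

section \<open>Resmoothing two crossings at once\<close>

locale double_resmoothing = S: involutions al be + Q: involutions al be''
  for al be be'' :: "'a \<Rightarrow> 'a" +
  fixes a c b d :: 'a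
  assumes corners: "distinct [a, c, be a, be c, b, d, be b, be d]"
    and be'': "be'' x = swap2 a c (be a) (be c) (swap2 b d (be b) (be d) (be x))"
begin

abbreviation "E \<equiv> {a, c, be a, be c, b, d, be b, be d}"
abbreviation "rot x \<equiv> swap2 a c (be a) (be c) (swap2 b d (be b) (be d) x)"

lemma first_return:
  assumes "x \<in> E"
  shows "\<exists>e\<in>E. S.ob e = S.ob x \<and> Q.ob (rot e) = Q.ob x \<and> (e = x \<longrightarrow> S.ob x \<inter> E = {x})"
proof -
  obtain e where e: "ret (\<lambda>x. be (al x)) E x e"
    using ret_exists[OF S.perm assms] .
  have "ret (\<lambda>x. rot (be (al x))) E x (rot e)"
    by (rule ret_comp[OF e]) (auto simp: swap2_def)
  then have t: "ret (\<lambda>x. be'' (al x)) E x (rot e)"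
    by (simp add: be'')
  show ?thesis
  proof (intro bexI[of _ e] conjI impI)
    show "e \<in> E" using ret_orb[OF e] by blast
    show "S.ob e = S.ob x" using ret_orb[OF e] unfolding S.ob_eq_iff by (simp add: S.ob_def)
    show "Q.ob (rot e) = Q.ob x"
      using ret_orb[OF t] unfolding Q.ob_eq_iff by (simp add: Q.ob_def)
    show "S.ob x \<inter> E = {x}" if "e = x"
      using ret_self[OF e[unfolded that]] by (simp add: S.ob_def)
  qed
qed

text \<open>With exactly two corners on the oriented circle of \<open>x\<close>, the first return of
  \<open>x\<close> cannot be \<open>x\<close>, hence is \<open>y\<close>.\<close>

lemma next_corner:
  assumes "x \<in> E" "y \<in> E" "x \<noteq> y" "S.ob y = S.ob x" "\<And>z. z \<in> E \<Longrightarrow> S.ob z = S.ob x \<Longrightarrow> z = x \<or> z = y"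
  shows "Q.ob (rot y) = Q.ob x"
proof -
  obtain e where e: "e \<in> E" "S.ob e = S.ob x" "Q.ob (rot e) = Q.ob x" "e = x \<longrightarrow> S.ob x \<inter> E = {x}"
    using first_return[OF assms(1)] by blast
  have "y \<in> S.ob x" using assms(4) by (simp add: S.ob_eq_iff)
  then have "e \<noteq> x" using e(4) assms(2,3) by auto
  then show ?thesis using e assms(5) by auto
qed

text \<open>The first return map of \<open>be \<circ> al\<close> exchanges \<open>a\<close> with \<open>b\<close> and \<open>c\<close> with \<open>d\<close>; following
  it by the rotations makes \<open>a\<close> return to \<open>d\<close> and \<open>c\<close> to \<open>b\<close>.\<close>

lemma diamond:
  assumes ac: "\<not> S.sc a c" and qac: "\<not> Q.sc a c" and ab: "S.ob a = S.ob b" and cd: "S.sc c d"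
  shows "S.ob c = S.ob d" "Q.ob a = Q.ob d" "Q.ob c = Q.ob b"
proof -
  define A A' C C' where "A = S.ob a" and "A' = S.ob (al a)" and "C = S.ob c" and "C' = S.ob (al c)"
  note defs = this
  have A: "S.ob a = A" "S.ob b = A" "S.ob (be a) = A'" "S.ob (be b) = A'"
    and C: "S.ob c = C" "S.ob (be c) = C'"
    using ab S.ob_al[OF ab] by (simp_all add: defs S.ob_be)
  have "\<not> S.sc c a" using ac S.sc_sym[of c a] by blast
  then have n: "A \<noteq> A'" "A' \<noteq> A" "C \<noteq> C'" "C' \<noteq> C" "A \<noteq> C" "A \<noteq> C'" "A' \<noteq> C" "A' \<noteq> C'"
    "C \<noteq> A" "C' \<noteq> A" "C \<noteq> A'" "C' \<noteq> A'"
    using ac S.ob_al_neq[of a] S.ob_al_neq[of c] S.ob_al_iff[of a c]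
    by (auto simp: S.sc_def defs simp del: S.ob_al_iff)
  have cd_cases: "S.ob d = C \<and> S.ob (be d) = C' \<or> S.ob d = C' \<and> S.ob (be d) = C"
    using cd S.ob_al[of c d] S.ob_al[of c "al d"] by (auto simp: S.sc_def defs S.ob_be)
  have rb: "rot b = d" and rd: "rot d = b" and rbc: "rot (be c) = be a" and bc: "be'' c = be a"
    using corners by (auto simp: swap2_def be'' simp del: S.be_eq_iff)
  have neq: "a \<noteq> b" "be c \<noteq> d" "d \<noteq> be c" "c \<noteq> d" using corners by auto
  have "Q.ob (rot b) = Q.ob a"
    using cd_cases
  proof (elim disjE conjE)
    assume D: "S.ob d = C" "S.ob (be d) = C'"
    show ?thesis by (rule next_corner) (auto simp: A C D n neq)
  next
    assume D: "S.ob d = C'" "S.ob (be d) = C"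
    show ?thesis by (rule next_corner) (auto simp: A C D n neq)
  qed
  then show ad: "Q.ob a = Q.ob d" using rb by simp
  \<comment> \<open>If \<open>c\<close> and \<open>d\<close> were traversed in opposite senses,
    \<open>d\<close> would return to \<open>be c\<close> in \<open>S\<close>, hence to
    \<open>be a = be'' c\<close> in \<open>Q\<close>; with \<open>ad\<close> this puts
    \<open>a\<close> and \<open>c\<close> on one circle of \<open>Q\<close>.\<close>
  show *: "S.ob c = S.ob d"
  proof (rule ccontr)
    assume "S.ob c \<noteq> S.ob d"
    then have D: "S.ob d = C'" "S.ob (be d) = C" using cd_cases C by auto
    have "Q.ob (rot (be c)) = Q.ob d"
      by (rule next_corner) (auto simp: A C n D neq)
    then have "Q.ob (be a) = Q.ob a" using rbc ad by simp
    then have "Q.ob a = Q.ob (al c)" using Q.ob_be[of c] bc by simp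
    then show False using qac by (simp add: Q.sc_def)
  qed
  then have D: "S.ob d = C" "S.ob (be d) = C'" using cd_cases C n by auto
  have "Q.ob (rot d) = Q.ob c"
    by (rule next_corner) (auto simp: A C n D neq)
  then show "Q.ob c = Q.ob b" using rd by simp
qed

end

text \<open>An oriented edge \<open>(e, b)\<close> is directed as the diagram iff \<open>b\<close>.  A half-edge is identified
  with the orientation of its edge that is directed away from its crossing.\<close>

type_synonym oedge = "edge \<times> bool"

section \<open>Corners of a diagram and the smoothing involution of a state\<close>

definition rev_oe :: "oedge \<Rightarrow> oedge" where
  "rev_oe x = (fst x, \<not> snd x)"

lemma fst_rev_oe [simp]: "fst (rev_oe x) = fst x"
  by (simp add: rev_oe_def)

definition leaving :: "halfedge \<Rightarrow> bool" where
  "leaving h = (case h of Into _ \<Rightarrow> False | Outof _ \<Rightarrow> True)"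

definition oe :: "vdiagram \<Rightarrow> halfedge \<Rightarrow> oedge" where
  "oe K h = (edge_at K h, leaving h)"

text \<open>The flags stand for upper (\<open>u\<close>) and right (\<open>r\<close>), so that a
  smoothing arc always negates exactly one of them.\<close>

definition cor :: "vdiagram \<Rightarrow> nat \<Rightarrow> bool \<Rightarrow> bool \<Rightarrow> oedge" where
  "cor K k u r = oe K (if u then if r then upper_right K k else upper_left K k
     else if r then lower_right K k else lower_left K k)"

lemma oe_corner:
  "oe K (upper_right K k) = cor K k True True" "oe K (upper_left K k) = cor K k True False"
  "oe K (lower_right K k) = cor K k False True" "oe K (lower_left K k) = cor K k False False"
  by (simp_all add: cor_def)

definition corners :: "vdiagram \<Rightarrow> oedge set" where
  "corners K = (\<lambda>(k, u, r). cor K k u r) ` ({..<num_cross K} \<times> UNIV)"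

text \<open>Away from the corners \<open>bet\<close> is the reversal, so its composite with the
  reversal is the identity there: each direction of a component without crossings is an orbit of its
  own, and only finitely many points are moved.\<close>

definition bet :: "vdiagram \<Rightarrow> state \<Rightarrow> oedge \<Rightarrow> oedge" where
  "bet K s x = (if x \<in> corners K then
     (case inv_into ({..<num_cross K} \<times> UNIV) (\<lambda>(k, u, r). cor K k u r) x of
        (k, u, r) \<Rightarrow> if left_right K s k then cor K k (\<not> u) r else cor K k u (\<not> r))
     else rev_oe x)"

locale diagram =
  fixes K :: vdiagram
  assumes K: "virtual_diagram K"
begin

abbreviation "n \<equiv> num_cross K"

lemma over_under:
  assumes "k < n" "l < n"
  shows "over K k = over K l \<longleftrightarrow> k = l" "under K k = under K l \<longleftrightarrow> k = l" "over K k \<noteq> under K l"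
proof -
  have inj: "pos K (over K k) = pos K (over K l) \<longleftrightarrow> k = l"
    using K assms by (auto simp: virtual_diagram_def inj_on_def)
  have eq: "pos K (under K j) = pos K (over K j)" "over K j \<noteq> under K j" if "j < n" for j
    using K that by (auto simp: virtual_diagram_def)
  show "over K k = over K l \<longleftrightarrow> k = l" "under K k = under K l \<longleftrightarrow> k = l" "over K k \<noteq> under K l"
    using inj eq assms by metis+
qed

lemma finite_marks: "finite (marks K)"
  by (simp add: marks_def)

lemma prev_mark:
  assumes "p \<in> marks K"
  shows "prev_mark K p \<in> marks K" "fst (prev_mark K p) = fst p"
    "(\<exists>u. (fst p, u) \<in> marks K \<and> u < snd p) \<Longrightarrow> snd (prev_mark K p) < snd p
       \<and> (\<forall>u. (fst p, u) \<in> marks K \<and> u < snd p \<longrightarrow> u \<le> snd (prev_mark K p))"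
    "\<not> (\<exists>u. (fst p, u) \<in> marks K \<and> u < snd p) \<Longrightarrow>
       (\<forall>u. (fst p, u) \<in> marks K \<longrightarrow> u \<le> snd (prev_mark K p))"
proof -
  define T where "T = {u. (fst p, u) \<in> marks K}"
  have "T \<subseteq> snd ` marks K" by (force simp: T_def)
  then have T: "finite T" using finite_marks finite_surj by blast
  have pT: "snd p \<in> T" using assms by (simp add: T_def)
  have eq: "prev_mark K p = (fst p, if \<exists>u\<in>T. u < snd p then Max {u\<in>T. u < snd p} else Max T)"
    by (auto simp: prev_mark_def T_def Let_def)
  show "fst (prev_mark K p) = fst p" by (simp add: eq)
  have 1: "snd (prev_mark K p) \<in> {u\<in>T. u < snd p}"
    "\<forall>u\<in>{u\<in>T. u < snd p}. u \<le> snd (prev_mark K p)" if "\<exists>u\<in>T. u < snd p"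
  proof -
    have f: "finite {u\<in>T. u < snd p}" "{u\<in>T. u < snd p} \<noteq> {}" using T that by auto
    show "snd (prev_mark K p) \<in> {u\<in>T. u < snd p}"
      using Max_in[OF f] that by (simp add: eq)
    show "\<forall>u\<in>{u\<in>T. u < snd p}. u \<le> snd (prev_mark K p)"
      using Max_ge[OF f(1)] that by (simp add: eq)
  qed
  have 2: "snd (prev_mark K p) \<in> T" "\<forall>u\<in>T. u \<le> snd (prev_mark K p)" if "\<not> (\<exists>u\<in>T. u < snd p)"
  proof -
    have f: "T \<noteq> {}" using pT by auto
    show "snd (prev_mark K p) \<in> T" using Max_in[OF T f] that by (simp add: eq)
    show "\<forall>u\<in>T. u \<le> snd (prev_mark K p)" using Max_ge[OF T] that by (simp add: eq)
  qed
  have "snd (prev_mark K p) \<in> T" using 1 2 by (cases "\<exists>u\<in>T. u < snd p") auto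
  then show "prev_mark K p \<in> marks K" by (simp add: T_def eq)
  show "snd (prev_mark K p) < snd p
       \<and> (\<forall>u. (fst p, u) \<in> marks K \<and> u < snd p \<longrightarrow> u \<le> snd (prev_mark K p))"
    if "\<exists>u. (fst p, u) \<in> marks K \<and> u < snd p"
    using 1 that by (simp add: T_def)
  show "\<forall>u. (fst p, u) \<in> marks K \<longrightarrow> u \<le> snd (prev_mark K p)"
    if "\<not> (\<exists>u. (fst p, u) \<in> marks K \<and> u < snd p)"
    using 2 that by (simp add: T_def)
qed

text \<open>For marks \<open>p < q\<close> on one component the predecessor of \<open>q\<close> lies
  in \<open>[p, q)\<close>, while that of \<open>p\<close> lies below \<open>p\<close> or, after
  wrapping around, not below \<open>q\<close>.\<close>

lemma prev_mark_inj: "inj_on (prev_mark K) (marks K)"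
proof -
  have *: "prev_mark K p \<noteq> prev_mark K q"
    if pq: "p \<in> marks K" "q \<in> marks K" "fst p = fst q" "snd p < snd q" for p q
  proof -
    have p: "(fst q, snd p) \<in> marks K" and q: "(fst p, snd q) \<in> marks K"
      using pq by (metis prod.collapse)+
    have "snd p \<le> snd (prev_mark K q)" "snd (prev_mark K q) < snd q"
      using prev_mark(3)[OF pq(2)] p pq(4) by blast+
    moreover have "snd (prev_mark K p) < snd p \<or> snd q \<le> snd (prev_mark K p)"
      using prev_mark(3,4)[OF pq(1)] q by blast
    ultimately show ?thesis by auto
  qed
  show ?thesis
  proof (rule inj_onI)
    fix p q assume pq: "p \<in> marks K" "q \<in> marks K" "prev_mark K p = prev_mark K q"
    then have "fst p = fst q" using prev_mark(2) by metis
    moreover have "snd p = snd q"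
      using *[of p q] *[of q p] pq calculation by (metis linorder_neqE)
    ultimately show "p = q" by (rule prod_eqI)
  qed
qed

lemma to_marks: "k < n \<Longrightarrow> to_right K k \<in> marks K" "k < n \<Longrightarrow> to_left K k \<in> marks K"
  by (auto simp: to_right_def to_left_def marks_def)

lemma to_inj:
  assumes "k < n" "l < n"
  shows "to_right K k = to_right K l \<longleftrightarrow> k = l" "to_left K k = to_left K l \<longleftrightarrow> k = l"
    "to_right K k \<noteq> to_left K l" "to_left K l \<noteq> to_right K k"
  using over_under[OF assms] over_under[OF assms(2,1)]
  by (auto simp: to_right_def to_left_def split: if_splits)

lemma cor_eq_iff [simp]:
  assumes "k < n" "l < n"
  shows "cor K k u r = cor K l u' r' \<longleftrightarrow> k = l \<and> u = u' \<and> r = r'"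
proof -
  have pm: "prev_mark K p = prev_mark K q \<longleftrightarrow> p = q" if "p \<in> marks K" "q \<in> marks K" for p q
    using prev_mark_inj that by (auto simp: inj_on_def)
  show ?thesis
    using to_inj[OF assms] to_inj[OF assms(2,1)] to_marks[OF assms(1)] to_marks[OF assms(2)]
    by (auto simp: cor_def oe_def leaving_def upper_right_def upper_left_def lower_right_def
        lower_left_def pm)
qed

lemma cor_corners: "k < n \<Longrightarrow> cor K k u r \<in> corners K"
  unfolding corners_def by (rule image_eqI[where x = "(k, u, r)"]) auto

lemma bet_cor:
  assumes "k < n"
  shows "bet K s (cor K k u r) = (if left_right K s k then cor K k (\<not> u) r else cor K k u (\<not> r))"
proof -
  have "inj_on (\<lambda>(k, u, r). cor K k u r) ({..<n} \<times> UNIV)" by (auto intro!: inj_onI)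
  then have "inv_into ({..<n} \<times> UNIV) (\<lambda>(k, u, r). cor K k u r) (cor K k u r) = (k, u, r)"
    using inv_into_f_f[of "\<lambda>(k, u, r). cor K k u r" "{..<n} \<times> UNIV" "(k, u, r)"] assms by simp
  then show ?thesis using cor_corners[OF assms] by (simp add: bet_def)
qed

lemma bet_other: "x \<notin> corners K \<Longrightarrow> bet K s x = rev_oe x"
  by (simp add: bet_def)

lemma corners_cases:
  assumes "x \<in> corners K" obtains k u r where "k < n" "x = cor K k u r"
  using assms by (auto simp: corners_def)

lemma marks_to: "p \<in> marks K \<Longrightarrow> \<exists>k<n. p = to_right K k \<or> p = to_left K k"
  by (auto simp: marks_def to_right_def to_left_def)

lemma prev_mark_surj: "prev_mark K ` marks K = marks K"
  using endo_inj_surj[OF finite_marks _ prev_mark_inj] prev_mark(1) by blast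

text \<open>An arc starts at its mark and, as \<open>prev_mark\<close> is onto, ends at some mark;
  its two directions are the outgoing half-edges at these two ends.\<close>

lemma corners_eq: "corners K = Arc ` marks K \<times> UNIV"
proof (intro equalityI subsetI)
  fix x assume "x \<in> corners K"
  then show "x \<in> Arc ` marks K \<times> UNIV"
    by (auto simp: corners_def cor_def oe_def upper_right_def upper_left_def lower_right_def
        lower_left_def split: if_splits intro!: imageI prev_mark(1) to_marks)
next
  fix x :: oedge assume "x \<in> Arc ` marks K \<times> UNIV"
  then obtain p b where x: "x = (Arc p, b)" "p \<in> marks K" by auto
  show "x \<in> corners K"
  proof (cases b)
    case True
    obtain k where "k < n" "p = to_right K k \<or> p = to_left K k" using marks_to x by blast
    then have "x = cor K k True True \<or> x = cor K k True False"
      using x True by (auto simp: cor_def oe_def upper_right_def upper_left_def leaving_def)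
    then show ?thesis using cor_corners[OF \<open>k < n\<close>] by metis
  next
    case False
    obtain q where q: "q \<in> marks K" "p = prev_mark K q" using prev_mark_surj x(2) by blast
    obtain k where "k < n" "q = to_right K k \<or> q = to_left K k" using marks_to q by blast
    then have "x = cor K k False True \<or> x = cor K k False False"
      using x q False by (auto simp: cor_def oe_def lower_right_def lower_left_def leaving_def)
    then show ?thesis using cor_corners[OF \<open>k < n\<close>] by metis
  qed
qed

lemma cor_edges: "k < n \<Longrightarrow> fst (cor K k u r) \<in> edges K"
  using cor_corners[of k u r] by (auto simp: corners_eq edges_def)

lemma rev_oe_corners [simp]: "rev_oe x \<in> corners K \<longleftrightarrow> x \<in> corners K"
  by (simp add: corners_eq rev_oe_def mem_Times_iff)

lemma bet_corners [simp]: "bet K s x \<in> corners K \<longleftrightarrow> x \<in> corners K"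
proof (cases "x \<in> corners K")
  case True
  obtain k u r where "k < n" "x = cor K k u r" using corners_cases[OF True] .
  then show ?thesis by (simp add: bet_cor cor_corners)
qed (simp add: bet_other)

sublocale st: involutions rev_oe "bet K s" for s
proof
  fix x
  show rr: "rev_oe (rev_oe x) = x" "rev_oe x \<noteq> x" for x
    by (auto simp: rev_oe_def prod_eq_iff)
  show bb: "bet K s (bet K s x) = x" "bet K s x \<noteq> x" for x
  proof -
    have "bet K s (bet K s x) = x \<and> bet K s x \<noteq> x"
    proof (cases "x \<in> corners K")
      case True
      obtain k u r where "k < n" "x = cor K k u r" using corners_cases[OF True] .
      then show ?thesis by (simp add: bet_cor)
    next
      case False
      then show ?thesis using rr by (simp add: bet_other)
    qed
    then show "bet K s (bet K s x) = x" "bet K s x \<noteq> x" by simp_all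
  qed
  have "bij (\<lambda>x. bet K s (rev_oe x))"
    by (rule bij_betw_byWitness[where f' = "\<lambda>x. rev_oe (bet K s x)"]) (auto simp: rr bb)
  moreover have "{x. bet K s (rev_oe x) \<noteq> x} \<subseteq> corners K"
  proof
    fix x assume x: "x \<in> {x. bet K s (rev_oe x) \<noteq> x}"
    show "x \<in> corners K"
    proof (rule ccontr)
      assume "x \<notin> corners K"
      then have "rev_oe x \<notin> corners K" by simp
      then show False using x rr(1) by (simp add: bet_other)
    qed
  qed
  then have "finite {x. bet K s (rev_oe x) \<noteq> x}"
    by (rule finite_subset) (simp add: corners_def)
  ultimately show "permutation (\<lambda>x. bet K s (rev_oe x))" by (simp add: permutation)
qed

section \<open>Adjacent states, and circles of a diagram as orbits\<close>

abbreviation "UL k \<equiv> cor K k True False"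
abbreviation "LR k \<equiv> cor K k False True"

text \<open>Stated through the smoothings instead of \<open>t = insert k s\<close>, adjacency
  becomes symmetric, so that one lemma about merges also serves for splits.\<close>

definition adj :: "nat \<Rightarrow> state \<Rightarrow> state \<Rightarrow> bool" where
  "adj k s t \<longleftrightarrow> k < n \<and> (\<forall>l<n. left_right K t l = (if l = k then \<not> left_right K s l else left_right K s l))"

lemma adj_sym: "adj k s t \<Longrightarrow> adj k t s"
  by (auto simp: adj_def)

lemma adj_insert: "k < n \<Longrightarrow> k \<notin> s \<Longrightarrow> adj k s (insert k s)"
  by (auto simp: adj_def left_right_def)

lemma adj_resmoothing:
  assumes "adj k s t"
  shows "resmoothing rev_oe (bet K s) (bet K t) (UL k) (LR k)"
proof -
  have k: "k < n" using assms by (simp add: adj_def)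
  have "bet K t x = swap2 (UL k) (LR k) (bet K s (UL k)) (bet K s (LR k)) (bet K s x)" for x
  proof (cases "x \<in> corners K")
    case True
    obtain l u r where x: "l < n" "x = cor K l u r" using corners_cases[OF True] .
    have "left_right K t l = (if l = k then \<not> left_right K s l else left_right K s l)"
      using assms x(1) by (simp add: adj_def)
    then show ?thesis using k x(1)
      by (cases u; cases r; cases "l = k"; cases "left_right K s k")
        (simp_all add: x(2) bet_cor swap2_def)
  next
    case False
    then have "bet K s x \<notin> corners K" by simp
    then have "bet K s x \<noteq> UL k" "bet K s x \<noteq> LR k" "bet K s x \<noteq> bet K s (UL k)" "bet K s x \<noteq> bet K s (LR k)"
      using cor_corners[OF k] bet_corners by metis+
    then show ?thesis using False by (simp add: swap2_def bet_other)
  qed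
  then show ?thesis
    using k by unfold_locales (auto simp: bet_cor)
qed

lemma smoothing_arc_bet:
  assumes "(h, h') \<in> smoothing_arcs K s"
  shows "oe K h \<in> corners K" "oe K h' = bet K s (oe K h)"
  using assms
  by (auto simp: smoothing_arcs_def first_arc_def second_arc_def oe_corner cor_corners bet_cor split: if_splits)

lemma bet_smoothing_arc:
  assumes "x \<in> corners K"
  shows "\<exists>(h, h') \<in> smoothing_arcs K s. {oe K h, oe K h'} = {x, bet K s x}"
proof -
  obtain k u r where x: "k < n" "x = cor K k u r" using corners_cases[OF assms] .
  have "first_arc K s k \<in> smoothing_arcs K s" "second_arc K s k \<in> smoothing_arcs K s"
    using x(1) by (auto simp: smoothing_arcs_def)
  then show ?thesis using x(1)
    by (cases u; cases r; cases "left_right K s k")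
      (force simp: x(2) bet_cor first_arc_def second_arc_def oe_corner)+
qed

text \<open>Identifies circles, as classes of edges, with unoriented orbits: a smoothing arc joins a
  corner to its \<open>bet\<close> image, and a step along an orbit crosses at most one arc.\<close>

lemma joined_iff: "(e, e') \<in> joined K s \<longleftrightarrow> st.sc s (e, b) (e', b')"
proof -
  define r where "r = {(edge_at K h, edge_at K h') | h h'. (h, h') \<in> smoothing_arcs K s}"
  have j: "joined K s = (r \<union> r\<inverse>)\<^sup>*" by (simp add: joined_def r_def Let_def)
  have sc_fst: "st.sc s (e, b) (e', b') \<longleftrightarrow> st.sc s (e, c) (e', c')" for e e' b b' c c'
  proof -
    have "(e, b) = (e, c) \<or> (e, b) = rev_oe (e, c)" "(e', b') = (e', c') \<or> (e', b') = rev_oe (e', c')"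
      by (auto simp: rev_oe_def)
    then show ?thesis by (metis st.sc_al)
  qed
  have arc_step: "st.sc s (e, True) (e', True)" if ee: "(e, e') \<in> r \<union> r\<inverse>" for e e'
  proof -
    obtain h h' where h: "(h, h') \<in> smoothing_arcs K s"
        "e = edge_at K h \<and> e' = edge_at K h' \<or> e = edge_at K h' \<and> e' = edge_at K h"
      using ee unfolding r_def by blast
    have *: "st.sc s (oe K h) (oe K h')" using smoothing_arc_bet[OF h(1)] by simp
    then have "st.sc s (edge_at K h, True) (edge_at K h', True)" "st.sc s (edge_at K h', True) (edge_at K h, True)"
      using * st.sc_sym[OF *] unfolding oe_def
      by (auto intro: sc_fst[THEN iffD1])
    then show ?thesis using h(2) by auto
  qed
  have r_bet: "(fst x, fst (bet K s x)) \<in> (r \<union> r\<inverse>)\<^sup>*" for x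
  proof (cases "x \<in> corners K")
    case True
    obtain h h' where h: "(h, h') \<in> smoothing_arcs K s" "{oe K h, oe K h'} = {x, bet K s x}"
      using bet_smoothing_arc[OF True, of s] by auto
    have "(fst (oe K h), fst (oe K h')) \<in> r" using h(1) by (auto simp: r_def oe_def)
    then have "(fst x, fst (bet K s x)) \<in> r \<union> r\<inverse>" using h(2) by (auto simp: doubleton_eq_iff)
    then show ?thesis by blast
  qed (simp add: bet_other)
  show ?thesis
  proof
    assume "(e, e') \<in> joined K s"
    then have "(e, e') \<in> (r \<union> r\<inverse>)\<^sup>*" by (simp add: j)
    then have "st.sc s (e, True) (e', True)"
    proof (induction rule: rtrancl_induct)
      case (step y z)
      then show ?case using st.sc_trans[OF step.IH arc_step] by blast
    qed simp
    then show "st.sc s (e, b) (e', b')" using sc_fst by blast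
  next
    assume "st.sc s (e, b) (e', b')"
    then have 1: "(e, b) \<in> st.ob s (e', b') \<or> (e, b) \<in> st.ob s (rev_oe (e', b'))"
      by (simp add: st.sc_def st.ob_eq_iff)
    have 2: "st.ob s x \<subseteq> {y. (fst x, fst y) \<in> (r \<union> r\<inverse>)\<^sup>*}" for x
      unfolding st.ob_def
    proof (rule orb_closed)
      fix y :: oedge assume "y \<in> {y. (fst x, fst y) \<in> (r \<union> r\<inverse>)\<^sup>*}"
      then show "bet K s (rev_oe y) \<in> {y. (fst x, fst y) \<in> (r \<union> r\<inverse>)\<^sup>*}"
        using r_bet[of "rev_oe y"] by (auto intro: rtrancl_trans)
    qed simp
    have "(e', e) \<in> (r \<union> r\<inverse>)\<^sup>*"
      using 1 2[of "(e', b')"] 2[of "rev_oe (e', b')"] by auto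
    moreover have "sym ((r \<union> r\<inverse>)\<^sup>*)" by (intro sym_rtrancl) (auto simp: sym_def)
    ultimately show "(e, e') \<in> joined K s" unfolding j by (meson symD)
  qed
qed

abbreviation "UR k \<equiv> cor K k True True"
abbreviation "LL k \<equiv> cor K k False False"

definition cls :: "state \<Rightarrow> edge \<Rightarrow> circle" where
  "cls s e = joined K s `` {e}"

lemma mem_cls: "e' \<in> cls s e \<longleftrightarrow> st.sc s (e, b) (e', b')"
  using joined_iff[of e e' s b b'] by (simp add: cls_def)

lemma mem_cls_fst: "fst y \<in> cls s (fst x) \<longleftrightarrow> st.sc s x y"
  using mem_cls[of "fst y" s "fst x" "snd x" "snd y"] by simp

lemma cls_eq: "cls s (fst x) = cls s (fst y) \<longleftrightarrow> st.sc s x y"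
proof
  assume "cls s (fst x) = cls s (fst y)"
  then show "st.sc s x y" using mem_cls_fst[of y s x] mem_cls_fst[of y s y] by simp
next
  assume xy: "st.sc s x y"
  have "st.sc s x z \<longleftrightarrow> st.sc s y z" for z
    using st.sc_trans[OF xy] st.sc_trans[OF st.sc_sym[OF xy]] by blast
  then have "e \<in> cls s (fst x) \<longleftrightarrow> e \<in> cls s (fst y)" for e
    using mem_cls_fst[of "(e, True)" s x] mem_cls_fst[of "(e, True)" s y] by simp
  then show "cls s (fst x) = cls s (fst y)" by blast
qed

lemma self_cls: "e \<in> cls s e"
  using mem_cls[of e s e True True] by simp

lemma cls_eq_mem: "cls s e = cls s e' \<longleftrightarrow> e \<in> cls s e'"
  using cls_eq[of s "(e, True)" "(e', True)"] mem_cls[of e s e' True True] st.sc_sym by auto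

lemma bet_edges: "fst (bet K s x) \<in> edges K \<longleftrightarrow> fst x \<in> edges K"
proof (cases "x \<in> corners K")
  case True
  obtain k u r where "k < n" "x = cor K k u r" using corners_cases[OF True] .
  then show ?thesis by (simp add: bet_cor cor_edges)
qed (simp add: bet_other)

lemma ob_edges:
  assumes "fst x \<in> edges K" "y \<in> st.ob s x" shows "fst y \<in> edges K"
proof -
  have "st.ob s x \<subseteq> {y. fst y \<in> edges K}"
    unfolding st.ob_def by (rule orb_closed) (use assms in \<open>auto simp: bet_edges\<close>)
  then show ?thesis using assms by blast
qed

lemma sc_edges:
  assumes "st.sc s x y" "fst y \<in> edges K" shows "fst x \<in> edges K"
proof -
  have "x \<in> st.ob s y \<or> x \<in> st.ob s (rev_oe y)" using assms(1) by (simp add: st.sc_def st.ob_eq_iff)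
  then show ?thesis using ob_edges[of y x s] ob_edges[of "rev_oe y" x s] assms(2) by auto
qed

lemma cls_edges: "e \<in> edges K \<Longrightarrow> cls s e \<subseteq> edges K"
  using sc_edges[of s "(_, True)" "(e, True)"] mem_cls[of _ s e True True] st.sc_sym
  by (metis fst_conv subsetI)

lemma circles_eq: "circles K s = cls s ` edges K"
  by (auto simp: circles_def quotient_def cls_def)

lemma circlesE:
  assumes "C \<in> circles K s" obtains e where "e \<in> edges K" "C = cls s e"
  using assms by (auto simp: circles_eq)

lemma circles_cls:
  assumes "C \<in> circles K s" "e \<in> C" shows "C = cls s e \<and> e \<in> edges K"
proof -
  obtain x where x: "x \<in> edges K" "C = cls s x" using circlesE[OF assms(1)] .
  then have "cls s e = cls s x" using assms(2) by (simp add: cls_eq_mem)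
  then show ?thesis using x assms(2) cls_edges[of x s] by auto
qed

lemma cls_circles: "e \<in> edges K \<Longrightarrow> cls s e \<in> circles K s"
  by (simp add: circles_eq)

lemma finite_edges: "finite (edges K)"
proof -
  have "finite {i. i < num_comps K \<and> (\<forall>t. (i, t) \<notin> marks K)}" by simp
  then show ?thesis using finite_marks by (simp add: edges_def)
qed

lemma finite_circles: "finite (circles K s)"
  by (simp add: circles_eq finite_edges)

section \<open>Orientations and circles of a state\<close>

text \<open>Translates an orbit into the encoding of orientations by sets of edges.\<close>

definition ori :: "state \<Rightarrow> oedge \<Rightarrow> orient" where
  "ori s x = {e. (e, True) \<in> st.ob s x}"

lemma ob_cases:
  assumes "st.sc s x y" shows "y \<in> st.ob s x \<longleftrightarrow> rev_oe y \<notin> st.ob s x"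
  using assms st.ob_al_neq[of s y] st.ob_eq_iff[of s y x] st.ob_eq_iff[of s "rev_oe y" x] st.sc_sym[OF assms]
    st.ob_al_iff[of s y "rev_oe x"]
  by (auto simp: st.sc_def)

lemma mem_ori:
  assumes "e \<in> cls s (fst x)" shows "(e, b) \<in> st.ob s x \<longleftrightarrow> (e \<in> ori s x \<longleftrightarrow> b)"
proof -
  have "st.sc s x (e, True)" using assms mem_cls_fst[of "(e, True)" s x] by simp
  from ob_cases[OF this] show ?thesis by (cases b) (auto simp: ori_def rev_oe_def)
qed

lemma ori_subset: "ori s x \<subseteq> cls s (fst x)"
  using mem_cls_fst[of "(_, True)" s x] st.ob_eq_iff[of s "(_, True)" x]
  by (auto simp: ori_def st.sc_def)

lemma ori_cong: "st.ob s x = st.ob s y \<Longrightarrow> ori s x = ori s y"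
  by (simp add: ori_def)

lemma ori_rev: "ori s (rev_oe x) = cls s (fst x) - ori s x"
proof -
  have "e \<in> ori s (rev_oe x) \<longleftrightarrow> e \<notin> ori s x" if "e \<in> cls s (fst x)" for e
  proof -
    have sc: "st.sc s x (e, True)" using that mem_cls_fst[of "(e, True)" s x] by simp
    show ?thesis
      using ob_cases[OF sc] st.ob_al_iff[of s "(e, True)" x]
      by (simp add: ori_def st.ob_eq_iff[symmetric])
        (metis sc st.al_al st.ob_al st.ob_al_neq st.sc_def)
  qed
  then show ?thesis using ori_subset[of s x] ori_subset[of s "rev_oe x"] by auto
qed

lemma ori_eq_iff:
  assumes "st.sc s x y" shows "ori s x = ori s y \<longleftrightarrow> st.ob s x = st.ob s y"
proof
  assume *: "ori s x = ori s y"
  have "fst x \<in> cls s (fst x)" "fst x \<in> cls s (fst y)"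
    using self_cls assms st.sc_sym mem_cls_fst by auto
  then have "(fst x, snd x) \<in> st.ob s y"
    using mem_ori[of "fst x" s x "snd x"] mem_ori[of "fst x" s y "snd x"] * by simp
  then show "st.ob s x = st.ob s y" by (simp add: st.ob_eq_iff)
qed (rule ori_cong)

lemma away_iff: "away K p h \<longleftrightarrow> (fst (oe K h) \<in> p \<longleftrightarrow> snd (oe K h))"
  by (cases h) (auto simp: oe_def leaving_def)

lemma away_ori:
  assumes "edge_at K h \<in> cls s (fst x)" shows "away K (ori s x) h \<longleftrightarrow> oe K h \<in> st.ob s x"
  using assms mem_ori[of "fst (oe K h)" s x "snd (oe K h)"] by (simp add: away_iff oe_def)

lemma orientation_iff:
  "orientation K s C p \<longleftrightarrow> p \<subseteq> C \<and>
    (\<forall>x\<in>corners K. fst x \<in> C \<longrightarrow> ((fst x \<in> p) = snd x) \<noteq> ((fst (bet K s x) \<in> p) = snd (bet K s x)))"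
  if C: "C \<in> circles K s"
proof -
  have C_bet: "fst (bet K s x) \<in> C \<longleftrightarrow> fst x \<in> C" for x
  proof -
    have "cls s (fst (bet K s x)) = cls s (fst x)" by (simp add: cls_eq)
    then show ?thesis using C self_cls circles_cls by metis
  qed
  let ?P = "\<lambda>x. fst x \<in> C \<longrightarrow> ((fst x \<in> p) = snd x) \<noteq> ((fst (bet K s x) \<in> p) = snd (bet K s x))"
  have P_bet: "?P (bet K s x) \<longleftrightarrow> ?P x" for x by (auto simp: C_bet)
  have "(\<forall>(h, h')\<in>smoothing_arcs K s. edge_at K h \<in> C \<longrightarrow> away K p h \<noteq> away K p h') \<longleftrightarrow>
    (\<forall>x\<in>corners K. ?P x)"
  proof (intro iffI ballI)
    fix x assume x: "x \<in> corners K"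
      and *: "\<forall>(h, h')\<in>smoothing_arcs K s. edge_at K h \<in> C \<longrightarrow> away K p h \<noteq> away K p h'"
    obtain h h' where h: "(h, h') \<in> smoothing_arcs K s" "{oe K h, oe K h'} = {x, bet K s x}"
      using bet_smoothing_arc[OF x, of s] by auto
    have "fst (oe K h) \<in> C \<longrightarrow> away K p h \<noteq> away K p h'" using * h(1) by (auto simp: oe_def)
    then have "?P (oe K h)" unfolding away_iff smoothing_arc_bet(2)[OF h(1)] .
    moreover have "oe K h = x \<or> oe K h = bet K s x" using h(2) by (auto simp: doubleton_eq_iff)
    ultimately show "?P x" using P_bet[of x] by auto
  next
    fix a assume *: "\<forall>x\<in>corners K. ?P x" and a: "a \<in> smoothing_arcs K s"
    obtain h h' where h: "a = (h, h')" by (cases a)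
    have "?P (oe K h)" using * a smoothing_arc_bet(1)[of h h' s] h by blast
    then have "fst (oe K h) \<in> C \<longrightarrow> away K p h \<noteq> away K p h'"
      unfolding away_iff smoothing_arc_bet(2)[OF a[unfolded h]] .
    then show "case a of (h, h') \<Rightarrow> edge_at K h \<in> C \<longrightarrow> away K p h \<noteq> away K p h'"
      by (simp add: h) (simp add: oe_def)
  qed
  then show ?thesis by (simp add: orientation_def)
qed

lemma orientation_ori:
  assumes "fst x \<in> edges K" shows "orientation K s (cls s (fst x)) (ori s x)"
proof -
  have "((fst y \<in> ori s x) = snd y) \<noteq> ((fst (bet K s y) \<in> ori s x) = snd (bet K s y))"
    if "fst y \<in> cls s (fst x)" for y
  proof -
    have y: "st.sc s x y" using that mem_cls_fst by simp
    then have "fst (bet K s y) \<in> cls s (fst x)" by (simp add: mem_cls_fst)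
    then have "((fst y \<in> ori s x) = snd y) \<longleftrightarrow> y \<in> st.ob s x"
      "((fst (bet K s y) \<in> ori s x) = snd (bet K s y)) \<longleftrightarrow> bet K s y \<in> st.ob s x"
      using mem_ori[OF that, of "snd y"] mem_ori[of "fst (bet K s y)" s x "snd (bet K s y)"] by simp_all
    moreover have "bet K s y \<in> st.ob s x \<longleftrightarrow> rev_oe y \<in> st.ob s x"
      using st.ob_be[of s y] st.ob_eq_iff by metis
    ultimately show ?thesis using ob_cases[OF y] by simp
  qed
  then show ?thesis
    using orientation_iff[OF cls_circles[OF assms]] ori_subset by blast
qed

text \<open>The direction of one edge propagates along its orbit and thereby determines the whole
  orientation.\<close>

lemma orientation_unique:
  assumes p: "orientation K s C p" and C: "C \<in> circles K s" and e: "e \<in> C"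
  shows "p = ori s (e, e \<in> p)"
proof -
  have Ce: "C = cls s e" using circles_cls[OF C e] by simp
  let ?x = "(e, e \<in> p)"
  have step: "((fst y \<in> p) = snd y) \<noteq> ((fst (bet K s y) \<in> p) = snd (bet K s y))" if "fst y \<in> C" for y
  proof (cases "y \<in> corners K")
    case True
    then show ?thesis using that p unfolding orientation_iff[OF C] by blast
  qed (auto simp: bet_other rev_oe_def)
  have sub: "st.ob s ?x \<subseteq> {y. fst y \<in> C \<and> (fst y \<in> p) = snd y}"
    unfolding st.ob_def
  proof (rule orb_closed)
    fix y assume y: "y \<in> {y. fst y \<in> C \<and> (fst y \<in> p) = snd y}"
    have "cls s (fst (bet K s (rev_oe y))) = cls s (fst y)" by (simp add: cls_eq)
    then have "fst (bet K s (rev_oe y)) \<in> C" using y C circles_cls self_cls by (metis (mono_tags, lifting) mem_Collect_eq)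
    moreover have "(fst (bet K s (rev_oe y)) \<in> p) = snd (bet K s (rev_oe y))"
      using y step[of "rev_oe y"] by (auto simp: rev_oe_def)
    ultimately show "bet K s (rev_oe y) \<in> {y. fst y \<in> C \<and> (fst y \<in> p) = snd y}" by simp
  qed (simp add: e)
  show ?thesis
  proof (intro equalityI subsetI)
    fix e' assume "e' \<in> ori s ?x" then show "e' \<in> p" using sub by (auto simp: ori_def)
  next
    fix e' assume e': "e' \<in> p"
    then have "e' \<in> cls s (fst ?x)" using p Ce by (auto simp: orientation_def)
    then show "e' \<in> ori s ?x" using mem_ori[of e' s ?x False] sub e' by auto
  qed
qed

section \<open>Types of edges of the cube\<close>

text \<open>\<open>UL k\<close> and \<open>LR k\<close> are on different arcs of either smoothing,
  so the values of \<open>tw\<close> at the two ends of an edge of the cube give its type.\<close>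

definition tw :: "state \<Rightarrow> nat \<Rightarrow> bool" where
  "tw s k \<longleftrightarrow> \<not> st.sc s (UL k) (LR k)"

lemma bet_UL_LR:
  assumes "k < n"
  shows "bet K s (UL k) = (if left_right K s k then LL k else UR k)"
    "bet K s (LR k) = (if left_right K s k then UR k else LL k)"
    "bet K s (UR k) = (if left_right K s k then LR k else UL k)"
    "bet K s (LL k) = (if left_right K s k then UL k else LR k)"
  using assms by (simp_all add: bet_cor)

lemma first_circle_eq:
  assumes "k < n"
  shows "first_circle K s k = cls s (fst (UL k))" "second_circle K s k = cls s (fst (LR k))"
proof -
  have "st.sc s (bet K s (UL k)) (UL k)" "st.sc s (bet K s (LR k)) (LR k)" by simp_all
  moreover have "fst (oe K h) = edge_at K h" for h by (simp add: oe_def)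
  ultimately show "first_circle K s k = cls s (fst (UL k))" "second_circle K s k = cls s (fst (LR k))"
    unfolding first_circle_def second_circle_def first_arc_def second_arc_def cls_def[symmetric] cls_eq[symmetric]
    using oe_corner[of K k] assms by (simp_all add: bet_UL_LR split: if_splits) (metis)+
qed

lemma circles_distinct_iff:
  "k < n \<Longrightarrow> first_circle K s k \<noteq> second_circle K s k \<longleftrightarrow> tw s k"
  by (simp add: first_circle_eq cls_eq tw_def)

lemma tw_UR: "k < n \<Longrightarrow> tw s k \<longleftrightarrow> \<not> st.sc s (UR k) (LL k)"
proof -
  assume k: "k < n"
  have "st.sc s (bet K s (UL k)) (bet K s (LR k)) = st.sc s (UL k) (LR k)" by simp
  then show ?thesis using st.sc_sym[of s "UR k" "LL k"] st.sc_sym[of s "LL k" "UR k"]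
    by (auto simp: tw_def bet_UL_LR k split: if_splits simp del: st.sc_be)
qed

text \<open>The orbit of \<open>UR k\<close> or \<open>LL k\<close> leaves the crossing there, as
  the local directions demand; \<open>UL k\<close> and \<open>LR k\<close> are \<open>bet\<close>
  partners of these, hence entered. By \<open>compat\<close>, a circle through both outgoing corners
  leaves at both, which fails for single-cycle smoothings.\<close>

lemma local_orient_eq:
  assumes k: "k < n" and x: "x \<in> {UR k, LL k}"
    and compat: "st.sc s (UR k) (LL k) \<Longrightarrow> st.ob s (UR k) = st.ob s (LL k)"
  shows "local_orient K s k (cls s (fst x)) = ori s x"
proof -
  have xe: "fst x \<in> edges K" using x k cor_edges by auto
  have up: "st.ob s v = st.ob s x" if "v \<in> {UR k, LL k}" "st.sc s x v" for v
    using that x compat st.sc_sym[OF that(2)] by auto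
  have down: "w \<notin> st.ob s x" if w: "w \<in> {UL k, LR k}" "st.sc s x w" for w
  proof -
    have "bet K s w \<in> {UR k, LL k}" using w(1) k by (auto simp: bet_UL_LR split: if_splits)
    then have "st.ob s (bet K s w) = st.ob s x" using up w(2) by simp
    then have "rev_oe w \<in> st.ob s x" using st.ob_be[of s w] st.ob_eq_iff by metis
    then show ?thesis using ob_cases[OF w(2)] by simp
  qed
  let ?P = "\<lambda>p. orientation K s (cls s (fst x)) p
     \<and> (\<forall>h\<in>{upper_right K k, lower_left K k}. edge_at K h \<in> cls s (fst x) \<longrightarrow> away K p h)
     \<and> (\<forall>h\<in>{upper_left K k, lower_right K k}. edge_at K h \<in> cls s (fst x) \<longrightarrow> \<not> away K p h)"
  have e: "edge_at K h \<in> cls s (fst x) \<longleftrightarrow> st.sc s x (oe K h)" for h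
    using mem_cls_fst[of "oe K h" s x] by (simp add: oe_def)
  have P: "?P (ori s x)"
    using orientation_ori[OF xe, of s] up down
    by (auto simp: away_ori e oe_corner st.ob_eq_iff)
  have "p = ori s x" if p: "?P p" for p
  proof -
    have "p = ori s (fst x, fst x \<in> p)"
      using orientation_unique[of s "cls s (fst x)" p "fst x"] p cls_circles[OF xe] self_cls by blast
    moreover have "fst x \<in> p \<longleftrightarrow> snd x"
    proof -
      obtain h where h: "h \<in> {upper_right K k, lower_left K k}" "oe K h = x"
        using x oe_corner[of K k] by auto
      then have "edge_at K h \<in> cls s (fst x)" by (simp add: e)
      then have "away K p h" using p h(1) by blast
      then show ?thesis using h(2) away_iff[of p h] by simp
    qed
    ultimately show ?thesis by simp
  qed
  then show ?thesis unfolding local_orient_def using P by (intro the_equality) blast+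
qed

text \<open>\<open>s\<close> is the state with two circles at \<open>k\<close>: the one before a
  merge, or the one after a split.\<close>

lemma adj_merge:
  assumes adj: "adj k s t" and tw: "tw s k"
  shows "\<not> tw t k" "st.ob t (UR k) = st.ob t (LL k)" "st.ob t (UL k) = st.ob t (LR k)"
    "st.sc t x y \<longleftrightarrow> st.sc s x y \<or> st.sc s x (UL k) \<and> st.sc s y (LR k) \<or> st.sc s x (LR k) \<and> st.sc s y (UL k)"
    "st.ob s x = st.ob s y \<Longrightarrow> st.ob t x = st.ob t y"
    "\<not> st.sc s x (UL k) \<Longrightarrow> \<not> st.sc s x (LR k) \<Longrightarrow> st.ob t x = st.ob s x"
proof -
  interpret r: resmoothing rev_oe "bet K s" "bet K t" "UL k" "LR k" by (rule adj_resmoothing[OF adj])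
  have k: "k < n" using adj by (simp add: adj_def)
  have ac: "\<not> st.sc s (UL k) (LR k)" using tw by (simp add: tw_def)
  show m: "st.ob t (UL k) = st.ob t (LR k)" by (rule r.merge[OF ac])
  then show "\<not> tw t k" by (simp add: tw_def st.ob_imp_sc)
  have "st.ob t (bet K t (UL k)) = st.ob t (bet K t (LR k))"
    unfolding st.ob_be by (rule st.ob_al[OF m])
  then show "st.ob t (UR k) = st.ob t (LL k)"
    unfolding bet_UL_LR[OF k] by (simp split: if_splits)
  show "st.sc t x y \<longleftrightarrow> st.sc s x y \<or> st.sc s x (UL k) \<and> st.sc s y (LR k) \<or> st.sc s x (LR k) \<and> st.sc s y (UL k)"
    by (rule r.merge_sc[OF ac])
  show "st.ob s x = st.ob s y \<Longrightarrow> st.ob t x = st.ob t y" by (rule r.ob_mono[OF ac])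
  show "\<not> st.sc s x (UL k) \<Longrightarrow> \<not> st.sc s x (LR k) \<Longrightarrow> st.ob t x = st.ob s x"
    by (rule r.unaffected)
qed

text \<open>The circle leaves at one of the corners \<open>UR k\<close> and \<open>LL k\<close> and
  enters at the other. The generators \<open>X\<close> there are opposite, so multiplication by
  \<open>UR k + LL k\<close> will vanish.\<close>

lemma adj_single:
  assumes adj: "adj k s t" and "\<not> tw s k" "\<not> tw t k"
  shows "st.sc t x y \<longleftrightarrow> st.sc s x y" "st.ob t (LL k) = st.ob t (rev_oe (UR k))"
proof -
  interpret r: resmoothing rev_oe "bet K s" "bet K t" "UL k" "LR k" by (rule adj_resmoothing[OF adj])
  have k: "k < n" using adj by (simp add: adj_def)
  have ac: "st.sc s (UL k) (LR k)" "st.sc t (UL k) (LR k)" using assms by (auto simp: tw_def)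
  show "st.sc t x y \<longleftrightarrow> st.sc s x y" by (rule r.single_sc[OF ac])
  have 1: "st.ob t (UL k) = st.ob t (rev_oe (LR k))" by (rule r.single[OF ac])
  have 2: "st.ob t (rev_oe (UL k)) = st.ob t (LR k)" using st.ob_al[OF 1] by simp
  have "st.ob t (bet K t (UL k)) = st.ob t (rev_oe (bet K t (LR k)))"
    unfolding st.ob_be st.ob_al[OF st.ob_be] st.al_al by (rule 2)
  moreover have "st.ob t (rev_oe (bet K t (UL k))) = st.ob t (bet K t (LR k))"
    unfolding st.ob_be st.ob_al[OF st.ob_be] st.al_al by (rule 1)
  ultimately show "st.ob t (LL k) = st.ob t (rev_oe (UR k))"
    unfolding bet_UL_LR[OF k] by (simp split: if_splits)
qed

text \<open>\<open>al\<close> says whether the circles of \<open>s\<close> at \<open>i\<close> and at \<open>j\<close> are numbered in the same way, and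
  \<open>d\<close> whether they are locally oriented in the same way.\<close>

definition aligned :: "state \<Rightarrow> nat \<Rightarrow> nat \<Rightarrow> bool \<Rightarrow> bool \<Rightarrow> bool" where
  "aligned s i j al d \<longleftrightarrow> (let f = if d then id else rev_oe in
     if al then st.ob s (UL i) = st.ob s (f (UL j)) \<and> st.ob s (LR i) = st.ob s (f (LR j))
     else st.ob s (UL i) = st.ob s (f (LR j)) \<and> st.ob s (LR i) = st.ob s (f (UL j)))"

text \<open>In \<open>p\<close> and in the opposite state \<open>q\<close>, both crossings join the
  same two circles. The relative orientation \<open>d\<close> is the same in both states, but the
  agreement \<open>al\<close> of the numberings changes exactly if \<open>d\<close> holds. This
  change produces the missing sign of such faces.\<close>

lemma diamond_signs:
  assumes adj: "adj i p r" "adj j p r'" "adj j r q" "adj i r' q" and ij: "i \<noteq> j"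
    and tw: "tw p i" "tw p j" "tw q i" "tw q j"
  shows "\<exists>al d. aligned p i j al d \<and> aligned q i j (al \<noteq> d) d"
proof -
  have ijn: "i < n" "j < n" using adj by (auto simp: adj_def)
  have lr: "left_right K q l = (if l = i \<or> l = j then \<not> left_right K p l else left_right K p l)" if "l < n" for l
    using adj(1,3) that ij by (auto simp: adj_def)
  \<comment> \<open>The ordered pairs of opposite corners at \<open>j\<close>. All of them define
    the same rotation, so \<open>b\<close> can be chosen as the corner that lies on the orbit of
    \<open>UL i\<close>.\<close>
  define V where "V = {(UL j, LR j), (LR j, UL j), (bet K p (UL j), bet K p (LR j)), (bet K p (LR j), bet K p (UL j))}"
  have dj: "distinct [UL j, LR j, bet K p (UL j), bet K p (LR j)]"
    using ijn by (simp add: bet_UL_LR)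
  have swap: "swap2 b d (bet K p b) (bet K p d) x = swap2 (UL j) (LR j) (bet K p (UL j)) (bet K p (LR j)) x"
    if "(b, d) \<in> V" for b d x
    using that dj unfolding V_def
    by (elim insertE emptyE Pair_inject) (auto simp: swap2_def simp del: st.be_eq_iff)
  have "left_right K r' i = left_right K p i" using adj(2) ij ijn by (simp add: adj_def)
  then have "bet K r' (UL i) = bet K p (UL i)" "bet K r' (LR i) = bet K p (LR i)"
    by (simp_all add: bet_UL_LR[OF ijn(1)])
  then have bq: "bet K q x = swap2 (UL i) (LR i) (bet K p (UL i)) (bet K p (LR i))
     (swap2 b d (bet K p b) (bet K p d) (bet K p x))" if "(b, d) \<in> V" for x b d
    using resmoothing.be'[OF adj_resmoothing[OF adj(4)], of x]
      resmoothing.be'[OF adj_resmoothing[OF adj(2)], of x] swap[OF that, of "bet K p x"] by simp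
  have dist: "distinct [UL i, LR i, bet K p (UL i), bet K p (LR i), b, d, bet K p b, bet K p d]"
    if "(b, d) \<in> V" for b d
  proof -
    have "(b, d) \<in> {(cor K j u v, cor K j (\<not> u) (\<not> v)) | u v. True}"
      using that ijn by (auto simp: V_def bet_UL_LR)
    then obtain u v where "b = cor K j u v" "d = cor K j (\<not> u) (\<not> v)" by blast
    then show ?thesis using ijn ij by (auto simp: bet_cor)
  qed
  have D: "st.ob p (LR i) = st.ob p d \<and> st.ob q (UL i) = st.ob q d \<and> st.ob q (LR i) = st.ob q b"
    if bd: "(b, d) \<in> V"
      and b: "st.ob p (UL i) = st.ob p b" and sc: "st.sc p (LR i) d" for b d
  proof -
    interpret d: double_resmoothing rev_oe "bet K p" "bet K q" "UL i" "LR i" b d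
      by unfold_locales (use dist[OF bd] bq[OF bd] in auto)
    show ?thesis using d.diamond[OF _ _ b sc] tw by (auto simp: tw_def)
  qed
  \<comment> \<open>The smoothings of \<open>j\<close> in \<open>p\<close> and \<open>q\<close>
    differ, so the partner of \<open>LR j\<close> in \<open>p\<close> is the partner of
    \<open>UL j\<close> in \<open>q\<close> and lies there on the orbit of the reversed
    \<open>UL j\<close>.\<close>
  have bqj: "bet K p (LR j) = bet K q (UL j)" "bet K p (UL j) = bet K q (LR j)"
    using lr[OF ijn(2)] ijn by (auto simp: bet_UL_LR)
  have "\<not> tw r j" using adj_merge(1)[OF adj_sym[OF adj(3)] tw(4)] .
  then have "st.sc r (UL j) (LR j)" by (simp add: tw_def)
  \<comment> \<open>\<open>UL j\<close> and \<open>LR j\<close> lie on different circles of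
    \<open>p\<close> but on one circle of \<open>r\<close>; since only the two circles at
    \<open>i\<close> were merged, they are on these two.\<close>
  then have "st.sc p (UL j) (UL i) \<and> st.sc p (LR j) (LR i) \<or> st.sc p (UL j) (LR i) \<and> st.sc p (LR j) (UL i)"
    using adj_merge(4)[OF adj(1) tw(1)] tw(2) by (auto simp: tw_def)
  then consider (1) "st.sc p (UL i) (UL j)" "st.sc p (LR i) (LR j)" | (2) "st.sc p (UL i) (LR j)" "st.sc p (LR i) (UL j)"
    using st.sc_sym by blast
  then show ?thesis
  proof cases
    case 1
    then consider (a) "st.ob p (UL i) = st.ob p (UL j)" | (b) "st.ob p (UL i) = st.ob p (bet K p (UL j))"
      by (auto simp: st.sc_def st.ob_be)
    then show ?thesis
    proof cases
      case a
      then show ?thesis using D[unfolded V_def, OF _ a, of "LR j"] 1 by (intro exI[of _ True]) (auto simp: aligned_def)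
    next
      case b
      then show ?thesis using D[unfolded V_def, OF _ b, of "bet K p (LR j)"] 1
        by (intro exI[of _ True] exI[of _ False]) (auto simp: aligned_def st.ob_be, simp_all add: bqj st.ob_be)
    qed
  next
    case 2
    then consider (a) "st.ob p (UL i) = st.ob p (LR j)" | (b) "st.ob p (UL i) = st.ob p (bet K p (LR j))"
      by (auto simp: st.sc_def st.ob_be)
    then show ?thesis
    proof cases
      case a
      then show ?thesis using D[unfolded V_def, OF _ a, of "UL j"] 2
        by (intro exI[of _ False] exI[of _ True]) (auto simp: aligned_def)
    next
      case b
      then show ?thesis using D[unfolded V_def, OF _ b, of "bet K p (UL j)"] 2
        by (intro exI[of _ False]) (auto simp: aligned_def st.ob_be, simp_all add: bqj st.ob_be)
    qed
  qed
qed

end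

section \<open>Signs of orderings\<close>

definition alt :: "('a list \<Rightarrow> int) \<Rightarrow> bool" where
  "alt F \<longleftrightarrow> (\<forall>p a b q. F (p @ a # b # q) = - F (p @ b # a # q))"

lemma alt_swap: "alt F \<Longrightarrow> F (p @ a # b # q) = - F (p @ b # a # q)"
  unfolding alt_def by blast

lemma alt_Cons: "alt F \<Longrightarrow> alt (\<lambda>V. F (a # V))"
  unfolding alt_def by (metis append_Cons)

lemma alt_front: "alt F \<Longrightarrow> F (u @ a # v) = (- 1) ^ length u * F (a # u @ v)"
proof (induction u arbitrary: F)
  case (Cons b u)
  have "F ((b # u) @ a # v) = (- 1) ^ length u * F (b # a # u @ v)"
    using Cons.IH[OF alt_Cons[OF Cons.prems, of b]] by simp
  also have "F (b # a # u @ v) = - F (a # b # u @ v)"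
    using alt_swap[OF Cons.prems, of "[]" b a "u @ v"] by simp
  finally show ?case by simp
qed simp

lemma alt_exchange:
  assumes "alt F" shows "F (a # p @ b # q) = - F (b # p @ a # q)"
proof -
  have "F (a # p @ b # q) = (- 1) ^ length p * F (a # b # p @ q)"
    using alt_front[OF alt_Cons[OF assms, of a], of p b q] by simp
  also have "F (a # b # p @ q) = - F (b # a # p @ q)"
    using alt_swap[OF assms, of "[]" a b "p @ q"] by simp
  also have "(- 1) ^ length p * - F (b # a # p @ q) = - F (b # p @ a # q)"
    using alt_front[OF alt_Cons[OF assms, of b], of p a q] by simp
  finally show ?thesis .
qed

text \<open>Exchanging the equal entries gives \<open>x = - x\<close>; for integers this forces
  0.\<close>

lemma alt_repeat: "alt F \<Longrightarrow> F (a # p @ a # q) = 0"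
  using alt_exchange[of F a p a q] by simp

text \<open>The constant depends on the two lists but not on \<open>F\<close>, so the same one
  applies to two alternating functions that are to be compared.\<close>

lemma alt_mset:
  assumes "mset xs = mset ys"
  shows "\<exists>c::int. \<forall>F. alt F \<longrightarrow> F xs = c * F ys"
  using assms
proof (induction ys arbitrary: xs)
  case (Cons y ys)
  then have "y \<in> set xs" by (metis list.set_intros(1) mset_eq_setD)
  then obtain u v where xs: "xs = u @ y # v" by (meson split_list)
  then have "mset (u @ v) = mset ys" using Cons.prems by simp
  then obtain c :: int where c: "\<forall>F. alt F \<longrightarrow> F (u @ v) = c * F ys" using Cons.IH by blast
  have "F xs = (- 1) ^ length u * c * F (y # ys)" if "alt F" for F
    using alt_front[OF that, of u y v] c[rule_format, OF alt_Cons[OF that, of y]] xs by simp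
  then show ?case by blast
qed (auto intro: exI[of _ 1])

text \<open>The sign of the order \<open>xs\<close> relative to the reference order
  \<open>ys\<close>. The value 0 on other lists makes it alternating on all lists.\<close>

definition lsgn :: "'a list \<Rightarrow> 'a list \<Rightarrow> int" where
  "lsgn ys xs = (if mset xs = mset ys
     then sign (SOME \<pi>. \<pi> permutes {..<length ys} \<and> permute_list \<pi> ys = xs) else 0)"

lemma lsgn_permute_self:
  assumes "distinct ys" "\<pi> permutes {..<length ys}"
  shows "lsgn ys (permute_list \<pi> ys) = sign \<pi>"
proof -
  have "\<rho> = \<pi>" if \<rho>: "\<rho> permutes {..<length ys}" "permute_list \<rho> ys = permute_list \<pi> ys" for \<rho>
  proof
    fix i
    show "\<rho> i = \<pi> i"
    proof (cases "i < length ys")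
      case True
      then have "ys ! \<rho> i = ys ! \<pi> i"
        using \<rho> assms(2) by (metis permute_list_nth)
      moreover have "\<rho> i < length ys" "\<pi> i < length ys"
        using permutes_in_image[OF \<rho>(1), of i] permutes_in_image[OF assms(2), of i] True by auto
      ultimately show ?thesis using assms(1) nth_eq_iff_index_eq by blast
    next
      case False
      then show ?thesis using \<rho>(1) assms(2) by (simp add: permutes_def)
    qed
  qed
  then have "(SOME \<rho>. \<rho> permutes {..<length ys} \<and> permute_list \<rho> ys = permute_list \<pi> ys) = \<pi>"
    using assms(2) by (intro some_equality) auto
  then show ?thesis using assms(2) by (simp add: lsgn_def)
qed

lemma lsgn_permute:
  assumes "distinct ys" "\<pi> permutes {..<length xs}"
  shows "lsgn ys (permute_list \<pi> xs) = sign \<pi> * lsgn ys xs"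
proof (cases "mset xs = mset ys")
  case True
  then obtain \<rho> where \<rho>: "\<rho> permutes {..<length ys}" "permute_list \<rho> ys = xs"
    by (rule mset_eq_permutation)
  have l: "length xs = length ys" using True mset_eq_length by blast
  have "permute_list \<pi> xs = permute_list (\<rho> \<circ> \<pi>) ys"
    using permute_list_compose[of \<pi> ys \<rho>] assms(2) \<rho> l by simp
  moreover have "\<rho> \<circ> \<pi> permutes {..<length ys}"
    using assms(2) \<rho>(1) l by (simp add: permutes_compose)
  ultimately have "lsgn ys (permute_list \<pi> xs) = sign (\<rho> \<circ> \<pi>)"
    using lsgn_permute_self[OF assms(1)] by simp
  also have "\<dots> = sign \<rho> * sign \<pi>"
    using assms(2) \<rho>(1) l
    by (intro sign_compose permutation_permutes[THEN iffD2] exI[of _ "{..<length ys}"]) auto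
  also have "sign \<rho> = lsgn ys xs" using lsgn_permute_self[OF assms(1) \<rho>(1)] \<rho>(2) by simp
  finally show ?thesis by simp
next
  case False
  then show ?thesis using assms(2) by (simp add: lsgn_def)
qed

lemma lsgn_self: "distinct ys \<Longrightarrow> lsgn ys ys = 1"
  using lsgn_permute_self[of ys id] by (simp add: permutes_id)

lemma lsgn_square:
  "mset xs = mset ys \<Longrightarrow> lsgn ys xs * lsgn ys xs = 1"
  by (auto simp: lsgn_def)

lemma alt_lsgn:
  assumes "distinct ys" shows "alt (lsgn ys)"
  unfolding alt_def
proof (intro allI)
  fix p q :: "'a list" and a b
  let ?\<pi> = "Transposition.transpose (length p) (Suc (length p))"
  have "permute_list ?\<pi> (p @ b # a # q) = p @ a # b # q"
  proof (rule nth_equalityI)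
    fix i assume "i < length (permute_list ?\<pi> (p @ b # a # q))"
    moreover have "?\<pi> permutes {..<length (p @ b # a # q)}"
      by (rule permutes_swap_id) auto
    ultimately show "permute_list ?\<pi> (p @ b # a # q) ! i = (p @ a # b # q) ! i"
      by (auto simp: permute_list_nth Transposition.transpose_def nth_append nth_Cons split: nat.splits)
  qed simp
  moreover have "lsgn ys (permute_list ?\<pi> (p @ b # a # q)) = sign ?\<pi> * lsgn ys (p @ b # a # q)"
    by (rule lsgn_permute[OF assms]) (rule permutes_swap_id, auto)
  ultimately show "lsgn ys (p @ a # b # q) = - lsgn ys (p @ b # a # q)"
    by (simp add: sign_swap_id)
qed

section \<open>The sign function of a state and its contraction along a merge\<close>

context diagram
begin

definition Ls :: "state \<Rightarrow> circle list" where
  "Ls s = (SOME xs. set xs = circles K s \<and> distinct xs)"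

lemma Ls: "set (Ls s) = circles K s" "distinct (Ls s)"
  using someI_ex[OF finite_distinct_list[OF finite_circles[of s]]] by (simp_all add: Ls_def)

text \<open>The arguments are edges and not circles because edges do not depend on the state: sign
  functions of different states can be evaluated at the same list.\<close>

definition D :: "state \<Rightarrow> edge list \<Rightarrow> int" where
  "D s V = lsgn (Ls s) (map (cls s) V)"

definition complete :: "state \<Rightarrow> edge list \<Rightarrow> bool" where
  "complete s V \<longleftrightarrow> distinct (map (cls s) V) \<and> cls s ` set V = circles K s"

lemma mset_Ls: "mset cl = mset (Ls s) \<longleftrightarrow> distinct cl \<and> set cl = circles K s"
  using Ls[of s] by (metis mset_eq_imp_distinct_iff mset_eq_setD set_eq_iff_mset_eq_distinct)

lemma complete_iff: "complete s V \<longleftrightarrow> mset (map (cls s) V) = mset (Ls s)"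
  unfolding mset_Ls complete_def by simp

lemma D_eq_0: "\<not> complete s V \<Longrightarrow> D s V = 0"
  by (simp add: complete_iff D_def lsgn_def)

lemma D_sq: "complete s V \<Longrightarrow> D s V * D s V = 1"
  unfolding complete_iff D_def by (rule lsgn_square)

lemma D_cong: "map (cls s) V = map (cls s) V' \<Longrightarrow> D s V = D s V'"
  by (simp add: D_def)

lemma alt_D: "alt (D s)"
proof -
  have "alt (lsgn (Ls s))" by (rule alt_lsgn) (rule Ls)
  then show ?thesis unfolding alt_def D_def map_append list.map by blast
qed

lemma exists_complete: "\<exists>V. map (cls s) V = Ls s \<and> complete s V"
proof -
  have "\<forall>C\<in>circles K s. \<exists>e. cls s e = C" by (auto simp: circles_eq)
  then obtain f where f: "\<And>C. C \<in> circles K s \<Longrightarrow> cls s (f C) = C" by metis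
  have "map (cls s) (map f (Ls s)) = Ls s"
    unfolding map_map by (rule map_idI) (simp add: Ls f)
  then show ?thesis unfolding complete_iff by metis
qed

text \<open>\<open>F\<close> is an alternating form of top degree in the circles of
  \<open>t\<close>, and such forms are all multiples of one.\<close>

lemma rank_one:
  assumes alt: "alt F" and zero: "\<And>V. \<not> complete t V \<Longrightarrow> F V = 0"
    and cong: "\<And>V V'. map (cls t) V = map (cls t) V' \<Longrightarrow> F V = F V'"
  shows "\<exists>\<sigma>. \<forall>V. F V = \<sigma> * D t V"
proof -
  obtain V0 where V0: "map (cls t) V0 = Ls t" "complete t V0" using exists_complete by blast
  have D0: "D t V0 = 1" using lsgn_self[OF Ls(2)[of t]] by (simp add: D_def V0)
  have "F V = F V0 * D t V" for V
  proof (cases "complete t V")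
    case True
    then have "mset (map (cls t) V) = mset (map (cls t) V0)" using V0 by (simp add: complete_iff)
    then obtain p where p: "p permutes {..<length (map (cls t) V0)}" "permute_list p (map (cls t) V0) = map (cls t) V"
      by (rule mset_eq_permutation)
    define V' where "V' = permute_list p V0"
    have V': "map (cls t) V' = map (cls t) V" "mset V' = mset V0"
      using p by (simp_all add: V'_def permute_list_map)
    obtain c :: int where "\<forall>F. alt F \<longrightarrow> F V' = c * F V0" using alt_mset[OF V'(2)] by blast
    then have "F V' = c * F V0" "D t V' = c * D t V0" using alt alt_D by blast+
    then show ?thesis using cong[OF V'(1)] D_cong[OF V'(1)] D0 by simp
  qed (simp add: zero D_eq_0)
  then show ?thesis by blast
qed

lemma merge_cls:
  assumes "adj k s t" "tw s k"
  shows "cls t a = cls t b \<longleftrightarrow> cls s a = cls s b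
    \<or> cls s a = cls s (fst (UL k)) \<and> cls s b = cls s (fst (LR k))
    \<or> cls s a = cls s (fst (LR k)) \<and> cls s b = cls s (fst (UL k))"
  by (rule adj_merge(4)[OF assms, of "(a, True)" "(b, True)", folded cls_eq, unfolded fst_conv])

text \<open>One merging circle loses its representative; that of the other one now represents the
  merged circle.\<close>

lemma merge_complete:
  assumes adj: "adj k s t" and tw: "tw s k" and e: "(e, e') \<in> {(fst (UL k), fst (LR k)), (fst (LR k), fst (UL k))}"
    and V: "complete s (e # V)"
  shows "complete t V"
proof -
  have k: "k < n" using adj by (simp add: adj_def)
  have t: "cls t a = cls t b \<longleftrightarrow> cls s a = cls s b \<or> cls s a = cls s e \<and> cls s b = cls s e'
      \<or> cls s a = cls s e' \<and> cls s b = cls s e" for a b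
    using e merge_cls[OF adj tw, of a b] by blast
  have Vd: "distinct (map (cls s) V)" "cls s e \<notin> cls s ` set V"
    and Vc: "insert (cls s e) (cls s ` set V) = circles K s"
    using V by (auto simp: complete_def)
  have "distinct (map (cls t) V)"
    using Vd t by (auto simp: distinct_map inj_on_def image_iff)
  moreover have "cls t ` set V = circles K t"
  proof
    have "set V \<subseteq> edges K"
    proof
      fix v assume "v \<in> set V"
      then have "cls s v \<in> circles K s" using Vc by blast
      then show "v \<in> edges K" using circles_cls self_cls by blast
    qed
    then show "cls t ` set V \<subseteq> circles K t" by (auto simp: circles_eq)
    show "circles K t \<subseteq> cls t ` set V"
    proof
      fix C assume "C \<in> circles K t"
      then obtain a where a: "a \<in> edges K" "C = cls t a" by (rule circlesE)
      have "e' \<in> edges K" using e cor_edges[OF k] by auto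
      then have "cls s e' \<in> insert (cls s e) (cls s ` set V)" "cls s a \<in> insert (cls s e) (cls s ` set V)"
        using Vc a cls_circles by auto
      moreover have "cls s (fst (UL k)) \<noteq> cls s (fst (LR k))"
        using tw by (simp add: cls_eq tw_def)
      then have "cls s e' \<noteq> cls s e" using e by auto
      ultimately obtain v where v: "v \<in> set V" "cls s e' = cls s v"
          "cls s a = cls s e \<or> cls s a \<in> cls s ` set V" by auto
      from v(3) show "C \<in> cls t ` set V"
      proof
        assume "cls s a = cls s e"
        then have "cls t a = cls t v" using t[of a v] v(2) by simp
        then show ?thesis using v(1) a(2) by simp
      next
        assume "cls s a \<in> cls s ` set V"
        then obtain w where w: "w \<in> set V" "cls s a = cls s w" by auto
        then have "cls t a = cls t w" using t[of a w] by simp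
        then show ?thesis using w(1) a(2) by simp
      qed
    qed
  qed
  ultimately show ?thesis by (simp add: complete_def)
qed

text \<open>The contraction is alternating and sees only the circles of \<open>t\<close>, so
  \<open>rank_one\<close> applies. That the factor is a sign is read off at a list on which only one
  of the two terms survives.\<close>

lemma merge_sign:
  assumes adj: "adj k s t" and tw: "tw s k"
  shows "\<exists>\<sigma>. \<sigma> * \<sigma> = 1 \<and> (\<forall>V. D s (fst (UL k) # V) - D s (fst (LR k) # V) = \<sigma> * D t V)"
proof -
  have k: "k < n" using adj by (simp add: adj_def)
  let ?a = "fst (UL k)" and ?b = "fst (LR k)"
  define F where "F V = D s (?a # V) - D s (?b # V)" for V
  have t: "cls t a = cls t b \<longleftrightarrow> cls s a = cls s b \<or> cls s a = cls s ?a \<and> cls s b = cls s ?b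
      \<or> cls s a = cls s ?b \<and> cls s b = cls s ?a" for a b
    by (rule merge_cls[OF adj tw])
  have "alt F"
    unfolding alt_def
  proof (intro allI)
    fix p x y q
    show "F (p @ x # y # q) = - F (p @ y # x # q)"
      using alt_swap[OF alt_Cons[OF alt_D[of s], of ?a], of p x y q]
        alt_swap[OF alt_Cons[OF alt_D[of s], of ?b], of p x y q] unfolding F_def by linarith
  qed
  moreover have "F V = 0" if "\<not> complete t V" for V
  proof -
    have "\<not> complete s (?a # V)" "\<not> complete s (?b # V)"
      using that merge_complete[OF adj tw, of ?a ?b V] merge_complete[OF adj tw, of ?b ?a V] by auto
    then show ?thesis by (simp add: F_def D_eq_0)
  qed
  moreover have "F V = F V'" if "map (cls t) V = map (cls t) V'" for V V'
  proof -
    \<comment> \<open>The reason for taking a difference: by vanishing on repetitions and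
      antisymmetry of \<open>D s\<close>, both sides equal
      \<open>D s (fst (UL k) # p @ fst (LR k) # q)\<close>.\<close>
    have ab: "F (p @ ?a # q) = F (p @ ?b # q)" for p q
      using alt_repeat[OF alt_D[of s], of ?a p q] alt_repeat[OF alt_D[of s], of ?b p q]
        alt_exchange[OF alt_D[of s], of ?a p ?b q] unfolding F_def by linarith
    have s: "F (p @ e # q) = F (p @ e' # q)" if "cls s e = cls s e'" for p q e e'
      unfolding F_def using that by (metis (no_types, lifting) D_cong list.simps(9) map_append)
    have one: "F (p @ e # q) = F (p @ e' # q)" if "cls t e = cls t e'" for p q e e'
      using that[unfolded t[of e e']]
    proof (elim disjE conjE)
      assume "cls s e = cls s ?a" "cls s e' = cls s ?b"
      then show ?thesis using s[of e ?a p q] s[of e' ?b p q] ab[of p q] by simp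
    next
      assume "cls s e = cls s ?b" "cls s e' = cls s ?a"
      then show ?thesis using s[of e ?b p q] s[of e' ?a p q] ab[of p q] by simp
    qed (rule s)
    have "F (p @ V) = F (p @ V')" for p
      using that
    proof (induction V arbitrary: V' p)
      case (Cons e V)
      then obtain e' W where V': "V' = e' # W" "cls t e = cls t e'" "map (cls t) V = map (cls t) W"
        by (auto simp: Cons_eq_map_conv)
      then show ?case using Cons.IH[OF V'(3), of "p @ [e']"] one[OF V'(2), of p V] by simp
    qed simp
    from this[of "[]"] show ?thesis by simp
  qed
  ultimately obtain \<sigma> where \<sigma>: "\<And>V. F V = \<sigma> * D t V" using rank_one[of F t] by blast
  \<comment> \<open>In a complete list, replace the representative of the first circle by
    \<open>UL k\<close> in front. The rest \<open>V\<close> represents the second circle, so the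
    term with \<open>LR k\<close> vanishes.\<close>
  obtain W where W: "complete s W" using exists_complete by blast
  have ab_edges: "?a \<in> edges K" "?b \<in> edges K" using cor_edges[OF k] by auto
  then have "cls s ?a \<in> cls s ` set W" using W cls_circles by (auto simp: complete_def)
  then obtain e where "e \<in> set W" "cls s e = cls s ?a" by auto
  then obtain u v where W': "W = u @ e # v" by (meson split_list)
  define V where "V = u @ v"
  have comp: "complete s (?a # V)"
    using W \<open>cls s e = cls s ?a\<close> unfolding complete_def W' V_def by auto
  have "cls s ?b \<noteq> cls s ?a" using tw cls_eq[of s "LR k" "UL k"] st.sc_sym[of s "LR k" "UL k"] by (auto simp: tw_def)
  then have "cls s ?b \<in> cls s ` set V"
    using comp cls_circles[OF ab_edges(2), of s] by (auto simp: complete_def)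
  then have "\<not> complete s (?b # V)" by (auto simp: complete_def)
  then have FV: "F V = D s (?a # V)" by (simp add: F_def D_eq_0)
  have "D t V * D t V = 1" by (rule D_sq) (rule merge_complete[OF adj tw _ comp, of ?b], simp)
  moreover have "(\<sigma> * D t V) * (\<sigma> * D t V) = 1" using FV \<sigma>[of V] D_sq[OF comp] by simp
  ultimately have "\<sigma> * \<sigma> = 1" by (simp add: mult.assoc mult.left_commute)
  then show ?thesis using \<sigma> by (auto simp: F_def)
qed

lemma unaffected_circle:
  assumes adj: "adj k s t" and e: "\<not> st.sc s x (UL k)" "\<not> st.sc s x (LR k)"
  shows "st.ob t x = st.ob s x" "cls t (fst x) = cls s (fst x)"
proof -
  interpret r: resmoothing rev_oe "bet K s" "bet K t" "UL k" "LR k" by (rule adj_resmoothing[OF adj])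
  show 1: "st.ob t x = st.ob s x" by (rule r.unaffected[OF e])
  have 2: "st.ob t (rev_oe x) = st.ob s (rev_oe x)" by (rule r.unaffected) (use e in simp_all)
  have "st.sc t y x \<longleftrightarrow> st.sc s y x" for y
  proof -
    have "st.sc s' y x \<longleftrightarrow> y \<in> st.ob s' x \<or> y \<in> st.ob s' (rev_oe x)" for s'
      by (simp add: st.sc_def st.ob_eq_iff)
    then show ?thesis by (simp add: 1 2)
  qed
  moreover have "e \<in> cls s' (fst x) \<longleftrightarrow> st.sc s' (e, True) x" for e s'
    using mem_cls_fst[of "(e, True)" s' x] st.sc_sym[of s' x "(e, True)"] st.sc_sym[of s' "(e, True)" x]
    by auto
  ultimately show "cls t (fst x) = cls s (fst x)" by blast
qed

section \<open>The chain space modulo relations\<close>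

definition eqv :: "nat \<Rightarrow> 'r::comm_ring_1 free_chain \<Rightarrow> 'r free_chain \<Rightarrow> bool" where
  "eqv i x y \<longleftrightarrow> x - y \<in> free_chain.span (relators K i)"

lemma eqv_refl [simp]: "eqv i x x"
  by (simp add: eqv_def free_chain.span_zero)

lemma eqv_sym: "eqv i x y \<Longrightarrow> eqv i y x"
  unfolding eqv_def using free_chain.span_neg[of "x - y"] by simp

lemma eqv_trans [trans]: "eqv i x y \<Longrightarrow> eqv i y z \<Longrightarrow> eqv i x z"
  unfolding eqv_def using free_chain.span_add[of "x - y" _ "y - z"] by simp

lemma eqv_add: "eqv i x y \<Longrightarrow> eqv i x' y' \<Longrightarrow> eqv i (x + x') (y + y')"
  unfolding eqv_def using free_chain.span_add[of "x - y" _ "x' - y'"] by (simp add: algebra_simps)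

lemma eqv_diff: "eqv i x y \<Longrightarrow> eqv i x' y' \<Longrightarrow> eqv i (x - x') (y - y')"
  unfolding eqv_def using free_chain.span_diff[of "x - y" _ "x' - y'"] by (simp add: algebra_simps)

lemma eqv_scale: "eqv i x y \<Longrightarrow> eqv i (fscale r x) (fscale r y)"
  unfolding eqv_def using free_chain.span_scale[of "x - y" _ r]
  by (simp add: free_chain.scale_right_diff_distrib)

lemma eqv_sum: "(\<And>a. a \<in> A \<Longrightarrow> eqv i (f a) (g a)) \<Longrightarrow> eqv i (sum f A) (sum g A)"
  by (induction A rule: infinite_finite_induct) (auto intro: eqv_add)

lemma eqv_sum_list: "(\<And>a. a \<in> set xs \<Longrightarrow> eqv i (f a) (g a)) \<Longrightarrow> eqv i (\<Sum>a\<leftarrow>xs. f a) (\<Sum>a\<leftarrow>xs. g a)"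
  by (induction xs) (auto intro: eqv_add)

lemma eqv_zero: "eqv i x 0 \<longleftrightarrow> x \<in> free_chain.span (relators K i)"
  by (simp add: eqv_def)

lemma fscale_single [simp]: "fscale r (single g c) = single g (r * c)"
  by (rule poly_mapping_eqI) (simp add: lookup_single when_def)

text \<open>A list \<open>m\<close> of oriented edges stands for the product of the corresponding generators
  \<open>X\<close>; \<open>fac s m C\<close> is the factor at the circle \<open>C\<close> of this monomial.\<close>

definition fac :: "state \<Rightarrow> oedge list \<Rightarrow> circle \<Rightarrow> factor" where
  "fac s m C = (case filter (\<lambda>x. fst x \<in> C) m of [] \<Rightarrow> One_at C | x # _ \<Rightarrow> X_at C (ori s x))"

definition indep :: "state \<Rightarrow> oedge list \<Rightarrow> bool" where
  "indep s m \<longleftrightarrow> distinct (map (\<lambda>x. cls s (fst x)) m)"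

text \<open>Two entries on one circle give 0, in accordance with \<open>X^2 = 0\<close>. The circles
  are always in the reference order, so signs of reorderings appear only in the coefficient.\<close>

definition chi :: "state \<Rightarrow> oedge list \<Rightarrow> 'r::comm_ring_1 \<Rightarrow> 'r free_chain" where
  "chi s m c = (if indep s m then single (s, map (fac s m) (Ls s)) c else 0)"

definition oedges :: "oedge set" where "oedges = edges K \<times> UNIV"

lemma oedges_iff: "x \<in> oedges \<longleftrightarrow> fst x \<in> edges K" "rev_oe x \<in> oedges \<longleftrightarrow> fst x \<in> edges K"
  by (auto simp: oedges_def rev_oe_def mem_Times_iff)

lemma circ_fac [simp]: "circ (fac s m C) = C"
  by (simp add: fac_def split: list.splits)

lemma fac_Nil: "(\<And>x. x \<in> set m \<Longrightarrow> fst x \<notin> C) \<Longrightarrow> fac s m C = One_at C"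
proof -
  assume "\<And>x. x \<in> set m \<Longrightarrow> fst x \<notin> C"
  then have "filter (\<lambda>x. fst x \<in> C) m = []" by (simp add: filter_empty_conv)
  then show ?thesis by (simp add: fac_def)
qed

lemma fac_Cons: "fac s (x # m) C = (if fst x \<in> C then X_at C (ori s x) else fac s m C)"
  by (simp add: fac_def)

lemma fac_words:
  assumes "distinct cl" "set cl = circles K s" "set m \<subseteq> oedges"
  shows "map (fac s m) cl \<in> words K s"
proof -
  have "orientation K s C p" if X: "X_at C p \<in> fac s m ` set cl" for C p
  proof -
    obtain C' where C': "C' \<in> circles K s" "X_at C p = fac s m C'" using X assms(2) by auto
    then have "C = C'" using circ_fac[of s m C'] by (metis factor.sel(2))
    obtain x xs where x: "filter (\<lambda>x. fst x \<in> C') m = x # xs" "p = ori s x"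
      using C' by (auto simp: fac_def split: list.splits)
    then have "x \<in> set m" "fst x \<in> C'" by (auto dest!: Cons_eq_filterD[OF sym])
    then have "C' = cls s (fst x)" "fst x \<in> edges K" using circles_cls[OF C'(1)] by auto
    then show ?thesis using orientation_ori x(2) \<open>C = C'\<close> by simp
  qed
  moreover have "circ ` fac s m ` set cl = set cl" by (simp add: image_image)
  ultimately show ?thesis using assms by (simp add: words_def comp_def)
qed

lemma fac_generators:
  "s \<in> states K i \<Longrightarrow> distinct cl \<Longrightarrow> set cl = circles K s \<Longrightarrow> set m \<subseteq> oedges \<Longrightarrow>
    (s, map (fac s m) cl) \<in> generators K i"
  by (simp add: generators_def fac_words)

lemma norm_word:
  fixes c :: "'r::comm_ring_1"
  assumes s: "s \<in> states K i" and cl: "distinct cl" "set cl = circles K s" and m: "indep s m" "set m \<subseteq> oedges"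
  shows "eqv i (single (s, map (fac s m) cl) c) (chi s m (c * of_int (lsgn (Ls s) cl)))"
proof -
  have "mset cl = mset (Ls s)" using cl mset_Ls by simp
  then obtain p where p: "p permutes {..<length (Ls s)}" "permute_list p (Ls s) = cl"
    by (rule mset_eq_permutation)
  define w where "w = map (fac s m) (Ls s)"
  have w: "permute_list p w = map (fac s m) cl" "p permutes {..<length w}"
    using p by (simp_all add: w_def permute_list_map)
  have "(s, w) \<in> generators K i" unfolding w_def by (rule fac_generators[OF s _ _ m(2)]) (simp_all add: Ls)
  then have "single (s, permute_list p w) 1 - single (s, w) (of_int (sign p)) \<in> (relators K i :: 'r free_chain set)"
    unfolding relators_def using w(2) by blast
  then have "eqv i (single (s, permute_list p w) 1) (single (s, w) (of_int (sign p) :: 'r))"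
    unfolding eqv_def by (rule free_chain.span_base)
  from eqv_scale[OF this, of c]
  have "eqv i (single (s, map (fac s m) cl) c) (single (s, w) (c * of_int (sign p)))"
    by (simp add: w)
  moreover have "lsgn (Ls s) cl = sign p" using lsgn_permute_self[OF Ls(2) p(1)] p(2) by simp
  ultimately show ?thesis using m(1) by (simp add: chi_def w_def)
qed

lemma singleton_mset: "mset xs = mset ys \<Longrightarrow> length xs \<le> 1 \<Longrightarrow> xs = ys"
  by (cases xs; cases ys) auto

text \<open>At most one entry lies on each circle, so the order of \<open>m\<close> is immaterial:
  the generators \<open>X\<close> commute, and wedge signs belong to the order of the circles
  alone.\<close>

lemma fac_mset:
  assumes "indep s m" "mset m = mset m'" "C \<in> circles K s" shows "fac s m C = fac s m' C"
proof -
  let ?f = "filter (\<lambda>x. fst x \<in> C)"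
  have ms: "mset (?f m) = mset (?f m')" using assms(2) by (metis mset_filter)
  have "distinct (map (\<lambda>x. cls s (fst x)) (?f m))"
    using assms(1) unfolding indep_def by (rule distinct_map_filter)
  moreover have "map (\<lambda>x. cls s (fst x)) (?f m) = replicate (length (?f m)) C"
    unfolding map_replicate_const[symmetric] using circles_cls[OF assms(3)] by (auto intro!: map_cong)
  moreover have "distinct (replicate j C) \<Longrightarrow> j \<le> 1" for j
    by (cases j; cases "j - 1") auto
  ultimately have "length (?f m) \<le> 1" by metis
  then have "?f m = ?f m'" using ms singleton_mset by blast
  then show ?thesis by (simp add: fac_def)
qed

lemma indep_mset: "mset m = mset m' \<Longrightarrow> indep s m \<longleftrightarrow> indep s m'"
  unfolding indep_def by (rule mset_eq_imp_distinct_iff) simp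

lemma chi_mset: "mset m = mset m' \<Longrightarrow> chi s m c = chi s m' c"
proof -
  assume *: "mset m = mset m'"
  show ?thesis
  proof (cases "indep s m")
    case True
    have eq: "map (fac s m) (Ls s) = map (fac s m') (Ls s)"
      using fac_mset[OF True *] by (simp add: Ls)
    show ?thesis by (simp only: chi_def indep_mset[OF *, of s] eq)
  next
    case False then show ?thesis using indep_mset[OF *] by (simp add: chi_def)
  qed
qed

lemma chi_swap: "chi s (x # y # m) c = chi s (y # x # m) c"
  by (rule chi_mset) simp

lemma fac_ob:
  assumes "st.ob s x = st.ob s y" "C \<in> circles K s" shows "fac s (x # m) C = fac s (y # m) C"
proof -
  have xy: "cls s (fst x) = cls s (fst y)" using assms(1) by (simp add: cls_eq st.ob_imp_sc)
  have "fst x \<in> C \<longleftrightarrow> fst y \<in> C"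
    using circles_cls[OF assms(2)] xy self_cls by metis
  then show ?thesis using ori_cong[OF assms(1)] by (simp add: fac_Cons)
qed

lemma indep_ob: "cls s (fst x) = cls s (fst y) \<Longrightarrow> indep s (x # m) \<longleftrightarrow> indep s (y # m)"
  by (simp add: indep_def)

lemma chi_ob:
  assumes "st.ob s x = st.ob s y" shows "chi s (x # m) c = chi s (y # m) c"
proof -
  have "cls s (fst x) = cls s (fst y)" using assms by (simp add: cls_eq st.ob_imp_sc)
  then have 1: "indep s (x # m) \<longleftrightarrow> indep s (y # m)" by (rule indep_ob)
  have 2: "map (fac s (x # m)) (Ls s) = map (fac s (y # m)) (Ls s)"
    using fac_ob[OF assms] by (simp add: Ls)
  show ?thesis by (simp only: chi_def 1 2)
qed

lemma chi_dep: "st.sc s x y \<Longrightarrow> chi s (x # y # m) c = 0"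
  using cls_eq[of s x y] by (simp add: chi_def indep_def)

text \<open>This is the orientation relator at the circle of \<open>x\<close>, the only circle whose
  factor changes.\<close>

lemma chi_rev:
  fixes c :: "'r::comm_ring_1"
  assumes s: "s \<in> states K i" and x: "x \<in> oedges" and m: "set m \<subseteq> oedges"
  shows "eqv i (chi s (rev_oe x # m) c) (- chi s (x # m) c)"
proof (cases "indep s (x # m)")
  case True
  define C where "C = cls s (fst x)"
  have "C \<in> set (Ls s)" using x Ls cls_circles by (simp add: C_def oedges_iff)
  then obtain p q where pq: "Ls s = p @ C # q" by (meson split_list)
  then have npq: "C \<notin> set p" "C \<notin> set q" using Ls(2)[of s] by auto
  have xC: "fst x \<in> C" by (simp add: C_def self_cls)
  have nx: "fst x \<notin> C'" if "C' \<in> set p \<union> set q" for C'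
  proof
    assume "fst x \<in> C'"
    moreover have "C' \<in> circles K s" using that Ls(1)[of s] pq by auto
    ultimately have "C' = C" using circles_cls C_def by metis
    then show False using that npq by blast
  qed
  have same: "map (fac s (y # m)) (Ls s) = map (fac s m) p @ X_at C (ori s y) # map (fac s m) q" if "fst y = fst x" for y
    using nx that xC by (simp add: pq fac_Cons)
  have "(s, map (fac s (x # m)) (Ls s)) \<in> generators K i"
    by (rule fac_generators[OF s]) (use Ls x m in auto)
  then have "single (s, map (fac s m) p @ X_at C (C - ori s x) # map (fac s m) q) 1
      + single (s, map (fac s m) p @ X_at C (ori s x) # map (fac s m) q) 1 \<in> (relators K i :: 'r free_chain set)"
    unfolding relators_def same[OF refl] by blast
  then have "single (s, map (fac s (rev_oe x # m)) (Ls s)) 1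
      - (- single (s, map (fac s (x # m)) (Ls s)) 1) \<in> (relators K i :: 'r free_chain set)"
    by (simp add: same ori_rev C_def)
  then have "eqv i (single (s, map (fac s (rev_oe x # m)) (Ls s)) 1)
      (- single (s, map (fac s (x # m)) (Ls s)) (1::'r))"
    unfolding eqv_def by (rule free_chain.span_base)
  from eqv_scale[OF this, of c] show ?thesis
    using True indep_ob[of s "rev_oe x" x m] by (simp add: chi_def)
next
  case False then show ?thesis using indep_ob[of s "rev_oe x" x m] by (simp add: chi_def)
qed

end

lemma index_of_append: "circ f = C \<Longrightarrow> C \<notin> circ ` set p \<Longrightarrow> index_of C (p @ f # q) = length p"
  unfolding index_of_def by (induction p) auto

lemma factor_at_append: "circ f = C \<Longrightarrow> C \<notin> circ ` set p \<Longrightarrow> factor_at C (p @ f # q) = f"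
  by (simp add: factor_at_def index_of_append)

lemma without_append:
  "circ f = C \<Longrightarrow> C \<notin> circ ` set p \<Longrightarrow> C \<notin> circ ` set q \<Longrightarrow> without C (p @ f # q) = p @ q"
  unfolding without_def by (induction p) (auto simp: filter_id_conv)

section \<open>Partial differentials of monomials\<close>

context diagram
begin

abbreviation "pd s k w \<equiv> partial_differential K s k w"

definition msign :: "state \<Rightarrow> state \<Rightarrow> nat \<Rightarrow> int" where
  "msign s t k = (SOME \<sigma>. \<sigma> * \<sigma> = 1 \<and> (\<forall>V. D s (fst (UL k) # V) - D s (fst (LR k) # V) = \<sigma> * D t V))"

lemma msign:
  assumes "adj k s t" "tw s k"
  shows "msign s t k * msign s t k = 1" "D s (fst (UL k) # V) - D s (fst (LR k) # V) = msign s t k * D t V"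
  using someI_ex[OF merge_sign[OF assms]] unfolding msign_def by blast+

text \<open>A split is given the constant of the reverse merge, which is its own inverse.\<close>

definition sigma :: "state \<Rightarrow> nat \<Rightarrow> int" where
  "sigma s k = (if tw s k then msign s (insert k s) k else msign (insert k s) s k)"

text \<open>Up to the sign \<open>sigma s k\<close>, the partial differential at \<open>k\<close> maps the monomial \<open>m\<close> to the sum of
  the monomials \<open>ym s k m\<close>.\<close>

definition ym :: "state \<Rightarrow> nat \<Rightarrow> oedge list \<Rightarrow> oedge list list" where
  "ym s k m = (if tw s k then [m] else if tw (insert k s) k then [UR k # m, LL k # m] else [])"

text \<open>Adapts a generator to a local orientation given by \<open>u\<close>; the companion
  \<open>nsg\<close> is the sign this costs and equals the factor \<open>orient_sign\<close> of the
  differential.\<close>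

definition nrm :: "state \<Rightarrow> oedge \<Rightarrow> oedge \<Rightarrow> oedge" where
  "nrm s u x = (if st.ob s x = st.ob s u then x else rev_oe x)"

definition nsg :: "state \<Rightarrow> oedge \<Rightarrow> oedge \<Rightarrow> int" where
  "nsg s u x = (if st.ob s x = st.ob s u then 1 else - 1)"

lemma nrm_ob: "st.sc s x u \<Longrightarrow> st.ob s (nrm s u x) = st.ob s u"
  using st.ob_al[of s x "rev_oe u"] by (auto simp: nrm_def st.sc_def)

lemma fst_nrm [simp]: "fst (nrm s u x) = fst x" by (simp add: nrm_def)

lemma orient_sign_nsg: "st.sc s x u \<Longrightarrow> orient_sign (ori s u) (X_at C (ori s x)) = nsg s u x"
  by (simp add: nsg_def ori_eq_iff)

lemma chi_minus: "chi s m (- c) = - chi s m c"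
  by (simp add: chi_def single_uminus)

text \<open>The reversal is decided in \<open>s\<close> but the relation is applied in
  \<open>t\<close>: generators are compared with the local orientation of one state and used in the
  other.\<close>

lemma chi_nrm:
  assumes "t \<in> states K i" "x \<in> oedges" "set m \<subseteq> oedges"
  shows "eqv i (chi t (x # m) c) (chi t (nrm s u x # m) (c * of_int (nsg s u x)))"
proof (cases "st.ob s x = st.ob s u")
  case False
  have "eqv i (chi t (rev_oe x # m) (- c)) (- chi t (x # m) (- c))" by (rule chi_rev[OF assms])
  then show ?thesis using False eqv_sym by (simp add: nrm_def nsg_def chi_minus)
qed (simp add: nrm_def nsg_def)

lemma chi_nrm2:
  assumes "t \<in> states K i" "x \<in> oedges" "z \<in> oedges" "set m \<subseteq> oedges"
  shows "eqv i (chi t (z # x # m) c) (chi t (z # nrm s u x # m) (c * of_int (nsg s u x)))"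
  using chi_nrm[OF assms(1,2), of "z # m"] assms(3,4) by (simp add: chi_swap[of t z])

lemma extract_circle:
  assumes "indep s m" "C \<in> circles K s"
  shows "(\<forall>x\<in>set m. fst x \<notin> C) \<or>
    (\<exists>x m0. mset m = mset (x # m0) \<and> fst x \<in> C \<and> (\<forall>y\<in>set m0. fst y \<notin> C))"
proof (cases "\<forall>x\<in>set m. fst x \<notin> C")
  case False
  then obtain x where x: "x \<in> set m" "fst x \<in> C" by blast
  then obtain a b where m: "m = a @ x # b" by (meson split_list)
  have "fst y \<notin> C" if "y \<in> set (a @ b)" for y
  proof
    assume "fst y \<in> C"
    then have "cls s (fst y) = cls s (fst x)" using circles_cls[OF assms(2)] x(2) by metis
    moreover have "cls s (fst x) \<notin> (\<lambda>x. cls s (fst x)) ` set (a @ b)"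
      using assms(1) unfolding indep_def m by auto
    ultimately show False using that by (metis imageI)
  qed
  then show ?thesis using m x(2) by (intro disjI2 exI[of _ x] exI[of _ "a @ b"]) auto
qed simp

lemma fac_skip:
  "\<lbrakk>\<And>x. x \<in> set xs \<Longrightarrow> fst x \<notin> C\<rbrakk> \<Longrightarrow> fac s (xs @ m) C = fac s m C"
  by (induction xs) (auto simp: fac_Cons)

lemma fac_state:
  assumes "\<And>x. x \<in> set m \<Longrightarrow> fst x \<in> C \<Longrightarrow> ori t x = ori s x" shows "fac t m C = fac s m C"
  using assms by (induction m) (auto simp: fac_Cons fac_def)

lemma insert_states: "s \<in> states K i \<Longrightarrow> k < n \<Longrightarrow> k \<notin> s \<Longrightarrow> insert k s \<in> states K (Suc i)"
  by (auto simp: states_def finite_subset[OF _ finite_lessThan])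

lemma merge_circles:
  assumes adj: "adj k s t" and tw: "tw s k"
  defines "A \<equiv> cls s (fst (UL k))" and "B \<equiv> cls s (fst (LR k))" and "C \<equiv> cls t (fst (UL k))"
  shows "A \<noteq> B" "C = A \<union> B" "A \<in> circles K s" "B \<in> circles K s" "C \<in> circles K t"
    "circles K t = insert C (circles K s - {A, B})" "C \<notin> circles K s - {A, B}"
    "\<And>x. fst x \<in> edges K \<Longrightarrow> fst x \<notin> C \<Longrightarrow> cls t (fst x) = cls s (fst x) \<and> ori t x = ori s x"
proof -
  have k: "k < n" using adj by (simp add: adj_def)
  show "A \<noteq> B" using tw by (simp add: A_def B_def cls_eq tw_def)
  have mem: "e \<in> cls s' (fst y) \<longleftrightarrow> st.sc s' (e, True) y" for e s' y
    using mem_cls_fst[of "(e, True)" s' y] st.sc_sym[of s' y "(e, True)"] st.sc_sym[of s' "(e, True)" y]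
    by auto
  have sc: "st.sc t x (UL k) \<longleftrightarrow> st.sc s x (UL k) \<or> st.sc s x (LR k)" for x
    using adj_merge(4)[OF adj tw, of x "UL k"] tw by (auto simp: tw_def)
  show C: "C = A \<union> B" by (auto simp: A_def B_def C_def mem sc)
  show AB: "A \<in> circles K s" "B \<in> circles K s" "C \<in> circles K t"
    using cls_circles cor_edges[OF k] by (simp_all add: A_def B_def C_def)
  show un: "cls t (fst x) = cls s (fst x) \<and> ori t x = ori s x" if "fst x \<in> edges K" "fst x \<notin> C" for x
  proof -
    have "\<not> st.sc s x (UL k)" "\<not> st.sc s x (LR k)"
      using that(2) st.sc_sym[of s x "UL k"] st.sc_sym[of s x "LR k"]
      unfolding C A_def B_def Un_iff mem_cls_fst by blast+
    from unaffected_circle[OF adj this] show ?thesis by (simp add: ori_def)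
  qed
  have eqC: "cls t e = C" if "e \<in> C" for e using that by (simp add: C_def cls_eq_mem)
  show "circles K t = insert C (circles K s - {A, B})"
  proof (intro equalityI subsetI)
    fix X assume X: "X \<in> circles K t"
    then obtain e where e: "e \<in> edges K" "X = cls t e" by (rule circlesE)
    show "X \<in> insert C (circles K s - {A, B})"
    proof (cases "e \<in> C")
      case False
      then have "X = cls s e" using un[of "(e, True)"] e by simp
      moreover have "e \<in> X" using e self_cls by simp
      ultimately show ?thesis using e False cls_circles C by auto
    qed (use eqC e in simp)
  next
    fix X assume "X \<in> insert C (circles K s - {A, B})"
    then consider "X = C" | "X \<in> circles K s" "X \<noteq> A" "X \<noteq> B" by blast
    then show "X \<in> circles K t"
    proof cases
      case 2
      obtain e where e: "e \<in> edges K" "X = cls s e" using circlesE[OF 2(1)] .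
      have "e \<notin> C" using 2 e C circles_cls[OF AB(1)] circles_cls[OF AB(2)] by auto
      then have "X = cls t e" using un[of "(e, True)"] e by simp
      then show ?thesis using e cls_circles by simp
    qed (use AB in simp)
  qed
  show "C \<notin> circles K s - {A, B}"
  proof
    assume C': "C \<in> circles K s - {A, B}"
    have "fst (UL k) \<in> C" by (simp add: C_def self_cls)
    then have "C = A" using C' circles_cls[of C s "fst (UL k)"] by (simp add: A_def)
    then show False using C' by blast
  qed
qed

lemma choose_edges:
  assumes "set p \<subseteq> circles K s" shows "\<exists>V. map (cls s) V = p \<and> set V \<subseteq> edges K \<and> (\<forall>e\<in>set V. \<exists>C\<in>set p. e \<in> C)"
  using assms
proof (induction p)
  case (Cons C p)
  obtain e where "e \<in> edges K" "C = cls s e" using Cons.prems by (auto simp: circles_eq)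
  moreover obtain V where "map (cls s) V = p" "set V \<subseteq> edges K" "\<forall>e\<in>set V. \<exists>C\<in>set p. e \<in> C"
    using Cons by auto
  ultimately show ?case using self_cls by (intro exI[of _ "e # V"]) auto
qed simp

lemma sgn_front: "lsgn (Ls s) (p @ a # q) = (- 1) ^ length p * lsgn (Ls s) (a # p @ q)"
  by (rule alt_front[OF alt_lsgn[OF Ls(2)]])

lemma merge_order_sign:
  assumes adj: "adj k s t" and tw: "tw s k"
  defines "A \<equiv> cls s (fst (UL k))" and "B \<equiv> cls s (fst (LR k))" and "C \<equiv> cls t (fst (UL k))"
  assumes r: "set r = circles K s - {A, B}"
  shows "lsgn (Ls s) (A # B # r) = msign s t k * lsgn (Ls t) (C # r)"
proof -
  note mc = merge_circles[OF adj tw, folded A_def B_def C_def]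
  have "set r \<subseteq> circles K s" using r by blast
  from choose_edges[OF this] obtain V where
    V: "map (cls s) V = r" "set V \<subseteq> edges K" "\<forall>e\<in>set V. \<exists>X\<in>set r. e \<in> X"
    by blast
  have cls_t: "cls t e = cls s e" if e: "e \<in> set V" for e
  proof -
    obtain X where X': "X \<in> set r" "e \<in> X" using V(3) e by blast
    then have X: "X \<in> circles K s" "X \<noteq> A" "X \<noteq> B" "e \<in> X" unfolding r by simp_all
    have "X = cls s e" using circles_cls[OF X(1,4)] by blast
    then have "e \<notin> A" "e \<notin> B" using X(2,3) by (auto simp: A_def B_def cls_eq_mem)
    moreover have "fst (e, True) \<in> edges K" using V(2) e by auto
    ultimately show ?thesis using mc(8)[of "(e, True)"] mc(2) by simp
  qed
  have "map (cls t) V = map (cls s) V" by (rule map_cong[OF refl cls_t])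
  then have Vt: "map (cls t) V = r" using V(1) by simp
  have Ct: "cls t (fst (LR k)) = C"
    using adj_merge(3)[OF adj tw] by (simp add: C_def cls_eq st.ob_imp_sc)
  \<comment> \<open>With \<open>LR k\<close> as the first entry of the list, one term of the
    contraction has a repetition; the other has both merging circles in front.\<close>
  have "D s (fst (UL k) # fst (LR k) # V) - D s (fst (LR k) # fst (LR k) # V) = msign s t k * D t (fst (LR k) # V)"
    by (rule msign(2)[OF adj tw])
  moreover have "D s (fst (LR k) # fst (LR k) # V) = 0"
    using alt_repeat[OF alt_D, of s "fst (LR k)" "[]" V] by simp
  ultimately show ?thesis by (simp add: D_def V Vt Ct A_def B_def)
qed

lemma extract_circle':
  assumes "indep s m" "C \<in> circles K s"
  obtains xs m0 where "mset m = mset (xs @ m0)" "xs = [] \<or> (\<exists>x. xs = [x] \<and> fst x \<in> C)" "\<forall>y\<in>set m0. fst y \<notin> C"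
proof -
  have "\<exists>xs m0. mset m = mset (xs @ m0) \<and> (xs = [] \<or> (\<exists>x. xs = [x] \<and> fst x \<in> C)) \<and> (\<forall>y\<in>set m0. fst y \<notin> C)"
    using extract_circle[OF assms]
  proof
    assume "\<forall>x\<in>set m. fst x \<notin> C"
    then show ?thesis by (intro exI[of _ "[]"] exI[of _ m]) simp
  next
    assume "\<exists>x m0. mset m = mset (x # m0) \<and> fst x \<in> C \<and> (\<forall>y\<in>set m0. fst y \<notin> C)"
    then obtain x m0 where "mset m = mset (x # m0)" "fst x \<in> C" "\<forall>y\<in>set m0. fst y \<notin> C" by blast
    then show ?thesis by (intro exI[of _ "[x]"] exI[of _ m0]) simp
  qed
  then show ?thesis using that by blast
qed

lemma indep_Cons:
  assumes "indep t m" "\<forall>y\<in>set m. fst y \<notin> C" "cls t (fst x) = C" shows "indep t (x # m)"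
proof -
  have "C \<notin> (\<lambda>x. cls t (fst x)) ` set m"
    using assms(2) self_cls by auto
  then show ?thesis using assms(1,3) by (simp add: indep_def)
qed

lemma indep_state:
  assumes "indep s m" "\<And>x. x \<in> set m \<Longrightarrow> cls t (fst x) = cls s (fst x)" shows "indep t m"
proof -
  have eq: "map (\<lambda>x. cls t (fst x)) m = map (\<lambda>x. cls s (fst x)) m" using assms(2) by simp
  show ?thesis using assms(1) by (simp only: indep_def eq)
qed

lemma circ_map_fac: "circ ` set (map (fac s m) p) = set p"
  by (simp add: image_image)

text \<open>The two factors are moved to the front one after the other, so the position of
  \<open>B\<close> is counted in the word without \<open>A\<close>.\<close>

lemma pd_merge:
  assumes k: "k < n" and tw: "tw s k" and ntw: "\<not> tw (insert k s) k"
    and A: "A = cls s (fst (UL k))" and B: "B = cls s (fst (LR k))" and C: "C = cls (insert k s) (fst (UL k))"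
    and cl: "distinct (p @ A # q)" "p @ q = p' @ B # q'"
  shows "pd s k (map (fac s m) (p @ A # q)) =
    (\<Sum>u\<leftarrow>merge_map C (local_orient K (insert k s) k C) (fac s m A) (fac s m B).
      single (insert k s, u @ map (fac s m) (p' @ q'))
        (of_int ((- 1) ^ length p * (- 1) ^ length p'
          * orient_sign (local_orient K s k A) (fac s m A) * orient_sign (local_orient K s k B) (fac s m B))))"
proof -
  let ?f = "map (fac s m)"
  have AB: "A \<noteq> B" using circles_distinct_iff[OF k, of s] tw by (simp add: first_circle_eq[OF k] A B)
  have t: "first_circle K (insert k s) k = second_circle K (insert k s) k"
    using circles_distinct_iff[OF k, of "insert k s"] ntw by simp
  have d: "distinct (p' @ B # q')" "A \<notin> set p" "A \<notin> set q" using cl by (auto simp flip: cl(2))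
  have A': "A \<notin> circ ` set (?f p)" "A \<notin> circ ` set (?f q)" unfolding circ_map_fac using d by simp_all
  have B': "B \<notin> circ ` set (?f p')" "B \<notin> circ ` set (?f q')" unfolding circ_map_fac using d by simp_all
  have w: "?f (p @ A # q) = ?f p @ fac s m A # ?f q" by simp
  have 1: "index_of A (?f (p @ A # q)) = length p" "factor_at A (?f (p @ A # q)) = fac s m A"
    unfolding w using A' by (simp_all add: index_of_append factor_at_append)
  have "without A (?f (p @ A # q)) = ?f p @ ?f q"
    unfolding w by (rule without_append) (use A' in simp_all)
  also have "\<dots> = ?f (p' @ B # q')" by (simp flip: cl(2))
  finally have 2: "without A (?f (p @ A # q)) = ?f p' @ fac s m B # ?f q'" by simp
  have 3: "index_of B (?f p' @ fac s m B # ?f q') = length p'"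
    "without B (?f p' @ fac s m B # ?f q') = ?f (p' @ q')"
    using B' by (simp_all add: index_of_append without_append)
  have 4: "factor_at B (?f (p @ A # q)) = fac s m B"
  proof -
    have "B \<in> set p \<or> B \<in> set q" using cl(2) by (metis Un_iff in_set_conv_decomp set_append)
    then show ?thesis
    proof
      assume "B \<in> set p"
      then obtain a b where "p = a @ B # b" by (meson split_list)
      then have "?f (p @ A # q) = ?f a @ fac s m B # ?f (b @ A # q)" "B \<notin> set a" using cl(1) by auto
      then show ?thesis by (simp only: factor_at_append[OF circ_fac] circ_map_fac simp_thms)
    next
      assume "B \<in> set q"
      then obtain a b where "q = a @ B # b" by (meson split_list)
      then have "?f (p @ A # q) = ?f (p @ A # a) @ fac s m B # ?f b" "B \<notin> set (p @ A # a)" using cl(1) AB by auto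
      then show ?thesis by (simp only: factor_at_append[OF circ_fac] circ_map_fac simp_thms)
    qed
  qed
  show ?thesis
    unfolding partial_differential_def Let_def front_sign_def
    using AB t by (simp add: first_circle_eq[OF k] A[symmetric] B[symmetric] C[symmetric] 1 2 3 4 del: map_append list.map)
qed

lemma pd_split:
  assumes k: "k < n" and ntw: "\<not> tw s k" and tw: "tw (insert k s) k"
    and A: "A = cls s (fst (UL k))" and C: "C = cls (insert k s) (fst (UL k))"
    and C': "C' = cls (insert k s) (fst (LR k))"
    and cl: "distinct (p @ A # q)"
  shows "pd s k (map (fac s m) (p @ A # q)) =
    (\<Sum>u\<leftarrow>split_map C (local_orient K (insert k s) k C) C' (local_orient K (insert k s) k C') (fac s m A).
      single (insert k s, u @ map (fac s m) (p @ q))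
        (of_int ((- 1) ^ length p * orient_sign (local_orient K s k A) (fac s m A))))"
proof -
  let ?f = "map (fac s m)"
  have A2: "cls s (fst (LR k)) = A"
    using circles_distinct_iff[OF k, of s] ntw by (simp add: first_circle_eq[OF k] A)
  have CC': "C \<noteq> C'" using circles_distinct_iff[OF k, of "insert k s"] tw by (simp add: first_circle_eq[OF k] C C')
  have A': "A \<notin> circ ` set (?f p)" "A \<notin> circ ` set (?f q)" unfolding circ_map_fac using cl by simp_all
  have w: "?f (p @ A # q) = ?f p @ fac s m A # ?f q" by simp
  have 1: "index_of A (?f (p @ A # q)) = length p" "factor_at A (?f (p @ A # q)) = fac s m A"
    unfolding w using A' by (simp_all add: index_of_append factor_at_append)
  have 2: "without A (?f (p @ A # q)) = ?f (p @ q)"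
    unfolding w map_append[of _ p q] by (rule without_append) (use A' in simp_all)
  show ?thesis
    unfolding partial_differential_def Let_def front_sign_def
    using A2 CC' by (simp add: first_circle_eq[OF k] A[symmetric] C[symmetric] C'[symmetric] 1 2 del: map_append list.map)
qed

lemma pd_single:
  assumes k: "k < n" and "\<not> tw s k" "\<not> tw (insert k s) k"
  shows "pd s k w = 0"
  using circles_distinct_iff[OF k, of s] circles_distinct_iff[OF k, of "insert k s"] assms
  unfolding partial_differential_def Let_def by simp

text \<open>The monomial is sorted so that its at most two entries on the merging circles come
  first; the four cases are the four values of \<open>m\<close>.\<close>

lemma core_merge_aux:
  assumes s: "s \<in> states K i" "k < n" "k \<notin> s" and tw: "tw s k"
    and A: "A = cls s (fst (UL k))" and B: "B = cls s (fst (LR k))"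
    and m: "indep s (xa @ xb @ mb)" "set (xa @ xb @ mb) \<subseteq> oedges"
    and cl: "distinct cl" "set cl = circles K s"
    and xa: "xa = [] \<or> (\<exists>x. xa = [x] \<and> fst x \<in> A)"
    and xb: "xb = [] \<or> (\<exists>x. xb = [x] \<and> fst x \<in> B)"
    and mb: "\<forall>y\<in>set mb. fst y \<notin> A \<union> B"
  shows "eqv (Suc i) (pd s k (map (fac s (xa @ xb @ mb)) cl))
    (chi (insert k s) (xa @ xb @ mb) (of_int (sigma s k * lsgn (Ls s) cl) :: 'r::comm_ring_1))"
proof -
  define t where "t = insert k s"
  define C where "C = cls t (fst (UL k))"
  have k: "k < n" by (rule s)
  have adj: "adj k s t" unfolding t_def using s by (intro adj_insert)
  have t: "t \<in> states K (Suc i)" unfolding t_def using s by (intro insert_states)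
  note am = adj_merge[OF adj tw]
  note mc = merge_circles[OF adj tw, folded A B C_def]
  have "A \<in> set cl" using cl mc by simp
  then obtain p q where pq: "cl = p @ A # q" by (meson split_list)
  have "B \<in> set (p @ q)" using cl mc(1,4) pq by auto
  then obtain p' q' where pq': "p @ q = p' @ B # q'" by (meson split_list)
  define r where "r = p' @ q'"
  have d: "distinct (A # p' @ B # q')" using cl(1) unfolding pq pq'[symmetric] by auto
  have "insert A (set (p' @ B # q')) = circles K s" using cl(2) unfolding pq pq'[symmetric] by auto
  then have r: "set r = circles K s - {A, B}" using d mc(1) by (auto simp: r_def)
  have Cr: "distinct (C # r)" "set (C # r) = circles K t" using d r mc(6,7) by (auto simp: r_def)
  \<comment> \<open>These are \<open>UR k\<close> and \<open>LL k\<close> in some order. Directed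
    outwards, they carry the local orientations of the first and the second circle.\<close>
  define u1 u2 where "u1 = bet K s (UL k)" and "u2 = bet K s (LR k)"
  have u: "u1 \<in> {UR k, LL k}" "u2 \<in> {UR k, LL k}" unfolding u1_def u2_def using k by (auto simp: bet_UL_LR)
  have uc: "cls s (fst u1) = A" "cls s (fst u2) = B" unfolding u1_def u2_def A B by (simp_all add: cls_eq)
  have "fst u1 \<in> C" using uc(1) mc(2) self_cls[of "fst u1" s] by simp
  then have "cls t (fst u1) = C" by (simp add: C_def cls_eq_mem)
  moreover have ut: "st.ob t u1 = st.ob t u2" using u am(2) by auto
  ultimately have lt: "local_orient K t k C = ori t u1"
    using local_orient_eq[OF k u(1), of t] am(2) by simp
  have ls: "local_orient K s k A = ori s u1" "local_orient K s k B = ori s u2"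
    using local_orient_eq[OF k u(1), of s] local_orient_eq[OF k u(2), of s] tw tw_UR[OF k, of s] uc by auto
  define c0 :: int where "c0 = (- 1) ^ length p * (- 1) ^ length p'"
  let ?m = "xa @ xb @ mb"
  have "lsgn (Ls s) cl = (- 1) ^ length p * lsgn (Ls s) (A # p' @ B # q')"
    unfolding pq sgn_front pq' by simp
  also have "lsgn (Ls s) (A # p' @ B # q') = (- 1) ^ length p' * lsgn (Ls s) (A # B # r)"
    using alt_front[OF alt_Cons[OF alt_lsgn[OF Ls(2)[of s]], of A], of p' B q'] by (simp add: r_def)
  also have "lsgn (Ls s) (A # B # r) = msign s t k * lsgn (Ls t) (C # r)"
    unfolding A B C_def by (rule merge_order_sign[OF adj tw]) (use r A B in simp)
  \<comment> \<open>\<open>msign\<close> occurs in \<open>sigma\<close> and in the change of the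
    reference order. It squares to 1, so only the signs of the positions remain.\<close>
  finally have "sigma s k * lsgn (Ls s) cl = (msign s t k * msign s t k) * (c0 * lsgn (Ls t) (C # r))"
    using tw by (simp add: sigma_def t_def c0_def)
  then have sg: "sigma s k * lsgn (Ls s) cl = c0 * lsgn (Ls t) (C # r)"
    by (simp add: msign(1)[OF adj tw])
  have pd: "pd s k (map (fac s ?m) cl) =
    (\<Sum>u\<leftarrow>merge_map C (ori t u1) (fac s ?m A) (fac s ?m B).
      single (t, u @ map (fac s ?m) r)
        (of_int (c0 * orient_sign (ori s u1) (fac s ?m A) * orient_sign (ori s u2) (fac s ?m B)) :: 'r))"
    using pd_merge[OF k tw am(1)[unfolded t_def] A B, of C p q p' q' ?m] cl(1) pq pq' lt ls
    by (simp add: t_def C_def r_def c0_def)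
  have mb_out: "fst y \<notin> C" if "y \<in> set mb" for y using mb that mc(2) by auto
  have st: "cls t (fst y) = cls s (fst y) \<and> ori t y = ori s y" if "y \<in> set mb" for y
    using mc(8)[of y] mb_out[OF that] m(2) that by (auto simp: oedges_iff)
  have "indep s mb" using m(1) by (simp add: indep_def)
  then have imb: "indep t mb" using st by (rule_tac indep_state) auto
  have mbo: "set mb \<subseteq> oedges" using m(2) by auto
  have fr: "map (fac s ?m) r = map (fac t (xs @ mb)) r" if xs: "\<forall>x\<in>set xs. fst x \<in> C" for xs
  proof (rule map_cong[OF refl])
    fix X assume X: "X \<in> set r"
    have disj: "fst x \<notin> X" if "fst x \<in> C" for x :: oedge
      using that X r mc(2) circles_cls[OF mc(3)] circles_cls[OF mc(4)] circles_cls[of X s "fst x"] by auto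
    have "\<forall>x\<in>set (xa @ xb). fst x \<notin> X" using xa xb disj mc(2) by auto
    then have "fac s ((xa @ xb) @ mb) X = fac s mb X" by (intro fac_skip) blast
    then have "fac s ?m X = fac s mb X" by simp
    also have "\<dots> = fac t mb X" using st by (intro fac_state[symmetric]) auto
    also have "\<dots> = fac t (xs @ mb) X" using disj xs by (intro fac_skip[symmetric]) auto
    finally show "fac s ?m X = fac t (xs @ mb) X" .
  qed
  have fr0: "map (fac s ?m) r = map (fac t mb) r"
    by (rule fr[of "[]", unfolded append_Nil]) simp
  have nw: "eqv (Suc i) (single (t, map (fac t m') (C # r)) (of_int z :: 'r))
      (chi t m' (of_int (z * lsgn (Ls t) (C # r))))" if "indep t m'" "set m' \<subseteq> oedges" for m' z
    using norm_word[OF t Cr that, of "of_int z :: 'r"] by simp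
  have Cx: "cls t (fst x) = C" if "fst x \<in> C" for x :: oedge using that by (simp add: C_def cls_eq_mem)
  have fb: "fac s mb A = One_at A" "fac s mb B = One_at B" "fac t mb C = One_at C"
    using mb mb_out by (auto intro!: fac_Nil)
  have AB: "e \<notin> B" if "e \<in> A" for e using that mc(1) circles_cls[OF mc(3)] circles_cls[OF mc(4)] by auto
  \<comment> \<open>Oriented like \<open>u\<close> in \<open>s\<close>, the entry \<open>x\<close>
    has the local orientation of the merged circle in \<open>t\<close>, since a merge keeps orbits
    together. Undoing the reversal in \<open>t\<close> cancels the sign \<open>nsg\<close>.\<close>
  have one: "eqv (Suc i)
      (single (t, X_at C (ori t u1) # map (fac s ?m) r) (of_int (c0 * nsg s u x) :: 'r))
      (chi t (x # mb) (of_int (c0 * lsgn (Ls t) (C # r))))"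
    if x: "x \<in> oedges" "fst x \<in> C" and u: "st.ob s (nrm s u x) = st.ob s u" "st.ob t u = st.ob t u1" for x u
  proof -
    have "st.ob t (nrm s u x) = st.ob t u1" using am(5)[OF u(1)] u(2) by simp
    then have ox: "ori t (nrm s u x) = ori t u1" by (rule ori_cong)
    have ind: "indep t (nrm s u x # mb)" by (rule indep_Cons[OF imb, of C]) (use mb_out Cx x in auto)
    have mapeq: "map (fac t (nrm s u x # mb)) (C # r) = X_at C (ori t u1) # map (fac s ?m) r"
      using fr[of "[nrm s u x]"] x ox by (simp add: fac_Cons)
    have o: "set (nrm s u x # mb) \<subseteq> oedges" using x mbo by (simp add: oedges_iff)
    have "eqv (Suc i) (single (t, X_at C (ori t u1) # map (fac s ?m) r) (of_int (c0 * nsg s u x) :: 'r))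
       (chi t (nrm s u x # mb) (of_int (c0 * nsg s u x * lsgn (Ls t) (C # r))))"
      using nw[OF ind o, of "c0 * nsg s u x"] unfolding mapeq .
    also have "eqv (Suc i) \<dots> (chi t (x # mb) (of_int (c0 * lsgn (Ls t) (C # r))))"
      using eqv_sym[OF chi_nrm[OF t x(1) mbo, of "of_int (c0 * lsgn (Ls t) (C # r)) :: 'r" s u]]
      by (simp add: mult_ac)
    finally show ?thesis .
  qed
  have scA: "st.sc s x u1" if "fst x \<in> A" for x using that uc(1) mem_cls_fst[of x s u1] st.sc_sym by auto
  have scB: "st.sc s x u2" if "fst x \<in> B" for x using that uc(2) mem_cls_fst[of x s u2] st.sc_sym by auto
  from xa show ?thesis
  proof (elim disjE exE conjE)
    assume xa': "xa = []"
    from xb show ?thesis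
    proof (elim disjE exE conjE)
      assume xb': "xb = []"
      have "pd s k (map (fac s ?m) cl) = single (t, map (fac t mb) (C # r)) (of_int c0 :: 'r)"
        unfolding pd fr0 by (simp add: xa' xb' fb)
      then show ?thesis using nw[OF imb mbo, of c0] by (simp add: sg xa' xb' t_def)
    next
      fix x assume xb': "xb = [x]" "fst x \<in> B"
      then have "fst x \<notin> A" using AB by blast
      then have "pd s k (map (fac s ?m) cl) =
          single (t, X_at C (ori t u1) # map (fac s ?m) r) (of_int (c0 * nsg s u2 x) :: 'r)"
        unfolding pd using orient_sign_nsg[OF scB[OF xb'(2)]] by (simp add: xa' xb' fb fac_Cons)
      moreover have "x \<in> oedges" using m(2) xb' by auto
      ultimately show ?thesis
        using one[of x u2] nrm_ob[OF scB[OF xb'(2)]] ut xb' mc(2) by (simp add: sg xa' t_def)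
    qed
  next
    fix x assume xa': "xa = [x]" "fst x \<in> A"
    have xo: "x \<in> oedges" using m(2) xa' by auto
    from xb show ?thesis
    proof (elim disjE exE conjE)
      assume xb': "xb = []"
      have "fst x \<notin> B" using AB xa' by blast
      then have "pd s k (map (fac s ?m) cl) =
          single (t, X_at C (ori t u1) # map (fac s ?m) r) (of_int (c0 * nsg s u1 x) :: 'r)"
        unfolding pd using orient_sign_nsg[OF scA[OF xa'(2)]] by (simp add: xa' xb' fb fac_Cons)
      then show ?thesis
        using one[of x u1] nrm_ob[OF scA[OF xa'(2)]] xo xa' mc(2) by (simp add: sg xb' t_def)
    next
      fix y assume xb': "xb = [y]" "fst y \<in> B"
      then have "fst y \<notin> A" "fst x \<notin> B" using AB xa' by blast+
      then have "pd s k (map (fac s ?m) cl) = (0 :: 'r free_chain)"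
        unfolding pd using xa' xb' by (simp add: fac_Cons)
      \<comment> \<open>The value \<open>m(X \<and> X) = 0\<close> appears as a repeated circle in
        the monomial.\<close>
      moreover have "st.sc t x y" using Cx[of x] Cx[of y] xa' xb' mc(2) by (simp add: cls_eq[symmetric])
      then have "chi t ?m (of_int (sigma s k * lsgn (Ls s) cl) :: 'r) = 0"
        using xa' xb' by (simp add: chi_dep)
      ultimately show ?thesis by (simp add: t_def)
    qed
  qed
qed

lemma core_merge:
  assumes s: "s \<in> states K i" "k < n" "k \<notin> s" and tw: "tw s k"
    and m: "indep s m" "set m \<subseteq> oedges" and cl: "distinct cl" "set cl = circles K s"
  shows "eqv (Suc i) (pd s k (map (fac s m) cl))
    (chi (insert k s) m (of_int (sigma s k * lsgn (Ls s) cl) :: 'r::comm_ring_1))"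
proof -
  define A B where "A = cls s (fst (UL k))" and "B = cls s (fst (LR k))"
  have adj: "adj k s (insert k s)" using s by (intro adj_insert)
  note mc = merge_circles[OF adj tw, folded A_def B_def]
  obtain xa ma where a: "mset m = mset (xa @ ma)" "xa = [] \<or> (\<exists>x. xa = [x] \<and> fst x \<in> A)" "\<forall>y\<in>set ma. fst y \<notin> A"
    using extract_circle'[OF m(1) mc(3)] .
  have "indep s (xa @ ma)" using m(1) indep_mset[OF a(1)] by simp
  then have "indep s ma" by (simp add: indep_def)
  then obtain xb mb where b: "mset ma = mset (xb @ mb)" "xb = [] \<or> (\<exists>x. xb = [x] \<and> fst x \<in> B)" "\<forall>y\<in>set mb. fst y \<notin> B"
    using extract_circle'[OF _ mc(4)] by blast
  have ms: "mset m = mset (xa @ xb @ mb)" using a(1) b(1) by simp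
  have "set ma = set (xb @ mb)" using b(1) by (rule mset_eq_setD)
  then have mb: "\<forall>y\<in>set mb. fst y \<notin> A \<union> B" using a(3) b(3) by auto
  have i: "indep s (xa @ xb @ mb)" using m(1) indep_mset[OF ms] by simp
  have o: "set (xa @ xb @ mb) \<subseteq> oedges" using m(2) mset_eq_setD[OF ms] by simp
  have f: "map (fac s m) cl = map (fac s (xa @ xb @ mb)) cl"
    using fac_mset[OF m(1) ms] cl(2) by simp
  show ?thesis
    unfolding f chi_mset[OF ms] by (rule core_merge_aux[OF s tw A_def B_def i o cl a(2) b(2) mb])
qed

text \<open>Without an \<open>X\<close> on the splitting circle, the two monomials are the terms of
  \<open>\<Delta>(1)\<close>; with one, the product with \<open>X_1 + X_2\<close> reduces to
  \<open>\<Delta>(X) = X_1 X_2\<close>.\<close>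

lemma core_split_aux:
  assumes s: "s \<in> states K i" "k < n" "k \<notin> s" and ntw: "\<not> tw s k" and tw: "tw (insert k s) k"
    and A: "A = cls s (fst (UL k))"
    and m: "indep s (xa @ ma)" "set (xa @ ma) \<subseteq> oedges"
    and cl: "distinct cl" "set cl = circles K s"
    and xa: "xa = [] \<or> (\<exists>x. xa = [x] \<and> fst x \<in> A)"
    and ma: "\<forall>y\<in>set ma. fst y \<notin> A"
  shows "eqv (Suc i) (pd s k (map (fac s (xa @ ma)) cl))
    (chi (insert k s) (UR k # xa @ ma) (of_int (sigma s k * lsgn (Ls s) cl) :: 'r::comm_ring_1)
     + chi (insert k s) (LL k # xa @ ma) (of_int (sigma s k * lsgn (Ls s) cl)))"
proof -
  define t where "t = insert k s"
  define C C' where "C = cls t (fst (UL k))" and "C' = cls t (fst (LR k))"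
  have k: "k < n" by (rule s)
  \<comment> \<open>Circles, orientations and signs are all taken from the reverse merge, which
    leads from \<open>t\<close> to \<open>s\<close>.\<close>
  have adj: "adj k t s" unfolding t_def using s by (intro adj_sym[OF adj_insert])
  have t: "t \<in> states K (Suc i)" unfolding t_def using s by (intro insert_states)
  have twt: "tw t k" using tw by (simp add: t_def)
  note am = adj_merge[OF adj twt]
  note mc = merge_circles[OF adj twt, folded A C_def C'_def]
  have "A \<in> set cl" using cl mc by simp
  then obtain p q where pq: "cl = p @ A # q" by (meson split_list)
  define r where "r = p @ q"
  have "distinct (A # r)" "insert A (set r) = circles K s" using cl unfolding pq r_def by auto
  then have r: "distinct r" "set r = circles K t - {C, C'}" using mc(6,7) by auto
  have Cr: "distinct (C # C' # r)" "set (C # C' # r) = circles K t" using r mc(1,3,4) by auto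
  define u1 u2 where "u1 = bet K t (UL k)" and "u2 = bet K t (LR k)"
  have u: "u1 \<in> {UR k, LL k}" "u2 \<in> {UR k, LL k}" unfolding u1_def u2_def using k by (auto simp: bet_UL_LR)
  have uc: "cls t (fst u1) = C" "cls t (fst u2) = C'" unfolding u1_def u2_def C_def C'_def by (simp_all add: cls_eq)
  have uo: "u1 \<in> oedges" "u2 \<in> oedges" using u cor_edges[OF k] by (auto simp: oedges_iff)
  have uA: "fst u1 \<in> C" "fst u2 \<in> C'" using uc self_cls by auto
  have uA': "fst u1 \<notin> C'" "fst u2 \<notin> C"
    using uA mc(1) circles_cls[OF mc(3)] circles_cls[OF mc(4)] by auto
  have "fst u1 \<in> A" using uA mc(2) by simp
  then have "cls s (fst u1) = A" unfolding A by (simp add: cls_eq_mem)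
  moreover have us: "st.ob s u1 = st.ob s u2" using u am(2) by auto
  ultimately have ls: "local_orient K s k A = ori s u1"
    using local_orient_eq[OF k u(1), of s] am(2) by simp
  have lt: "local_orient K t k C = ori t u1" "local_orient K t k C' = ori t u2"
    using local_orient_eq[OF k u(1), of t] local_orient_eq[OF k u(2), of t] twt tw_UR[OF k, of t] uc by auto
  define c0 :: int where "c0 = (- 1) ^ length p"
  let ?m = "xa @ ma"
  have "lsgn (Ls s) cl = c0 * lsgn (Ls s) (A # r)"
    unfolding pq sgn_front c0_def r_def ..
  moreover have "lsgn (Ls t) (C # C' # r) = msign t s k * lsgn (Ls s) (A # r)"
    unfolding A C_def C'_def by (rule merge_order_sign[OF adj twt]) (use r C_def C'_def in simp)
  ultimately have sg: "sigma s k * lsgn (Ls s) cl = c0 * lsgn (Ls t) (C # C' # r)"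
    using ntw by (simp add: sigma_def t_def)
  have pd: "pd s k (map (fac s ?m) cl) =
    (\<Sum>u\<leftarrow>split_map C (ori t u1) C' (ori t u2) (fac s ?m A).
      single (t, u @ map (fac s ?m) r)
        (of_int (c0 * orient_sign (ori s u1) (fac s ?m A)) :: 'r))"
    using pd_split[OF k ntw tw A, of C C' p q ?m] cl(1) pq lt ls
    by (simp add: t_def C_def C'_def r_def c0_def)
  have ma_out: "fst y \<notin> C" "fst y \<notin> C'" if "y \<in> set ma" for y using ma that mc(2) by auto
  have mao: "set ma \<subseteq> oedges" using m(2) by auto
  have st: "cls t (fst y) = cls s (fst y) \<and> ori t y = ori s y" if "y \<in> set ma" for y
    using mc(8)[of y] ma that mao by (auto simp: oedges_iff)
  have "indep s ma" using m(1) by (simp add: indep_def)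
  then have ima: "indep t ma" using st by (rule_tac indep_state) auto
  have fr: "map (fac s ?m) r = map (fac t (xs @ ma)) r" if xs: "\<forall>x\<in>set xs. fst x \<in> A" for xs
  proof (rule map_cong[OF refl])
    fix X assume X: "X \<in> set r"
    have disj: "fst x \<notin> X" if "fst x \<in> A" for x :: oedge
      using that X r mc(2) circles_cls[OF mc(3)] circles_cls[OF mc(4)] circles_cls[of X t "fst x"] by auto
    have "\<forall>x\<in>set xa. fst x \<notin> X" using xa disj by auto
    then have "fac s ?m X = fac s ma X" by (intro fac_skip) blast
    also have "\<dots> = fac t ma X" using st by (intro fac_state[symmetric]) auto
    also have "\<dots> = fac t (xs @ ma) X" using disj xs by (intro fac_skip[symmetric]) auto
    finally show "fac s ?m X = fac t (xs @ ma) X" .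
  qed
  have nw: "eqv (Suc i) (single (t, map (fac t m') (C # C' # r)) (of_int z :: 'r))
      (chi t m' (of_int (z * lsgn (Ls t) (C # C' # r))))" if "indep t m'" "set m' \<subseteq> oedges" for m' z
    using norm_word[OF t Cr that, of "of_int z :: 'r"] by simp
  have fa: "fac s ma A = One_at A" "fac t ma C = One_at C" "fac t ma C' = One_at C'"
    using ma ma_out by (auto intro!: fac_Nil)
  define c :: 'r where "c = of_int (c0 * lsgn (Ls t) (C # C' # r))"
  have goal: "eqv (Suc i) (pd s k (map (fac s ?m) cl)) (chi t (u1 # ?m) c + chi t (u2 # ?m) c)"
    using xa
  proof (elim disjE exE conjE)
    assume xa': "xa = []"
    have i1: "indep t (u1 # ma)" "indep t (u2 # ma)"
      using indep_Cons[OF ima _ uc(1)] indep_Cons[OF ima _ uc(2)] ma_out by auto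
    have o1: "set (u1 # ma) \<subseteq> oedges" "set (u2 # ma) \<subseteq> oedges" using uo mao by auto
    have f1: "map (fac t (u1 # ma)) (C # C' # r) = X_at C (ori t u1) # One_at C' # map (fac s ?m) r"
      using fr[of "[u1]"] uA uA' fa mc(2) by (simp add: fac_Cons)
    have f2: "map (fac t (u2 # ma)) (C # C' # r) = One_at C # X_at C' (ori t u2) # map (fac s ?m) r"
      using fr[of "[u2]"] uA uA' fa mc(2) by (simp add: fac_Cons)
    have "pd s k (map (fac s ?m) cl)
       = single (t, map (fac t (u1 # ma)) (C # C' # r)) (of_int c0 :: 'r)
       + single (t, map (fac t (u2 # ma)) (C # C' # r)) (of_int c0)"
      unfolding f1 f2 pd by (simp add: xa' fa add.commute)
    also have "eqv (Suc i) \<dots> (chi t (u1 # ma) c + chi t (u2 # ma) c)"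
      unfolding c_def by (intro eqv_add nw i1 o1)
    finally show ?thesis by (simp add: xa')
  next
    fix x assume xa': "xa = [x]" "fst x \<in> A"
    have xo: "x \<in> oedges" using m(2) xa' by auto
    have sx: "st.sc s x u1"
      using xa'(2) \<open>cls s (fst u1) = A\<close> mem_cls_fst[of x s u1] st.sc_sym by auto
    define x' where "x' = nrm s u1 x"
    have x': "st.ob s x' = st.ob s u1" unfolding x'_def by (rule nrm_ob[OF sx])
    define \<epsilon> where "\<epsilon> = nsg s u1 x"
    have x'o: "x' \<in> oedges" using xo by (simp add: x'_def oedges_iff)
    have "indep t (u2 # ma)" by (rule indep_Cons[OF ima _ uc(2)]) (use ma_out in auto)
    then have i2: "indep t (u1 # u2 # ma)"
      by (rule indep_Cons[OF _ _ uc(1)]) (use ma_out uA' in auto)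
    have o2: "set (u1 # u2 # ma) \<subseteq> oedges" using uo mao by auto
    have f: "map (fac t (u1 # u2 # ma)) (C # C' # r) = X_at C (ori t u1) # X_at C' (ori t u2) # map (fac s ?m) r"
      using fr[of "[u1, u2]"] uA uA' fa mc(2) by (simp add: fac_Cons)
    have "pd s k (map (fac s ?m) cl)
       = single (t, map (fac t (u1 # u2 # ma)) (C # C' # r)) (of_int (c0 * \<epsilon>) :: 'r)"
      unfolding f pd using orient_sign_nsg[OF sx] by (simp add: xa' fac_Cons \<epsilon>_def)
    also have "eqv (Suc i) \<dots> (chi t (u1 # u2 # ma) (c * of_int \<epsilon>))"
      using nw[OF i2 o2, of "c0 * \<epsilon>"] by (simp add: c_def mult_ac)
    \<comment> \<open>On its new circle \<open>x'\<close> coincides with \<open>u1\<close> or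
      \<open>u2\<close>. The product with that one is a square and vanishes, the other product is
      the left-hand side.\<close>
    also have "chi t (u1 # u2 # ma) (c * of_int \<epsilon>)
       = chi t (u1 # x' # ma) (c * of_int \<epsilon>) + chi t (u2 # x' # ma) (c * of_int \<epsilon>)"
    proof -
      have "st.sc t x' u1 \<or> st.sc t x' u2"
      proof -
        have "fst x' \<in> C \<union> C'" using xa'(2) mc(2) by (simp add: x'_def)
        then have "cls t (fst x') = C \<or> cls t (fst x') = C'" unfolding C_def C'_def by (auto simp: cls_eq_mem)
        then show ?thesis using uc by (simp add: cls_eq[symmetric])
      qed
      moreover have "st.ob t x' = st.ob t v" if v: "v \<in> {u1, u2}" "st.sc t x' v" for v
      proof -
        \<comment> \<open>Opposite orbits in \<open>t\<close> would remain opposite after merging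
          back to \<open>s\<close>, where \<open>x'\<close> agrees with both \<open>u1\<close> and
          \<open>u2\<close>.\<close>
        have "st.ob t x' \<noteq> st.ob t (rev_oe v)"
        proof
          assume "st.ob t x' = st.ob t (rev_oe v)"
          then have "st.ob s x' = st.ob s (rev_oe v)" by (rule am(5))
          moreover have "st.ob s v = st.ob s x'" using v(1) x' us by auto
          ultimately show False using st.ob_al_neq[of s v] by simp
        qed
        then show ?thesis using v(2) by (simp add: st.sc_def)
      qed
      ultimately consider "st.sc t x' u1" "st.ob t x' = st.ob t u1" | "st.sc t x' u2" "st.ob t x' = st.ob t u2" by blast
      then show ?thesis
      proof cases
        case 1
        have "chi t (u1 # x' # ma) (c * of_int \<epsilon>) = 0" by (rule chi_dep[OF st.sc_sym[OF 1(1)]])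
        moreover have "chi t (u2 # x' # ma) (c * of_int \<epsilon>) = chi t (u1 # u2 # ma) (c * of_int \<epsilon>)"
          unfolding chi_swap[of t u2 x'] by (rule chi_ob[OF 1(2)])
        ultimately show ?thesis by simp
      next
        case 2
        have "chi t (u2 # x' # ma) (c * of_int \<epsilon>) = 0" by (rule chi_dep[OF st.sc_sym[OF 2(1)]])
        moreover have "chi t (u1 # x' # ma) (c * of_int \<epsilon>) = chi t (u1 # u2 # ma) (c * of_int \<epsilon>)"
          unfolding chi_swap[of t u1 x'] chi_swap[of t u1 u2] by (rule chi_ob[OF 2(2)])
        ultimately show ?thesis by simp
      qed
    qed
    also have "eqv (Suc i) \<dots> (chi t (u1 # x # ma) c + chi t (u2 # x # ma) c)"
      unfolding x'_def \<epsilon>_def by (intro eqv_add eqv_sym[OF chi_nrm2] t xo uo mao)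
    finally show ?thesis by (simp add: xa')
  qed
  have "(u1 = UR k \<and> u2 = LL k) \<or> (u1 = LL k \<and> u2 = UR k)"
    unfolding u1_def u2_def by (auto simp: bet_UL_LR[OF k])
  then show ?thesis using goal unfolding sg c_def t_def[symmetric] by (auto simp: add.commute)
qed

lemma core_split:
  assumes s: "s \<in> states K i" "k < n" "k \<notin> s" and ntw: "\<not> tw s k" and tw: "tw (insert k s) k"
    and m: "indep s m" "set m \<subseteq> oedges" and cl: "distinct cl" "set cl = circles K s"
  shows "eqv (Suc i) (pd s k (map (fac s m) cl))
    (chi (insert k s) (UR k # m) (of_int (sigma s k * lsgn (Ls s) cl) :: 'r::comm_ring_1)
     + chi (insert k s) (LL k # m) (of_int (sigma s k * lsgn (Ls s) cl)))"
proof -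
  define A where "A = cls s (fst (UL k))"
  have "A \<in> circles K s" unfolding A_def by (intro cls_circles cor_edges s)
  from extract_circle'[OF m(1) this]
  obtain xa ma where a: "mset m = mset (xa @ ma)" "xa = [] \<or> (\<exists>x. xa = [x] \<and> fst x \<in> A)" "\<forall>y\<in>set ma. fst y \<notin> A"
    by blast
  have i: "indep s (xa @ ma)" using m(1) indep_mset[OF a(1)] by simp
  have o: "set (xa @ ma) \<subseteq> oedges" using m(2) mset_eq_setD[OF a(1)] by simp
  have f: "map (fac s m) cl = map (fac s (xa @ ma)) cl"
    using fac_mset[OF m(1) a(1)] cl(2) by simp
  have "mset (x # m) = mset (x # xa @ ma)" for x using a(1) by simp
  note ch = chi_mset[OF this]
  show ?thesis
    unfolding f ch by (rule core_split_aux[OF s ntw tw A_def i o cl a(2,3)])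
qed

text \<open>The sign \<open>sigma s k\<close> is independent of the monomial, and the monomials in
  \<open>ym\<close> carry no signs; so the two can be compared separately on a face.\<close>

lemma core:
  assumes s: "s \<in> states K i" "k < n" "k \<notin> s"
    and m: "indep s m" "set m \<subseteq> oedges" and cl: "distinct cl" "set cl = circles K s"
  shows "eqv (Suc i) (pd s k (map (fac s m) cl))
    (\<Sum>m'\<leftarrow>ym s k m. chi (insert k s) m' (of_int (sigma s k * lsgn (Ls s) cl) :: 'r::comm_ring_1))"
proof -
  consider "tw s k" | "\<not> tw s k" "tw (insert k s) k" | "\<not> tw s k" "\<not> tw (insert k s) k" by blast
  then show ?thesis
  proof cases
    case 1 then show ?thesis using core_merge[OF s _ m cl] by (simp add: ym_def)
  next
    case 2 then show ?thesis using core_split[OF s _ _ m cl] by (simp add: ym_def)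
  next
    case 3 then show ?thesis by (simp add: ym_def pd_single[OF s(2)])
  qed
qed

end

section \<open>Faces of the cube\<close>

definition Zop :: "'a \<Rightarrow> 'a \<Rightarrow> ('a list \<Rightarrow> int) \<Rightarrow> 'a list \<Rightarrow> int" where
  "Zop a b F V = F (a # V) - F (b # V)"

text \<open>The two orders of contraction insert the same pairs of entries in opposite
  order.\<close>

lemma Zop_anticommute:
  assumes "alt F" shows "Zop a b (Zop c d F) V = - Zop c d (Zop a b F) V"
  using alt_swap[OF assms, of "[]" c a V] alt_swap[OF assms, of "[]" c b V]
    alt_swap[OF assms, of "[]" d a V] alt_swap[OF assms, of "[]" d b V]
  by (simp add: Zop_def)

lemma Zop_scale: "Zop a b (\<lambda>V. x * F V) V = x * Zop a b F V"
  by (simp add: Zop_def right_diff_distrib)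

context diagram
begin

abbreviation "Zk k \<equiv> Zop (fst (UL k)) (fst (LR k))"

lemma Zk_sigma:
  assumes "adj k s (insert k s)"
  shows "tw s k \<Longrightarrow> Zk k (D s) = (\<lambda>V. sigma s k * D (insert k s) V)"
    "\<not> tw s k \<Longrightarrow> tw (insert k s) k \<Longrightarrow> Zk k (D (insert k s)) = (\<lambda>V. sigma s k * D s V)"
  using msign(2)[OF assms] msign(2)[OF adj_sym[OF assms]] by (auto simp: Zop_def sigma_def)

lemma sigma_sq:
  assumes "adj k s (insert k s)" "tw s k \<or> tw (insert k s) k"
  shows "sigma s k * sigma s k = 1"
  using msign(1)[OF assms(1)] msign(1)[OF adj_sym[OF assms(1)]] assms(2) by (auto simp: sigma_def)

lemma exists_D: "\<exists>V. D s V = 1"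
proof -
  obtain V where V: "map (cls s) V = Ls s" using exists_complete by blast
  then show ?thesis using lsgn_self[OF Ls(2)[of s]] by (auto simp: D_def intro!: exI[of _ V])
qed

definition nc :: "state \<Rightarrow> nat" where "nc s = card (circles K s)"

lemma nc_adj:
  assumes "adj k s t"
  shows "tw s k \<Longrightarrow> nc t + 1 = nc s" "tw t k \<Longrightarrow> nc s + 1 = nc t"
    "\<not> tw s k \<Longrightarrow> \<not> tw t k \<Longrightarrow> nc t = nc s"
proof -
  have m: "nc t + 1 = nc s" if adj: "adj k s t" and tw: "tw s k" for s t
  proof -
    note mc = merge_circles[OF adj tw]
    have "card (circles K s - {cls s (fst (UL k)), cls s (fst (LR k))}) = nc s - 2"
      using mc(1,3,4) by (simp add: card_Diff_subset nc_def)
    moreover have "card {cls s (fst (UL k)), cls s (fst (LR k))} \<le> nc s"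
      unfolding nc_def by (rule card_mono) (use mc(3,4) finite_circles in auto)
    then have "2 \<le> nc s" using mc(1) by simp
    ultimately show ?thesis
      using mc(7) finite_circles[of s] unfolding nc_def[of t] mc(6) by (simp add: nc_def)
  qed
  show "tw s k \<Longrightarrow> nc t + 1 = nc s" "tw t k \<Longrightarrow> nc s + 1 = nc t"
    using m[OF assms] m[OF adj_sym[OF assms]] by auto
  show "nc t = nc s" if "\<not> tw s k" "\<not> tw t k"
  proof -
    have "cls t e = cls s e" for e
    proof -
      have "e' \<in> cls t e \<longleftrightarrow> e' \<in> cls s e" for e'
        unfolding mem_cls[of e' _ e True True] adj_single(1)[OF assms that] ..
      then show ?thesis by blast
    qed
    then show ?thesis by (simp add: nc_def circles_eq)
  qed
qed

text \<open>A contraction sees circles without orientation, so only the numbering matters;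
  exchanging the two circles negates the difference.\<close>

lemma Zk_aligned:
  assumes "aligned s k l al d"
  shows "Zk k (D s) = (\<lambda>V. (if al then 1 else - 1) * Zk l (D s) V)"
proof
  fix V
  have c: "D s (fst x # V) = D s (fst y # V)" if "st.sc s x y" for x y
    by (rule D_cong) (use that in \<open>simp add: cls_eq\<close>)
  have f: "st.sc s x y" if "st.ob s x = st.ob s ((if d then id else rev_oe) y)" for x y
    using that by (auto simp: st.sc_def split: if_splits)
  show "Zk k (D s) V = (if al then 1 else - 1) * Zk l (D s) V"
  proof (cases al)
    case True
    then have "st.sc s (UL k) (UL l)" "st.sc s (LR k) (LR l)"
      using assms f by (auto simp: aligned_def Let_def)
    then show ?thesis using True c by (simp add: Zop_def)
  next
    case False
    then have "st.sc s (UL k) (LR l)" "st.sc s (LR k) (UL l)"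
      using assms f by (auto simp: aligned_def Let_def)
    then show ?thesis using False c by (simp add: Zop_def)
  qed
qed

text \<open>\<open>bet K s x\<close> and \<open>rev_oe x\<close> lie on one orbit. This expresses
  the factor of a split by the corners \<open>UL k\<close> and \<open>LR k\<close>, in terms of
  which alignment is stated.\<close>

lemma ysum:
  assumes k: "k < n"
  shows "chi s (UR k # m) c + chi s (LL k # m) c = chi s (rev_oe (UL k) # m) c + chi s (rev_oe (LR k) # m) c"
proof -
  have "chi s (bet K s (UL k) # m) c = chi s (rev_oe (UL k) # m) c"
    "chi s (bet K s (LR k) # m) c = chi s (rev_oe (LR k) # m) c"
    by (intro chi_ob st.ob_be)+
  then show ?thesis by (auto simp: bet_UL_LR[OF k] add.commute split: if_splits)
qed

text \<open>In contrast to contractions only the orientation matters: a different numbering permutes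
  the two summands.\<close>

lemma ysum_aligned:
  fixes c :: "'r::comm_ring_1"
  assumes s: "s \<in> states K i" and kl: "k < n" "l < n" and al: "aligned s k l al d" and m: "set m \<subseteq> oedges"
  shows "eqv i (chi s (UR k # m) c + chi s (LL k # m) c)
    (fscale (if d then 1 else - 1) (chi s (UR l # m) c + chi s (LL l # m) c))"
proof -
  let ?f = "if d then id else rev_oe"
  have r: "st.ob s (rev_oe x) = st.ob s (rev_oe y)" if "st.ob s x = st.ob s y" for x y
    using that by (rule st.ob_al)
  have eq: "chi s (rev_oe (UL k) # m) c + chi s (rev_oe (LR k) # m) c
      = chi s (rev_oe (?f (UL l)) # m) c + chi s (rev_oe (?f (LR l)) # m) c"
  proof (cases al)
    case True
    then have h: "st.ob s (UL k) = st.ob s (?f (UL l))" "st.ob s (LR k) = st.ob s (?f (LR l))"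
      using al by (auto simp: aligned_def Let_def)
    show ?thesis unfolding chi_ob[OF r[OF h(1)]] chi_ob[OF r[OF h(2)]] ..
  next
    case False
    then have h: "st.ob s (UL k) = st.ob s (?f (LR l))" "st.ob s (LR k) = st.ob s (?f (UL l))"
      using al by (auto simp: aligned_def Let_def)
    show ?thesis unfolding chi_ob[OF r[OF h(1)]] chi_ob[OF r[OF h(2)]] by (rule add.commute)
  qed
  show ?thesis
  proof (cases d)
    case True then show ?thesis using eq ysum[OF kl(1), of s m c] ysum[OF kl(2), of s m c] by simp
  next
    case False
    have o: "UL l \<in> oedges" "LR l \<in> oedges" using cor_edges[OF kl(2)] by (auto simp: oedges_iff)
    have "eqv i (chi s (UL l # m) c + chi s (LR l # m) c) (- chi s (rev_oe (UL l) # m) c + - chi s (rev_oe (LR l) # m) c)"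
      by (intro eqv_add) (use chi_rev[OF s, of "rev_oe (UL l)" m c] chi_rev[OF s, of "rev_oe (LR l)" m c] o m in
        \<open>simp_all add: oedges_iff\<close>)
    moreover have "fscale (- 1) x = - x" for x :: "'r free_chain"
      by (simp add: free_chain.scale_minus_left)
    ultimately show ?thesis using False eq ysum[OF kl(1), of s m c] ysum[OF kl(2), of s m c] by simp
  qed
qed

text \<open>\<open>path2 s k l m c\<close>: the composite of the partial differentials at \<open>k\<close> and then at \<open>l\<close>.\<close>

definition path2 :: "state \<Rightarrow> nat \<Rightarrow> nat \<Rightarrow> oedge list \<Rightarrow> 'r::comm_ring_1 \<Rightarrow> 'r free_chain" where
  "path2 s k l m c = (\<Sum>m'\<leftarrow>ym s k m. \<Sum>m''\<leftarrow>ym (insert k s) l m'.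
     chi (insert l (insert k s)) m'' (of_int (sigma s k * sigma (insert k s) l) * c))"

lemma chi_scale: "chi s m (r * c) = fscale r (chi s m c)"
  by (simp add: chi_def)

end

section \<open>Signs and cancellation on one face of the cube\<close>

locale cube_face = diagram +
  fixes s :: state and k l i :: nat
  assumes s: "s \<in> states K i" and kl: "k < n" "l < n" "k \<notin> s" "l \<notin> s" "k \<noteq> l"
begin

abbreviation "a \<equiv> insert k s"
abbreviation "b \<equiv> insert l s"
abbreviation "q \<equiv> insert l (insert k s)"

lemma q_eq: "insert k (insert l s) = q" by blast

lemma adjs: "adj k s a" "adj l s b" "adj l a q" "adj k b q" "adj k b (insert k b)"
proof -
  show "adj k s a" "adj l s b" "adj l a q" using kl by (auto intro!: adj_insert)
  show "adj k b (insert k b)" using kl by (auto intro!: adj_insert)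
  then show "adj k b q" by (simp only: q_eq)
qed

lemma q_states: "q \<in> states K (Suc (Suc i))"
  using kl by (intro insert_states s) auto

abbreviation "s1 \<equiv> sigma s k"
abbreviation "s2 \<equiv> sigma a l"
abbreviation "s3 \<equiv> sigma s l"
abbreviation "s4 \<equiv> sigma b k"

lemma Z:
  "tw s k \<Longrightarrow> Zk k (D s) = (\<lambda>V. s1 * D a V)" "\<not> tw s k \<Longrightarrow> tw a k \<Longrightarrow> Zk k (D a) = (\<lambda>V. s1 * D s V)"
  "tw a l \<Longrightarrow> Zk l (D a) = (\<lambda>V. s2 * D q V)" "\<not> tw a l \<Longrightarrow> tw q l \<Longrightarrow> Zk l (D q) = (\<lambda>V. s2 * D a V)"
  "tw s l \<Longrightarrow> Zk l (D s) = (\<lambda>V. s3 * D b V)" "\<not> tw s l \<Longrightarrow> tw b l \<Longrightarrow> Zk l (D b) = (\<lambda>V. s3 * D s V)"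
  "tw b k \<Longrightarrow> Zk k (D b) = (\<lambda>V. s4 * D q V)" "\<not> tw b k \<Longrightarrow> tw q k \<Longrightarrow> Zk k (D q) = (\<lambda>V. s4 * D b V)"
  by (rule Zk_sigma[OF adjs(1)] Zk_sigma[OF adjs(2)] Zk_sigma[OF adjs(3)]
      Zk_sigma[OF adjs(5), unfolded q_eq]; assumption)+

lemma sq:
  "tw s k \<or> tw a k \<Longrightarrow> s1 * s1 = 1" "tw a l \<or> tw q l \<Longrightarrow> s2 * s2 = 1"
  "tw s l \<or> tw b l \<Longrightarrow> s3 * s3 = 1" "tw b k \<or> tw q k \<Longrightarrow> s4 * s4 = 1"
  by (rule sigma_sq[OF adjs(1)] sigma_sq[OF adjs(2)] sigma_sq[OF adjs(3)]
      sigma_sq[OF adjs(5), unfolded q_eq]; assumption)+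

text \<open>\<open>M\<close>, \<open>S\<close> and \<open>E\<close> stand for a merge, a split and a
  single-cycle edge; of two pairs, the first is the path through \<open>a\<close> and the second the
  one through \<open>b\<close>. Here both double contractions lead from \<open>D s\<close> to
  multiples of \<open>D q\<close>.\<close>

lemma sign_MM:
  assumes "tw s k" "tw a l" "tw s l" "tw b k" shows "s1 * s2 = - (s3 * s4)"
proof -
  obtain V where V: "D q V = 1" using exists_D by blast
  have "Zk l (Zk k (D s)) V = - Zk k (Zk l (D s)) V" by (rule Zop_anticommute[OF alt_D])
  then show ?thesis using assms V by (simp add: Z Zop_scale)
qed

text \<open>Contractions run against splits, hence start from \<open>D q\<close> and end at
  \<open>D s\<close>.\<close>

lemma sign_SS:
  assumes "\<not> tw s k" "tw a k" "\<not> tw a l" "tw q l" "\<not> tw s l" "tw b l" "\<not> tw b k" "tw q k"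
  shows "s1 * s2 = - (s3 * s4)"
proof -
  obtain V where V: "D s V = 1" using exists_D by blast
  have "Zk l (Zk k (D q)) V = - Zk k (Zk l (D q)) V" by (rule Zop_anticommute[OF alt_D])
  then have "s4 * s3 = - (s2 * s1)" using assms V by (simp add: Z Zop_scale)
  then show ?thesis by (simp add: mult.commute)
qed

text \<open>\<open>b\<close> has the most circles and \<open>a\<close> the fewest, so the double
  contractions lead from \<open>D b\<close> to \<open>D a\<close>, through \<open>D s\<close> and
  through \<open>D q\<close>.\<close>

lemma sign_MS_SM:
  assumes "tw s k" "\<not> tw a l" "tw q l" "\<not> tw s l" "tw b l" "tw b k"
  shows "s1 * s2 = - (s3 * s4)"
proof -
  obtain V where V: "D a V = 1" using exists_D by blast
  have "Zk l (Zk k (D b)) V = - Zk k (Zk l (D b)) V" by (rule Zop_anticommute[OF alt_D])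
  then have "s4 * s2 = - (s3 * s1)" using assms V by (simp add: Z Zop_scale)
  then have "(s4 * s2) * (s2 * s3) = - (s3 * s1) * (s2 * s3)" by simp
  then have "(s2 * s2) * (s3 * s4) = - (s3 * s3) * (s1 * s2)" by (simp add: mult_ac)
  then show ?thesis using sq assms by simp
qed

text \<open>\<open>s\<close> and \<open>q\<close> have one circle more than \<open>a\<close> and
  \<open>b\<close>, so there is no double contraction across the face. Instead, the contractions at
  \<open>k\<close> and \<open>l\<close> coincide up to sign, for \<open>D s\<close> and for
  \<open>D q\<close>; the product of these two signs depends on \<open>d\<close> only.\<close>

lemma sign_MS_MS:
  assumes "tw s k" "\<not> tw a l" "tw q l" "tw s l" "\<not> tw b k" "tw q k"
  obtains al d where "aligned q k l al d" "s1 * s2 = (if d then - 1 else 1) * (s3 * s4)"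
proof -
  obtain al d where al: "aligned s k l al d" "aligned q k l (al \<noteq> d) d"
    using diamond_signs[OF adjs(1,2,3,4) kl(5)] assms by blast
  obtain V where V: "D a V = 1" using exists_D by blast
  \<comment> \<open>The unknown value of \<open>D b\<close> at a list that normalises
    \<open>D a\<close>; it is eliminated between the equations obtained from \<open>s\<close> and
    from \<open>q\<close>.\<close>
  define \<beta> where "\<beta> = D b V"
  have 1: "s1 = (if al then 1 else - 1) * (s3 * \<beta>)"
    using fun_cong[OF Zk_aligned[OF al(1)], of V] assms V by (simp add: Z \<beta>_def)
  have 2: "s4 * \<beta> = (if al \<noteq> d then 1 else - 1) * s2"
    using fun_cong[OF Zk_aligned[OF al(2)], of V] assms V by (simp add: Z \<beta>_def)
  have sq': "s2 * s2 = 1" "s4 * s4 = 1" using sq assms by auto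
  have "s4 * s4 * \<beta> = s4 * ((if al \<noteq> d then 1 else - 1) * s2)" using 2 by (simp only: mult.assoc)
  then have "\<beta> = (if al \<noteq> d then 1 else - 1) * (s4 * s2)" using sq' by (simp add: mult_ac split: if_splits)
  then have "s1 * s2 = (if al then 1 else - 1) * (if al \<noteq> d then 1 else - 1) * (s3 * s4) * (s2 * s2)"
    using 1 by (simp add: mult_ac split: if_splits)
  then have "s1 * s2 = (if d then - 1 else 1) * (s3 * s4)"
    using sq' by (cases al; cases d) auto
  then show ?thesis using that al(2) by blast
qed

text \<open>Now \<open>a\<close> and \<open>b\<close> are the states in which both crossings join
  two circles. The alignment in \<open>a\<close> survives in \<open>q\<close> because a merge keeps
  orbits together.\<close>

lemma sign_SM_SM:
  assumes "\<not> tw s k" "tw a k" "tw a l" "\<not> tw s l" "tw b l" "tw b k"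
  obtains al d where "aligned q k l al d" "s1 * s2 = (if d then - 1 else 1) * (s3 * s4)"
proof -
  obtain al d where al: "aligned a k l al d" "aligned b k l (al \<noteq> d) d"
    using diamond_signs[OF adj_sym[OF adjs(1)] adjs(3) adjs(2) adj_sym[OF adjs(4)] kl(5)] assms by blast
  have alq: "aligned q k l al d"
  proof (cases al)
    case True
    then have h: "st.ob a (UL k) = st.ob a ((if d then id else rev_oe) (UL l))"
      "st.ob a (LR k) = st.ob a ((if d then id else rev_oe) (LR l))"
      using al(1) by (simp_all only: aligned_def Let_def if_True)
    from adj_merge(5)[OF adjs(3) assms(3) h(1)] adj_merge(5)[OF adjs(3) assms(3) h(2)] show ?thesis
      unfolding aligned_def Let_def using True by (simp only: if_True simp_thms)
  next
    case False
    then have h: "st.ob a (UL k) = st.ob a ((if d then id else rev_oe) (LR l))"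
      "st.ob a (LR k) = st.ob a ((if d then id else rev_oe) (UL l))"
      using al(1) by (simp_all only: aligned_def Let_def if_False)
    from adj_merge(5)[OF adjs(3) assms(3) h(1)] adj_merge(5)[OF adjs(3) assms(3) h(2)] show ?thesis
      unfolding aligned_def Let_def using False by (simp only: if_False simp_thms)
  qed
  obtain V where V: "D s V = 1" using exists_D by blast
  define \<beta> where "\<beta> = D q V"
  have 1: "s1 = (if al then 1 else - 1) * (s2 * \<beta>)"
    using fun_cong[OF Zk_aligned[OF al(1)], of V] assms V by (simp add: Z \<beta>_def)
  have 2: "s4 * \<beta> = (if al \<noteq> d then 1 else - 1) * s3"
    using fun_cong[OF Zk_aligned[OF al(2)], of V] assms V by (simp add: Z \<beta>_def)
  have sq': "s2 * s2 = 1" "s4 * s4 = 1" using sq assms by auto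
  have "s4 * s4 * \<beta> = s4 * ((if al \<noteq> d then 1 else - 1) * s3)" using 2 by (simp only: mult.assoc)
  then have "\<beta> = (if al \<noteq> d then 1 else - 1) * (s3 * s4)" using sq' by (simp add: mult_ac split: if_splits)
  then have "s1 * s2 = (if al then 1 else - 1) * (if al \<noteq> d then 1 else - 1) * (s3 * s4) * (s2 * s2)"
    using 1 by (simp add: mult_ac split: if_splits)
  then have "s1 * s2 = (if d then - 1 else 1) * (s3 * s4)"
    using sq' by (cases al; cases d) auto
  then show ?thesis using that alq by blast
qed

end

context cube_face
begin

lemma path_eq:
  "path2 s k l m c = (\<Sum>m'\<leftarrow>ym s k m. \<Sum>m''\<leftarrow>ym a l m'. chi q m'' (of_int (s1 * s2) * c))"
  "path2 s l k m c = (\<Sum>m'\<leftarrow>ym s l m. \<Sum>m''\<leftarrow>ym b k m'. chi q m'' (of_int (s3 * s4) * c))"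
  unfolding path2_def q_eq by (rule refl)+

lemma ym_eq:
  "ym s k m = (if tw s k then [m] else if tw a k then [UR k # m, LL k # m] else [])"
  "ym a l m = (if tw a l then [m] else if tw q l then [UR l # m, LL l # m] else [])"
  "ym s l m = (if tw s l then [m] else if tw b l then [UR l # m, LL l # m] else [])"
  "ym b k m = (if tw b k then [m] else if tw q k then [UR k # m, LL k # m] else [])"
  unfolding ym_def q_eq by (rule refl)+

lemma cancel:
  assumes "s1 * s2 = - (s3 * s4)"
  shows "chi q m' (of_int (s1 * s2) * c) + chi q m' (of_int (s3 * s4) * c) = 0"
  unfolding assms by (simp add: chi_minus)

text \<open>If \<open>d\<close> holds, the factors of the two splits agree and the coefficients are
  opposite; otherwise the coefficients agree and the factors are opposite.\<close>

lemma cancel_aligned: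
  fixes c :: "'r::comm_ring_1"
  assumes al: "aligned q k l al d" and sg: "x = (if d then - 1 else 1) * (y::int)" and m: "set m \<subseteq> oedges"
  shows "eqv (Suc (Suc i)) (chi q (UR l # m) (of_int x * c) + chi q (LL l # m) (of_int x * c)
      + (chi q (UR k # m) (of_int y * c) + chi q (LL k # m) (of_int y * c))) 0"
proof -
  have "eqv (Suc (Suc i)) (chi q (UR l # m) (of_int x * c) + chi q (LL l # m) (of_int x * c)
      + (chi q (UR k # m) (of_int y * c) + chi q (LL k # m) (of_int y * c)))
     (chi q (UR l # m) (of_int x * c) + chi q (LL l # m) (of_int x * c)
      + fscale (if d then 1 else - 1) (chi q (UR l # m) (of_int y * c) + chi q (LL l # m) (of_int y * c)))"
    by (intro eqv_add eqv_refl ysum_aligned[OF q_states kl(1,2) al m])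
  also have "\<dots> = 0" unfolding sg
    by (cases d) (simp_all add: chi_minus free_chain.scale_minus_left)
  finally show ?thesis .
qed

text \<open>In \<open>q\<close> the corners \<open>UR k\<close> and \<open>LL k\<close> are
  traversed in opposite senses. So a split at \<open>k\<close> followed by a merge vanishes modulo
  the relations if the other path resmooths \<open>k\<close> without changing the number of
  circles.\<close>

lemma cancel_single:
  fixes c :: "'r::comm_ring_1"
  assumes E: "\<not> tw b k" "\<not> tw q k" and m: "set m \<subseteq> oedges"
  shows "eqv (Suc (Suc i)) (chi q (UR k # m) c + chi q (LL k # m) c) 0"
proof -
  have "chi q (LL k # m) c = chi q (rev_oe (UR k) # m) c"
    by (rule chi_ob) (rule adj_single(2)[OF adjs(4) E])
  moreover have "eqv (Suc (Suc i)) (chi q (UR k # m) c + chi q (rev_oe (UR k) # m) c)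
      (chi q (UR k # m) c + - chi q (UR k # m) c)"
    using cor_edges[OF kl(1)] by (intro eqv_add eqv_refl chi_rev[OF q_states _ m]) (simp add: oedges_iff)
  ultimately show ?thesis by simp
qed

text \<open>Two single-cycle edges change no unoriented circle, so \<open>s\<close> and
  \<open>q\<close> agree on whether two circles meet at \<open>l\<close>.\<close>

lemma MS_not_EE:
  assumes "tw q l" "\<not> tw s l" "\<not> tw b l" "\<not> tw b k" "\<not> tw q k" shows False
  using assms(1,2) adj_single(1)[OF adjs(4) assms(4,5)] adj_single(1)[OF adjs(2) assms(2,3)]
  by (simp add: tw_def)

text \<open>Both paths change the number of circles by the same amount. If only one of them contains
  a single-cycle edge, parity makes it \<open>EE\<close>; the other is then a split and a merge, and
  \<open>MS_not_EE\<close> fixes their order.\<close>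

lemma types:
  obtains (MM) "tw s k" "tw a l" "tw s l" "tw b k"
  | (SS) "\<not> tw s k" "tw a k" "\<not> tw a l" "tw q l" "\<not> tw s l" "tw b l" "\<not> tw b k" "tw q k"
  | (MS_SM) "tw s k" "\<not> tw a l" "tw q l" "\<not> tw s l" "tw b l" "tw b k"
  | (SM_MS) "\<not> tw s k" "tw a k" "tw a l" "tw s l" "\<not> tw b k" "tw q k"
  | (MS_MS) "tw s k" "\<not> tw a l" "tw q l" "tw s l" "\<not> tw b k" "tw q k"
  | (SM_SM) "\<not> tw s k" "tw a k" "tw a l" "\<not> tw s l" "tw b l" "tw b k"
  | (SM_EE) "\<not> tw s k" "tw a k" "tw a l" "\<not> tw s l" "\<not> tw b l" "\<not> tw b k" "\<not> tw q k"
  | (EE_SM) "\<not> tw s l" "tw b l" "tw b k" "\<not> tw s k" "\<not> tw a k" "\<not> tw a l" "\<not> tw q l"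
  | (zero) "\<not> tw s k \<and> \<not> tw a k \<or> \<not> tw a l \<and> \<not> tw q l" "\<not> tw s l \<and> \<not> tw b l \<or> \<not> tw b k \<and> \<not> tw q k"
proof -
  have K: "\<not> (tw q k \<and> \<not> tw s k \<and> \<not> tw a k \<and> \<not> tw a l \<and> \<not> tw q l)"
  proof -
    interpret sw: cube_face K s l k i by unfold_locales (use s kl in auto)
    show ?thesis using sw.MS_not_EE unfolding q_eq by blast
  qed
  have tri: "tw s' j \<and> nc t + 1 = nc s' \<and> \<not> tw t j \<or> tw t j \<and> nc s' + 1 = nc t \<and> \<not> tw s' j
      \<or> \<not> tw s' j \<and> \<not> tw t j \<and> nc t = nc s'" if adj: "adj j s' t" for j s' t
    using nc_adj[OF adj] adj_merge(1)[OF adj] by blast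
  have K2: "\<not> (tw q l \<and> \<not> tw s l \<and> \<not> tw b l \<and> \<not> tw b k \<and> \<not> tw q k)"
    using MS_not_EE by blast
  have "tw s k \<and> tw a l \<and> tw s l \<and> tw b k
    \<or> \<not> tw s k \<and> tw a k \<and> \<not> tw a l \<and> tw q l \<and> \<not> tw s l \<and> tw b l \<and> \<not> tw b k \<and> tw q k
    \<or> tw s k \<and> \<not> tw a l \<and> tw q l \<and> \<not> tw s l \<and> tw b l \<and> tw b k
    \<or> \<not> tw s k \<and> tw a k \<and> tw a l \<and> tw s l \<and> \<not> tw b k \<and> tw q k
    \<or> tw s k \<and> \<not> tw a l \<and> tw q l \<and> tw s l \<and> \<not> tw b k \<and> tw q k
    \<or> \<not> tw s k \<and> tw a k \<and> tw a l \<and> \<not> tw s l \<and> tw b l \<and> tw b k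
    \<or> \<not> tw s k \<and> tw a k \<and> tw a l \<and> \<not> tw s l \<and> \<not> tw b l \<and> \<not> tw b k \<and> \<not> tw q k
    \<or> \<not> tw s l \<and> tw b l \<and> tw b k \<and> \<not> tw s k \<and> \<not> tw a k \<and> \<not> tw a l \<and> \<not> tw q l
    \<or> (\<not> tw s k \<and> \<not> tw a k \<or> \<not> tw a l \<and> \<not> tw q l) \<and> (\<not> tw s l \<and> \<not> tw b l \<or> \<not> tw b k \<and> \<not> tw q k)"
    using tri[OF adjs(1)] tri[OF adjs(2)] tri[OF adjs(3)] tri[OF adjs(4)] K K2
    by (elim disjE conjE) simp_all
  then show ?thesis
    by (elim disjE[of _ "_ \<or> _"] disjE[where Q = "_ \<and> (_ \<or> _)"] conjE) (blast intro: that)+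
qed

lemma face:
  fixes c :: "'r::comm_ring_1"
  assumes m: "set m \<subseteq> oedges"
  shows "eqv (Suc (Suc i)) (path2 s k l m c + path2 s l k m c) 0"
proof -
  show ?thesis
  proof (cases rule: types)
    case MM
    then show ?thesis using cancel[OF sign_MM, of m c] by (simp add: path_eq ym_eq del: of_int_mult)
  next
    case SS
    note e = cancel[OF sign_SS[OF SS]]
    have "path2 s k l m c + path2 s l k m c = 0"
      using SS e[of "UR l # UR k # m" c] e[of "LL l # UR k # m" c] e[of "UR l # LL k # m" c] e[of "LL l # LL k # m" c]
        chi_swap[of q "UR k" "UR l" m "of_int (s3 * s4) * c"] chi_swap[of q "UR k" "LL l" m "of_int (s3 * s4) * c"]
        chi_swap[of q "LL k" "UR l" m "of_int (s3 * s4) * c"] chi_swap[of q "LL k" "LL l" m "of_int (s3 * s4) * c"]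
      by (simp add: path_eq ym_eq add_eq_0_iff del: of_int_mult)
    then show ?thesis by simp
  next
    case MS_SM
    note e = cancel[OF sign_MS_SM[OF MS_SM]]
    have "path2 s k l m c + path2 s l k m c = 0"
      using MS_SM e[of "UR l # m" c] e[of "LL l # m" c]
      by (simp add: path_eq ym_eq add_eq_0_iff del: of_int_mult)
    then show ?thesis by simp
  next
    case SM_MS
    interpret sw: cube_face K s l k i by unfold_locales (use s kl in auto)
    have "s1 * s2 = - (s3 * s4)" using sw.sign_MS_SM SM_MS unfolding q_eq by simp
    note e = cancel[OF this]
    have "path2 s k l m c + path2 s l k m c = 0"
      using SM_MS e[of "UR k # m" c] e[of "LL k # m" c]
      by (simp add: path_eq ym_eq add_eq_0_iff del: of_int_mult)
    then show ?thesis by simp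
  next
    case MS_MS
    obtain al d where al: "aligned q k l al d" "s1 * s2 = (if d then - 1 else 1) * (s3 * s4)"
      using sign_MS_MS[OF MS_MS] .
    show ?thesis
      using cancel_aligned[OF al m, of c] MS_MS by (simp add: path_eq ym_eq del: of_int_mult)
  next
    case SM_SM
    obtain al d where al: "aligned q k l al d" "s1 * s2 = (if d then - 1 else 1) * (s3 * s4)"
      using sign_SM_SM[OF SM_SM] .
    have "s3 * s4 = (if d then - 1 else 1) * (s1 * s2)" using al(2) by simp
    from cancel_aligned[OF al(1) this m, of c] show ?thesis
      using SM_SM by (simp add: path_eq ym_eq add.commute del: of_int_mult)
  next
    case SM_EE
    then show ?thesis using cancel_single[OF SM_EE(6,7) m, of "of_int (s1 * s2) * c"]
      by (simp add: path_eq ym_eq del: of_int_mult)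
  next
    case EE_SM
    interpret sw: cube_face K s l k i by unfold_locales (use s kl in auto)
    show ?thesis using sw.cancel_single[OF EE_SM(6), of m "of_int (s3 * s4) * c"] EE_SM m
      by (simp add: path_eq ym_eq q_eq del: of_int_mult)
  next
    case zero
    then show ?thesis by (auto simp: path_eq ym_eq)
  qed
qed

end

section \<open>The differential\<close>

definition dgen :: "vdiagram \<Rightarrow> state \<times> word \<Rightarrow> 'r::comm_ring_1 free_chain" where
  "dgen K g = (\<Sum>k\<in>{..<num_cross K} - fst g. partial_differential K (fst g) k (snd g))"

lemma fd_eq_sum:
  fixes x :: "'r::comm_ring_1 free_chain"
  assumes "finite S" "Poly_Mapping.keys x \<subseteq> S"
  shows "free_differential K x = (\<Sum>g\<in>S. fscale (Poly_Mapping.lookup x g) (dgen K g))"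
proof -
  have "free_differential K x = (\<Sum>g\<in>Poly_Mapping.keys x. fscale (Poly_Mapping.lookup x g) (dgen K g))"
    unfolding free_differential_def dgen_def
    by (intro sum.cong refl) (auto simp: free_chain.scale_sum_right)
  also have "\<dots> = (\<Sum>g\<in>S. fscale (Poly_Mapping.lookup x g) (dgen K g))"
    by (rule sum.mono_neutral_left) (use assms in \<open>auto simp: in_keys_iff\<close>)
  finally show ?thesis .
qed

lemma fd_add: "free_differential K (x + y) = free_differential K x + free_differential K y"
proof -
  let ?S = "Poly_Mapping.keys x \<union> Poly_Mapping.keys y"
  have "Poly_Mapping.keys (x + y) \<subseteq> ?S" by (rule Poly_Mapping.keys_add)
  then show ?thesis
    by (simp add: fd_eq_sum[of ?S] lookup_add free_chain.scale_left_distrib sum.distrib)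
qed

lemma fd_single: "free_differential K (single g c) = fscale c (dgen K g)"
  by (simp add: fd_eq_sum[of "{g}"])

lemma fd_zero [simp]: "free_differential K 0 = 0"
  by (simp add: free_differential_def)

lemma keys_fscale: "Poly_Mapping.keys (fscale r x) \<subseteq> Poly_Mapping.keys x"
  by (auto simp: in_keys_iff)

lemma fd_scale: "free_differential K (fscale r x) = fscale r (free_differential K x)"
proof -
  show ?thesis using keys_fscale[of r x]
    by (simp add: fd_eq_sum[of "Poly_Mapping.keys x"] free_chain.scale_sum_right)
qed

lemma fd_diff: "free_differential K (x - y) = free_differential K x - free_differential K y"
  using fd_add[of K "x - y" y] by simp

lemma fd_sum: "free_differential K (sum f A) = (\<Sum>a\<in>A. free_differential K (f a))"
  by (induction A rule: infinite_finite_induct) (simp_all add: fd_add)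

lemma fd_sum_list: "free_differential K (\<Sum>a\<leftarrow>xs. f a) = (\<Sum>a\<leftarrow>xs. free_differential K (f a))"
  by (induction xs) (simp_all add: fd_add)

lemma sum_list_scale: "fscale r (\<Sum>a\<leftarrow>xs. f a) = (\<Sum>a\<leftarrow>xs. fscale r (f a))"
  by (induction xs) (simp_all add: free_chain.scale_right_distrib)

lemma not_distinct_map_mset:
  "\<not> distinct (map f m) \<Longrightarrow> \<exists>x y m0. mset m = mset (x # y # m0) \<and> f x = f y"
proof (induction m)
  case (Cons a m)
  show ?case
  proof (cases "distinct (map f m)")
    case True
    then obtain y where y: "y \<in> set m" "f a = f y" using Cons.prems by auto
    then obtain p q where "m = p @ y # q" by (meson split_list)
    then show ?thesis using y(2) by (intro exI[of _ a] exI[of _ y] exI[of _ "p @ q"]) simp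
  next
    case False
    then obtain x y m0 where "mset m = mset (x # y # m0)" "f x = f y" using Cons.IH by blast
    then show ?thesis by (intro exI[of _ x] exI[of _ y] exI[of _ "a # m0"]) simp
  qed
qed simp

text \<open>The ordered pairs are matched with their transposes by induction on the index set, which
  avoids dividing a symmetrised sum by 2.\<close>

lemma sum_off_diagonal:
  fixes T :: "'a \<Rightarrow> 'a \<Rightarrow> 'b::ab_group_add"
  assumes "finite A" and P0: "P 0" and Padd: "\<And>x y. P x \<Longrightarrow> P y \<Longrightarrow> P (x + y)"
    and T: "\<And>k l. k \<in> A \<Longrightarrow> l \<in> A \<Longrightarrow> k \<noteq> l \<Longrightarrow> P (T k l + T l k)"
  shows "P (\<Sum>k\<in>A. \<Sum>l\<in>A - {k}. T k l)"
  using assms(1) T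
proof (induction A rule: finite_induct)
  case (insert x A)
  have "(\<Sum>k\<in>insert x A. \<Sum>l\<in>insert x A - {k}. T k l)
      = (\<Sum>l\<in>A. T x l) + (\<Sum>k\<in>A. \<Sum>l\<in>insert x A - {k}. T k l)"
    using insert.hyps by simp
  also have "(\<Sum>k\<in>A. \<Sum>l\<in>insert x A - {k}. T k l) = (\<Sum>k\<in>A. T k x + (\<Sum>l\<in>A - {k}. T k l))"
  proof (rule sum.cong[OF refl])
    fix k assume "k \<in> A"
    then have "insert x A - {k} = insert x (A - {k})" "x \<notin> A - {k}" using insert.hyps by auto
    then show "(\<Sum>l\<in>insert x A - {k}. T k l) = T k x + (\<Sum>l\<in>A - {k}. T k l)"
      using insert.hyps by simp
  qed
  also have "(\<Sum>l\<in>A. T x l) + \<dots> = (\<Sum>k\<in>A. T x k + T k x) + (\<Sum>k\<in>A. \<Sum>l\<in>A - {k}. T k l)"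
    by (simp add: sum.distrib)
  finally have eq: "(\<Sum>k\<in>insert x A. \<Sum>l\<in>insert x A - {k}. T k l)
      = (\<Sum>k\<in>A. T x k + T k x) + (\<Sum>k\<in>A. \<Sum>l\<in>A - {k}. T k l)" .
  have Psum: "P (sum f B)" if "\<And>b. b \<in> B \<Longrightarrow> P (f b)" for f and B :: "'a set"
    using that by (induction B rule: infinite_finite_induct) (auto intro: Padd P0)
  have "P (\<Sum>k\<in>A. T x k + T k x)"
  proof (rule Psum)
    fix k assume "k \<in> A"
    then show "P (T x k + T k x)" using insert.hyps(2) by (intro insert.prems) auto
  qed
  moreover have "P (\<Sum>k\<in>A. \<Sum>l\<in>A - {k}. T k l)" by (rule insert.IH) (use insert.prems in auto)
  ultimately show ?case unfolding eq using Padd by blast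
qed (simp add: P0)

section \<open>The differential on monomials, relators and cosets\<close>

context diagram
begin

abbreviation "fd x \<equiv> free_differential K x"

text \<open>The differential of a monomial in the reference order, as given by
  \<open>core\<close>.\<close>

definition dchi :: "state \<Rightarrow> oedge list \<Rightarrow> 'r::comm_ring_1 \<Rightarrow> 'r free_chain" where
  "dchi s m c = (\<Sum>k\<in>{..<n} - s. \<Sum>m'\<leftarrow>ym s k m. chi (insert k s) m' (of_int (sigma s k) * c))"

lemma dchi_scale: "dchi s m (r * c) = fscale r (dchi s m c)"
proof -
  have *: "of_int x * (r * c) = r * (of_int x * c)" for x by (rule mult.left_commute)
  show ?thesis
    unfolding dchi_def free_chain.scale_sum_right sum_list_scale chi_scale[symmetric] * ..
qed

lemma dgen_fac:
  fixes c :: "'r::comm_ring_1"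
  assumes s: "s \<in> states K i" and m: "indep s m" "set m \<subseteq> oedges" and cl: "distinct cl" "set cl = circles K s"
  shows "eqv (Suc i) (dgen K (s, map (fac s m) cl)) (dchi s m (of_int (lsgn (Ls s) cl) :: 'r))"
  unfolding dgen_def dchi_def fst_conv snd_conv
proof (rule eqv_sum)
  fix k assume "k \<in> {..<n} - s"
  then show "eqv (Suc i) (pd s k (map (fac s m) cl))
      (\<Sum>m'\<leftarrow>ym s k m. chi (insert k s) m' (of_int (sigma s k) * of_int (lsgn (Ls s) cl) :: 'r))"
    using core[OF s _ _ m cl, of k] by simp
qed

text \<open>An orientation is determined by the direction of one edge, so every factor
  \<open>X\<close> comes from an oriented edge; \<open>m\<close> collects one for each of
  them.\<close>

lemma word_fac:
  assumes w: "w \<in> words K s"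
  obtains m where "indep s m" "set m \<subseteq> oedges" "w = map (fac s m) (map circ w)"
    "distinct (map circ w)" "set (map circ w) = circles K s"
proof -
  define isX where "isX f \<longleftrightarrow> (\<exists>C p. f = X_at C p)" for f
  define rep where "rep f = (case f of One_at C \<Rightarrow> undefined | X_at C p \<Rightarrow> (let e = (SOME e. e \<in> C) in (e, e \<in> p)))" for f
  have d: "distinct (map circ w)" "set (map circ w) = circles K s"
    and o: "\<And>C p. X_at C p \<in> set w \<Longrightarrow> orientation K s C p"
    using w by (auto simp: words_def)
  have rep: "fst (rep f) \<in> circ f" "rep f \<in> oedges" "cls s (fst (rep f)) = circ f"
      "f = X_at (circ f) (ori s (rep f))" if f: "f \<in> set w" "isX f" for f
  proof -
    obtain C p where Cp: "f = X_at C p" using f(2) by (auto simp: isX_def)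
    have C: "C \<in> circles K s" using f(1) d(2) Cp by force
    then obtain e where "e \<in> edges K" "C = cls s e" by (rule circlesE)
    then have ne: "(SOME e. e \<in> C) \<in> C" using self_cls by (intro someI[of "\<lambda>e. e \<in> C"]) auto
    have r: "rep (X_at C p) = ((SOME e. e \<in> C), (SOME e. e \<in> C) \<in> p)" by (simp add: rep_def Let_def)
    show "fst (rep f) \<in> circ f" using ne by (simp add: r Cp)
    show "rep f \<in> oedges" "cls s (fst (rep f)) = circ f"
      using circles_cls[OF C ne] by (simp_all add: r Cp oedges_iff)
    show "f = X_at (circ f) (ori s (rep f))"
      using orientation_unique[OF o[of C p] C ne] f(1) by (simp add: r Cp)
  qed
  define m where "m = map rep (filter isX w)"
  have "map (\<lambda>x. cls s (fst x)) m = map circ (filter isX w)"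
    unfolding m_def map_map using rep(3) by (intro map_cong) auto
  moreover have "distinct (map circ (filter isX w))" using d(1) by (rule distinct_map_filter)
  ultimately have "indep s m" by (simp add: indep_def)
  moreover have "set m \<subseteq> oedges" using rep(2) by (auto simp: m_def)
  moreover have "fac s m (circ f) = f" if f: "f \<in> set w" for f
  proof -
    obtain p q where pq: "w = p @ f # q" using f by (meson split_list)
    have other: "fst (rep g) \<notin> circ f" if g: "g \<in> set p \<union> set q" "isX g" for g
    proof
      assume a: "fst (rep g) \<in> circ f"
      have gw: "g \<in> set w" using g pq by auto
      have "circ f \<in> circles K s" using d(2) f by auto
      from circles_cls[OF this a] have "circ f = circ g" using rep(3)[OF gw g(2)] by simp
      then show False using d(1) g(1) unfolding pq by auto
    qed
    have m': "m = map rep (filter isX p) @ (if isX f then [rep f] else []) @ map rep (filter isX q)"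
      by (simp add: m_def pq)
    have "fac s m (circ f) = fac s ((if isX f then [rep f] else []) @ map rep (filter isX q)) (circ f)"
      unfolding m' by (rule fac_skip) (use other in auto)
    moreover have "fac s (map rep (filter isX q)) (circ f) = One_at (circ f)"
      by (rule fac_Nil) (use other in auto)
    ultimately show ?thesis
      using rep[OF f] by (cases f) (auto simp: fac_Cons isX_def)
  qed
  then have "w = map (fac s m) (map circ w)" by (simp add: map_idI)
  ultimately show ?thesis using that d by blast
qed

lemma dchi_mset:
  assumes "mset m = mset m'" shows "dchi s m c = dchi s m' c"
proof -
  have *: "mset (x # m) = mset (x # m')" for x using assms by simp
  have "(\<Sum>m'\<leftarrow>ym s k m. chi t m' z) = (\<Sum>m'\<leftarrow>ym s k m'. chi t m' z)" for k t z
    unfolding ym_def by (simp add: chi_mset[OF assms] chi_mset[OF *])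
  then show ?thesis unfolding dchi_def by (intro sum.cong refl) simp
qed

lemma dchi_rev:
  fixes c :: "'r::comm_ring_1"
  assumes s: "s \<in> states K i" and x: "x \<in> oedges" and m: "set m \<subseteq> oedges"
  shows "eqv (Suc i) (dchi s (rev_oe x # m) c) (- dchi s (x # m) c)"
  unfolding dchi_def sum_negf[symmetric]
proof (rule eqv_sum)
  fix k assume k: "k \<in> {..<n} - s"
  define t where "t = insert k s"
  define z where "z = of_int (sigma s k) * c"
  have t: "t \<in> states K (Suc i)" using k s by (auto simp: t_def intro!: insert_states)
  have 0: "eqv (Suc i) (chi t (rev_oe x # m) z) (- chi t (x # m) z)" by (rule chi_rev[OF t x m])
  have 1: "eqv (Suc i) (chi t (u # rev_oe x # m) z) (- chi t (u # x # m) z)" if "u \<in> oedges" for u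
    using chi_rev[OF t x, of "u # m" z] that m by (simp add: chi_swap[of t u])
  have o: "UR k \<in> oedges" "LL k \<in> oedges" using k cor_edges by (auto simp: oedges_iff)
  show "eqv (Suc i) (\<Sum>m'\<leftarrow>ym s k (rev_oe x # m). chi (insert k s) m' (of_int (sigma s k) * c))
      (- (\<Sum>m'\<leftarrow>ym s k (x # m). chi (insert k s) m' (of_int (sigma s k) * c)))"
    unfolding t_def[symmetric] z_def[symmetric] ym_def
    using 0 eqv_add[OF 1[OF o(1)] 1[OF o(2)]] by simp
qed

text \<open>Needed because such monomials are 0 by definition. A merge keeps \<open>x\<close> and
  \<open>y\<close> on one circle; a split may separate them, but then the new factor
  \<open>UR k\<close> or \<open>LL k\<close> shares a circle with one of them.\<close>

lemma dchi_dep: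
  assumes s: "s \<in> states K i" and m: "\<not> indep s m"
  shows "dchi s m c = 0"
proof -
  obtain x y m0 where xy: "mset m = mset (x # y # m0)" "st.sc s x y"
  proof -
    show ?thesis
      using not_distinct_map_mset[OF m[unfolded indep_def]] that by (auto simp: cls_eq)
  qed
  have "(\<Sum>m'\<leftarrow>ym s k (x # y # m0). chi (insert k s) m' z) = 0" if k: "k \<in> {..<n} - s" for k z
  proof -
    define t where "t = insert k s"
    have adj: "adj k s t" unfolding t_def using k by (intro adj_insert) auto
    have kn: "k < n" using k by simp
    show ?thesis
    proof (cases "tw s k")
      case True
      then have "st.sc t x y" using adj_merge(4)[OF adj True] xy(2) by blast
      then show ?thesis using True by (simp add: ym_def chi_dep t_def)
    next
      case False
      have "chi t (u # x # y # m0) z = 0" if tw: "tw t k" and u: "u \<in> {UR k, LL k}" for u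
      proof -
        have "bet K t u \<in> {UL k, LR k}" using u bet_UL_LR[OF kn, of t] by auto
        moreover have "st.sc t u (bet K t u)" by simp
        ultimately have "st.sc t u (UL k) \<or> st.sc t u (LR k)" by (auto simp del: st.sc_be)
        moreover have "st.sc t x y \<or> st.sc t x (UL k) \<and> st.sc t y (LR k) \<or> st.sc t x (LR k) \<and> st.sc t y (UL k)"
          using adj_merge(4)[OF adj_sym[OF adj] tw] xy(2) by blast
        ultimately consider "st.sc t x y" | "st.sc t u x" | "st.sc t u y"
          by (meson st.sc_sym st.sc_trans)
        then show ?thesis
        proof cases
          case 1
          have "chi t (u # x # y # m0) z = chi t (x # y # u # m0) z" by (rule chi_mset) simp
          then show ?thesis using chi_dep[OF 1] by simp
        next
          case 2 then show ?thesis by (rule chi_dep)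
        next
          case 3
          have "chi t (u # x # y # m0) z = chi t (u # y # x # m0) z" by (rule chi_mset) simp
          then show ?thesis using chi_dep[OF 3] by simp
        qed
      qed
      then show ?thesis using False by (simp add: ym_def t_def[symmetric])
    qed
  qed
  then show ?thesis unfolding dchi_mset[OF xy(1)] unfolding dchi_def by (intro sum.neutral) blast
qed

text \<open>The differential of a word depends on its order only through \<open>lsgn\<close>, which
  settles the permutations; the two words of an orientation relator are monomials that differ by the
  reversal of one entry.\<close>

lemma fd_relators:
  fixes r :: "'r::comm_ring_1 free_chain"
  assumes "r \<in> relators K i" shows "eqv (Suc i) (fd r) 0"
  using assms unfolding relators_def
proof (elim UnE CollectE exE conjE)
  fix s w \<sigma>
  assume r: "r = single (s, permute_list \<sigma> w) 1 - single (s, w) (of_int (sign \<sigma>))"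
    and g: "(s, w) \<in> generators K i" and \<sigma>: "\<sigma> permutes {..<length w}"
  have s: "s \<in> states K i" and w: "w \<in> words K s" using g by (auto simp: generators_def)
  obtain m where m: "indep s m" "set m \<subseteq> oedges" "w = map (fac s m) (map circ w)"
    "distinct (map circ w)" "set (map circ w) = circles K s" using word_fac[OF w] .
  define cl where "cl = map circ w"
  have w_cl: "w = map (fac s m) cl" using m(3) by (simp add: cl_def)
  have cl: "distinct cl" "set cl = circles K s" using m(4,5) by (simp_all add: cl_def)
  have \<sigma>': "\<sigma> permutes {..<length cl}" using \<sigma> by (simp add: cl_def)
  have pw: "permute_list \<sigma> w = map (fac s m) (permute_list \<sigma> cl)"
    unfolding w_cl by (rule permute_list_map[OF \<sigma>'])
  have cl': "distinct (permute_list \<sigma> cl)" "set (permute_list \<sigma> cl) = circles K s"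
    using cl \<sigma>' by simp_all
  have "eqv (Suc i) (dgen K (s, permute_list \<sigma> w) - fscale (of_int (sign \<sigma>)) (dgen K (s, w)))
     (dchi s m (of_int (lsgn (Ls s) (permute_list \<sigma> cl))) - fscale (of_int (sign \<sigma>)) (dchi s m (of_int (lsgn (Ls s) cl) :: 'r)))"
    unfolding pw unfolding w_cl by (intro eqv_diff eqv_scale dgen_fac s m cl cl')
  also have "\<dots> = 0"
    unfolding dchi_scale[symmetric] lsgn_permute[OF Ls(2) \<sigma>'] by simp
  finally show ?thesis by (simp add: r fd_diff fd_single)
next
  fix s u C p v
  assume r: "r = single (s, u @ X_at C (C - p) # v) 1 + single (s, u @ X_at C p # v) 1"
    and g: "(s, u @ X_at C p # v) \<in> generators K i"
  define w where "w = u @ X_at C p # v"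
  have s: "s \<in> states K i" and w: "w \<in> words K s" using g by (auto simp: generators_def w_def)
  obtain m where m: "indep s m" "set m \<subseteq> oedges" "w = map (fac s m) (map circ w)"
    "distinct (map circ w)" "set (map circ w) = circles K s" using word_fac[OF w] .
  have C: "C \<in> circles K s" using m(5) by (auto simp: w_def)
  have fC: "fac s m C = X_at C p" "map (fac s m) (map circ u) = u" "map (fac s m) (map circ v) = v"
    using m(3) by (auto simp: w_def)
  obtain x m0 where x: "mset m = mset (x # m0)" "fst x \<in> C" "\<forall>y\<in>set m0. fst y \<notin> C"
  proof -
    have "\<not> (\<forall>x\<in>set m. fst x \<notin> C)" using fC(1) fac_Nil[of m C s] by auto
    then show ?thesis using extract_circle[OF m(1) C] that by blast
  qed
  have i: "indep s (x # m0)" using m(1) indep_mset[OF x(1)] by simp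
  have o: "x \<in> oedges" "set m0 \<subseteq> oedges" using m(2) mset_eq_setD[OF x(1)] by auto
  have i': "indep s (rev_oe x # m0)" using i indep_ob[of s "rev_oe x" x m0] by simp
  have o': "set (x # m0) \<subseteq> oedges" "set (rev_oe x # m0) \<subseteq> oedges" using o by (auto simp: oedges_iff)
  define cl where "cl = map circ w"
  have cl: "distinct cl" "set cl = circles K s" using m(4,5) by (simp_all add: cl_def)
  have f: "fac s (x # m0) X = fac s m X" if "X \<in> circles K s" for X
    using fac_mset[OF m(1) x(1) that] by simp
  have wx: "w = map (fac s (x # m0)) cl"
  proof -
    have "map (fac s m) cl = map (fac s (x # m0)) cl" using f cl(2) by simp
    with m(3)[folded cl_def] show ?thesis by (rule trans)
  qed
  have "p = ori s x" using fC(1) f[OF C] x(2) by (simp add: fac_Cons)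
  moreover have "cls s (fst x) = C" using circles_cls[OF C x(2)] by simp
  ultimately have oC: "ori s (rev_oe x) = C - p" by (simp add: ori_rev)
  have same: "fac s (rev_oe x # m0) X = fac s (x # m0) X" if X: "X \<in> circles K s" "X \<noteq> C" for X
  proof -
    have "fst x \<notin> X" using circles_cls[OF X(1), of "fst x"] X(2) \<open>cls s (fst x) = C\<close> by auto
    then show ?thesis by (simp add: fac_Cons)
  qed
  have npq: "C \<notin> circ ` set u" "C \<notin> circ ` set v" using m(4) by (auto simp: w_def)
  have cuv: "circ ` set u \<subseteq> circles K s" "circ ` set v \<subseteq> circles K s" using m(5) by (auto simp: w_def)
  have side: "map (fac s (rev_oe x # m0)) (map circ y) = y"
    if y: "C \<notin> circ ` set y" "circ ` set y \<subseteq> circles K s" "map (fac s m) (map circ y) = y" for y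
  proof -
    have "map (fac s (rev_oe x # m0)) (map circ y) = map (fac s m) (map circ y)"
    proof (rule map_cong[OF refl])
      fix X assume "X \<in> set (map circ y)"
      then have "X \<in> circles K s" "X \<noteq> C" using y(1,2) by auto
      then show "fac s (rev_oe x # m0) X = fac s m X" using same f by simp
    qed
    then show ?thesis using y(3) by (rule trans)
  qed
  note mu = side[OF npq(1) cuv(1) fC(2)] and mv = side[OF npq(2) cuv(2) fC(3)]
  have wr: "u @ X_at C (C - p) # v = map (fac s (rev_oe x # m0)) cl"
    using mu mv x(2) by (simp only: cl_def w_def map_append list.map factor.sel fac_Cons fst_rev_oe if_True oC)
  have "eqv (Suc i) (dgen K (s, u @ X_at C (C - p) # v) + dgen K (s, w))
     (dchi s (rev_oe x # m0) (of_int (lsgn (Ls s) cl)) + dchi s (x # m0) (of_int (lsgn (Ls s) cl) :: 'r))"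
    unfolding wr unfolding wx by (intro eqv_add dgen_fac s i i' o o' cl)
  also have "eqv (Suc i) \<dots> (- dchi s (x # m0) (of_int (lsgn (Ls s) cl)) + dchi s (x # m0) (of_int (lsgn (Ls s) cl) :: 'r))"
    by (intro eqv_add eqv_refl dchi_rev s o)
  finally show ?thesis by (simp add: r fd_add fd_single w_def)
qed

lemma fd_eqv:
  assumes "eqv i x y" shows "eqv (Suc i) (fd x) (fd y)"
proof -
  have "free_chain.span (relators K i) \<subseteq> {x. fd x \<in> free_chain.span (relators K (Suc i))}"
  proof (rule free_chain.span_minimal)
    show "relators K i \<subseteq> {x. fd x \<in> free_chain.span (relators K (Suc i))}"
      using fd_relators[unfolded eqv_zero] by blast
    show "free_chain.subspace {x. fd x \<in> free_chain.span (relators K (Suc i))}"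
      by (rule free_chain.subspaceI)
        (auto simp: fd_add fd_scale intro: free_chain.span_zero free_chain.span_add free_chain.span_scale)
  qed
  then show ?thesis using assms unfolding eqv_def fd_diff[symmetric] by blast
qed

lemma fd_chi:
  assumes s: "s \<in> states K i" and m: "set m \<subseteq> oedges"
  shows "eqv (Suc i) (fd (chi s m c)) (dchi s m c)"
proof (cases "indep s m")
  case True
  have "eqv (Suc i) (fscale c (dgen K (s, map (fac s m) (Ls s)))) (fscale c (dchi s m (of_int (lsgn (Ls s) (Ls s)))))"
    by (intro eqv_scale dgen_fac s True m Ls)
  then show ?thesis
    using True lsgn_self[OF Ls(2)[of s]] by (simp add: chi_def fd_single flip: dchi_scale)
next
  case False
  then show ?thesis by (simp add: chi_def dchi_dep[OF s])
qed

lemma ym_oedges: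
  assumes "k < n" "set m \<subseteq> oedges" "m' \<in> set (ym s k m)" shows "set m' \<subseteq> oedges"
proof -
  have "UR k \<in> oedges" "LL k \<in> oedges" using cor_edges[OF assms(1)] by (simp_all add: oedges_iff)
  then show ?thesis using assms(2,3) by (auto simp: ym_def simp del: split_paired_All split: if_splits)
qed

lemma sum_list_sum: "(\<Sum>x\<leftarrow>xs. \<Sum>l\<in>B. f x l) = (\<Sum>l\<in>B. \<Sum>x\<leftarrow>xs. (f x l :: 'b::comm_monoid_add))"
  by (induction xs) (simp_all add: sum.distrib)

lemma fd_dchi:
  fixes c :: "'r::comm_ring_1"
  assumes s: "s \<in> states K i" and m: "set m \<subseteq> oedges"
  shows "eqv (Suc (Suc i)) (fd (dchi s m c)) 0"
proof -
  define A where "A = {..<n} - s"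
  have "eqv (Suc (Suc i)) (fd (dchi s m c))
     (\<Sum>k\<in>A. \<Sum>m'\<leftarrow>ym s k m. dchi (insert k s) m' (of_int (sigma s k) * c))"
    unfolding dchi_def[of s] A_def[symmetric] fd_sum fd_sum_list
  proof (intro eqv_sum eqv_sum_list)
    fix k m' assume k: "k \<in> A" and m': "m' \<in> set (ym s k m)"
    show "eqv (Suc (Suc i)) (fd (chi (insert k s) m' (of_int (sigma s k) * c)))
        (dchi (insert k s) m' (of_int (sigma s k) * c))"
      by (rule fd_chi) (use k m' m s in \<open>auto simp: A_def intro!: insert_states dest: ym_oedges\<close>)
  qed
  also have "(\<Sum>k\<in>A. \<Sum>m'\<leftarrow>ym s k m. dchi (insert k s) m' (of_int (sigma s k) * c))
     = (\<Sum>k\<in>A. \<Sum>l\<in>A - {k}. path2 s k l m c)"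
  proof (rule sum.cong[OF refl])
    fix k assume "k \<in> A"
    have A: "{..<n} - insert k s = A - {k}" by (auto simp: A_def)
    show "(\<Sum>m'\<leftarrow>ym s k m. dchi (insert k s) m' (of_int (sigma s k) * c)) = (\<Sum>l\<in>A - {k}. path2 s k l m c)"
      unfolding dchi_def A sum_list_sum path2_def by (simp add: mult_ac)
  qed
  \<comment> \<open>The ordered pairs \<open>(k, l)\<close> and \<open>(l, k)\<close> are the two
    paths around one face.\<close>
  also have "eqv (Suc (Suc i)) \<dots> 0"
  proof (rule sum_off_diagonal[where P = "\<lambda>x. eqv (Suc (Suc i)) x 0"])
    show "eqv (Suc (Suc i)) (x + y) 0" if "eqv (Suc (Suc i)) x 0" "eqv (Suc (Suc i)) y 0" for x y :: "'r free_chain"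
      using eqv_add[OF that] by simp
    show "eqv (Suc (Suc i)) (path2 s k l m c + path2 s l k m c) 0" if "k \<in> A" "l \<in> A" "k \<noteq> l" for k l
    proof -
      interpret cube_face K s k l i by unfold_locales (use that s in \<open>auto simp: A_def\<close>)
      show ?thesis by (rule face[OF m])
    qed
  qed (simp_all add: A_def)
  finally show ?thesis .
qed

lemma dgen_dchi:
  assumes "g \<in> generators K i"
  obtains s m and z :: int where "s \<in> states K i" "set m \<subseteq> oedges"
    "eqv (Suc i) (dgen K g) (dchi s m (of_int z :: 'r::comm_ring_1))"
proof -
  obtain s w where g: "g = (s, w)" by (cases g)
  then have s: "s \<in> states K i" and w: "w \<in> words K s" using assms by (auto simp: generators_def)
  obtain m where m: "indep s m" "set m \<subseteq> oedges" "w = map (fac s m) (map circ w)"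
    "distinct (map circ w)" "set (map circ w) = circles K s" using word_fac[OF w] .
  have "eqv (Suc i) (dgen K (s, map (fac s m) (map circ w))) (dchi s m (of_int (lsgn (Ls s) (map circ w)) :: 'r))"
    by (rule dgen_fac[OF s m(1,2,4,5)])
  then show ?thesis using that[OF s m(2)] m(3) g by metis
qed

lemma fd_fd:
  fixes x :: "'r::comm_ring_1 free_chain"
  assumes x: "x \<in> free_chains K i"
  shows "eqv (Suc (Suc i)) (fd (fd x)) 0"
proof -
  have fd: "fd x = (\<Sum>g\<in>Poly_Mapping.keys x. fscale (Poly_Mapping.lookup x g) (dgen K g))"
    by (rule fd_eq_sum) auto
  have "eqv (Suc (Suc i)) (\<Sum>g\<in>Poly_Mapping.keys x. fscale (Poly_Mapping.lookup x g) (fd (dgen K g)))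
    (\<Sum>g\<in>Poly_Mapping.keys x. fscale (Poly_Mapping.lookup x g) 0)"
  proof (intro eqv_sum eqv_scale)
    fix g assume "g \<in> Poly_Mapping.keys x"
    then have "g \<in> generators K i" using x by (auto simp: free_chains_def)
    then obtain s m and z :: int where z: "s \<in> states K i" "set m \<subseteq> oedges"
      "eqv (Suc i) (dgen K g) (dchi s m (of_int z :: 'r))" by (rule dgen_dchi)
    show "eqv (Suc (Suc i)) (fd (dgen K g :: 'r free_chain)) 0"
      by (rule eqv_trans[OF fd_eqv[OF z(3)] fd_dchi[OF z(1,2)]])
  qed
  then show ?thesis unfolding fd fd_sum fd_scale by simp
qed

lemma free_chains_closed:
  "0 \<in> free_chains K i" "x \<in> free_chains K i \<Longrightarrow> y \<in> free_chains K i \<Longrightarrow> x + y \<in> free_chains K i"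
  "x \<in> free_chains K i \<Longrightarrow> fscale r x \<in> free_chains K i"
  using Poly_Mapping.keys_add[of x y] keys_fscale[of r x] unfolding free_chains_def by auto

lemma free_chains_sum: "(\<And>a. a \<in> A \<Longrightarrow> f a \<in> free_chains K i) \<Longrightarrow> sum f A \<in> free_chains K i"
  by (induction A rule: infinite_finite_induct) (auto intro: free_chains_closed)

lemma free_chains_sum_list: "(\<And>a. a \<in> set xs \<Longrightarrow> f a \<in> free_chains K i) \<Longrightarrow> (\<Sum>a\<leftarrow>xs. f a) \<in> free_chains K i"
  by (induction xs) (auto intro: free_chains_closed)

lemma chi_free: "s \<in> states K i \<Longrightarrow> set m \<subseteq> oedges \<Longrightarrow> chi s m c \<in> free_chains K i"
  using fac_generators[of s i "Ls s" m] Ls[of s] by (auto simp: chi_def free_chains_def)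

lemma dchi_free:
  assumes "s \<in> states K i" "set m \<subseteq> oedges" shows "dchi s m c \<in> free_chains K (Suc i)"
  unfolding dchi_def
  by (intro free_chains_sum free_chains_sum_list chi_free)
    (use assms in \<open>auto intro!: insert_states dest: ym_oedges\<close>)

text \<open>Modulo relations the differential is a combination of monomials, whose words are known
  to be generators.\<close>

lemma fd_free:
  fixes x :: "'r::comm_ring_1 free_chain"
  assumes x: "x \<in> free_chains K i"
  shows "\<exists>z\<in>free_chains K (Suc i). eqv (Suc i) (fd x) z"
proof -
  have "\<exists>z\<in>free_chains K (Suc i). eqv (Suc i) (dgen K g) (z :: 'r free_chain)" if "g \<in> Poly_Mapping.keys x" for g
  proof -
    have "g \<in> generators K i" using x that by (auto simp: free_chains_def)
    then obtain s m and z :: int where z: "s \<in> states K i" "set m \<subseteq> oedges"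
      "eqv (Suc i) (dgen K g) (dchi s m (of_int z :: 'r))" by (rule dgen_dchi)
    then show ?thesis using dchi_free by blast
  qed
  then obtain f where f: "\<And>g. g \<in> Poly_Mapping.keys x \<Longrightarrow> f g \<in> free_chains K (Suc i)"
    "\<And>g. g \<in> Poly_Mapping.keys x \<Longrightarrow> eqv (Suc i) (dgen K g) (f g :: 'r free_chain)" by metis
  have "fd x = (\<Sum>g\<in>Poly_Mapping.keys x. fscale (Poly_Mapping.lookup x g) (dgen K g))"
    by (rule fd_eq_sum) auto
  moreover have "eqv (Suc i) \<dots> (\<Sum>g\<in>Poly_Mapping.keys x. fscale (Poly_Mapping.lookup x g) (f g))"
    by (intro eqv_sum eqv_scale f)
  moreover have "(\<Sum>g\<in>Poly_Mapping.keys x. fscale (Poly_Mapping.lookup x g) (f g)) \<in> free_chains K (Suc i)"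
    by (intro free_chains_sum free_chains_closed f)
  ultimately show ?thesis by auto
qed

lemma coset_eqv: "coset K i x = {y. eqv i y x}"
  by (simp add: coset_def eqv_def)

lemma coset_cong: "eqv i x y \<Longrightarrow> coset K i x = coset K i y"
  unfolding coset_eqv using eqv_trans eqv_sym by blast

text \<open>By \<open>fd_eqv\<close> all cosets in the union defining \<open>differential\<close>
  coincide.\<close>

lemma differential_coset: "differential K i (coset K i x) = coset K (Suc i) (fd x)"
proof -
  have "coset K (Suc i) (fd y) = coset K (Suc i) (fd x)" if "y \<in> coset K i x" for y
    by (rule coset_cong[OF fd_eqv]) (use that in \<open>simp add: coset_eqv\<close>)
  moreover have "x \<in> coset K i x" by (simp add: coset_eqv)
  ultimately show ?thesis unfolding differential_def by blast
qed

end

theorem theorem2: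
  fixes K :: vdiagram and i :: nat and c :: "'r::comm_ring_1 chain"
  assumes "virtual_diagram K" and "c \<in> chain_space K i"
  shows "differential K i c \<in> chain_space K (Suc i)
    \<and> differential K (Suc i) (differential K i c) = zero_chain K (Suc (Suc i))"
proof -
  interpret diagram K by unfold_locales (rule assms(1))
  obtain x where x: "x \<in> free_chains K i" "c = coset K i x"
    using assms(2) by (auto simp: chain_space_def)
  obtain z where z: "z \<in> free_chains K (Suc i)" "eqv (Suc i) (fd x) z"
    using fd_free[OF x(1)] by blast
  have "differential K i c = coset K (Suc i) z"
    unfolding x(2) differential_coset by (rule coset_cong[OF z(2)])
  then have "differential K i c \<in> chain_space K (Suc i)"
    using z(1) by (simp add: chain_space_def)
  moreover have "differential K (Suc i) (differential K i c) = zero_chain K (Suc (Suc i))"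
    unfolding x(2) differential_coset zero_chain_def by (rule coset_cong[OF fd_fd[OF x(1)]])
  ultimately show ?thesis ..
qed

end
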